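(* Let $d,a,b,c_1,\dots,c_n$ be positive integers with $d\mid q-1$, let $\lambda_1,\dots,\lambda_n\in\kappa^\times$, and let $S_{C,\lambda}$ be the $n$-dimensional affine hypersurface over $\kappa$ defined by $$y^d=\Big(\prod_{i=1}^nx_i^{c_i}\Big)\Big(1-\sum_{i=1}^nx_i\Big)^a\Big(\prod_{i=1}^nx_i-\sum_{i=1}^n\lambda_i\prod_{j\neq i}x_j\Big)^b,$$ with $\mu_d$ acting by $\xi\cdot(x_1,\dots,x_n,y)=(x_1,\dots,x_n,\xi y)$. For $m\in\mathbb{Z}/d\mathbb{Z}$ and $r\ge1$ define a function over $\kappa_r$ by $$f_r(\lambda)=F_C^{(n)}\left({\overline{\varphi_{d,r}}^{m(a+nb+\sum_{i=1}^nc_i)};\overline{\varphi_{d,r}}^{mb}\atop\overline{\varphi_{d,r}}^{m(b+c_1)},\dots,\overline{\varphi_{d,r}}^{m(b+c_n)}};\lambda_1,\dots,\lambda_n\right).$$ Suppose that $\gcd(d,a)=\gcd(d,b)=1$. Then $$L(S_{C,\lambda},\chi^m;t)=\begin{cases}\dfrac{1}{1-q^nt}&(m=0),\\ \exp\Big(\sum_{r=1}^\infty(-1)^nJ_C^r\cdot f_r(\lambda)\dfrac{t^r}{r}\Big)&(m\neq0),\end{cases}$$ where $J_C=j(\varphi_d^{ma},\varphi_d^{m(b+c_1)},\dots,\varphi_d^{m(b+c_n)})$.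
   Context: $\kappa$ is a finite field with $q$ elements of characteristic $p$. $\widehat{\kappa^\times}=\mathrm{Hom}(\kappa^\times,\overline{\mathbb{Q}}^\times)$ is the group of multiplicative characters, $\varepsilon$ the trivial character, $\overline{\eta}=\eta^{-1}$; every $\eta\in\widehat{\kappa^\times}$ (including $\varepsilon$) is extended to $\kappa$ by $\eta(0)=0$. $\delta(\eta)=1$ if $\eta=\varepsilon$ and $0$ otherwise. Fix a non-trivial additive character $\psi\in\mathrm{Hom}(\kappa,\overline{\mathbb{Q}}^\times)$. Put $$g(\eta)=-\sum_{x\in\kappa^\times}\psi(x)\eta(x),\quad g^\circ(\eta)=q^{\delta(\eta)}g(\eta),\quad j(\eta_1,\dots,\eta_k)=(-1)^{k-1}\sum_{x_i\in\kappa^\times,\ x_1+\cdots+x_k=1}\ \prod_{i=1}^k\eta_i(x_i)\ (k\ge 2),$$ $$(\alpha)_\nu=\frac{g(\alpha\nu)}{g(\alpha)},\qquad(\alpha)_\nu^\circ=\frac{g^\circ(\alpha\nu)}{g^\circ(\alpha)},$$ $$F_C^{(n)}\left({\alpha;\beta\atop\gamma_1,\dots,\gamma_n};\lambda_1,\dots,\lambda_n\right)=\frac{1}{(1-q)^n}\sum_{\nu_1,\dots,\nu_n\in\widehat{\kappa^\times}}\frac{(\alpha)_{\nu_1\cdots\nu_n}(\beta)_{\nu_1\cdots\nu_n}}{(\gamma_1)^\circ_{\nu_1}\cdots(\gamma_n)^\circ_{\nu_n}(\varepsilon)^\circ_{\nu_1}\cdots(\varepsilon)^\circ_{\nu_n}}\nu_1(\lambda_1)\cdots\nu_n(\lambda_n).$$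 $\kappa_r\subset\overline{\kappa}$ is the degree $r$ extension of $\kappa$; functions over $\kappa_r$ are defined by the same formulas with $\kappa,q$ replaced by $\kappa_r,q^r$ and with any non-trivial additive character of $\kappa_r$ (the values of $F_C^{(n)}$ do not depend on this choice). $\mu_d\subset\kappa^\times$ is the group of $d$th roots of unity. Fix a generator $\varphi$ of $\widehat{\kappa^\times}$ and put $\varphi_d=\varphi^{(q-1)/d}$, $\chi=\varphi|_{\mu_d}$ (so $\widehat{\mu_d}=\{\chi^m\mid m\in\mathbb{Z}/d\mathbb{Z}\}$) and $\varphi_{d,r}=\varphi_d\circ N_{\kappa_r/\kappa}\in\widehat{\kappa_r^\times}$, where $N_{\kappa_r/\kappa}$ is the norm map. For a variety $V$ over $\kappa$ with an action over $\kappa$ of a finite abelian group $G$, with $F$ the $q$-Frobenius on $V(\overline{\kappa})$, and for $\theta\in\mathrm{Hom}(G,\overline{\mathbb{Q}}^\times)$, $$N_r(V;\theta)=\frac{1}{\#G}\sum_{g\in G}\theta(g)\,\#\{x\in V(\overline{\kappa})\mid F^r(x)=g(x)\},\qquad L(V,\theta;t)=\exp\Big(\sum_{r=1}^\infty\frac{N_r(V;\theta)}{r}t^r\Big)\in\overline{\mathbb{Q}}[[t]].$$ *)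

theory Defs
  imports
    "HOL-Algebra.Algebraic_Closure_Type"
    "HOL-Computational_Algebra.Formal_Power_Series"
    "HOL-Library.FuncSet"
    "HOL-Library.Cardinality"
begin

type_synonym qbar = "rat alg_closure"

text \<open>
  Characters are defined over an arbitrary finite subfield \<open>K\<close> of a field type, so that the same
  definitions serve for \<open>\<kappa>\<close> (a type, \<open>K = UNIV\<close>) and for its extensions (subsets of the algebraic
  closure).
\<close>

text \<open>
  A multiplicative character of \<open>K\<close> is represented by its extension by zero, both at \<open>0\<close> and outside
  \<open>K\<close>; this makes the representation unique, so that equality of characters is equality of functions.
\<close>

definition mult_chars :: "'f::field set \<Rightarrow> ('f \<Rightarrow> qbar) set" where
  "mult_chars K = {\<eta>. (\<forall>x\<in>K - {0}. \<eta> x \<noteq> 0) \<and>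
                      (\<forall>x\<in>K - {0}. \<forall>y\<in>K - {0}. \<eta> (x * y) = \<eta> x * \<eta> y) \<and>
                      (\<forall>x. x \<notin> K - {0} \<longrightarrow> \<eta> x = 0)}"

definition triv_char :: "'f::field set \<Rightarrow> 'f \<Rightarrow> qbar" where
  "triv_char K = (\<lambda>x. if x \<in> K - {0} then 1 else 0)"

definition char_mult :: "('f \<Rightarrow> qbar) \<Rightarrow> ('f \<Rightarrow> qbar) \<Rightarrow> 'f \<Rightarrow> qbar" where
  "char_mult \<eta> \<theta> = (\<lambda>x. \<eta> x * \<theta> x)"

text \<open>The case distinction keeps the value \<open>0\<close> at \<open>0\<close> also for exponent \<open>0\<close>.\<close>

definition char_pow :: "('f \<Rightarrow> qbar) \<Rightarrow> int \<Rightarrow> 'f \<Rightarrow> qbar" where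
  "char_pow \<eta> k = (\<lambda>x. if \<eta> x = 0 then 0 else \<eta> x powi k)"

definition char_inv :: "('f \<Rightarrow> qbar) \<Rightarrow> 'f \<Rightarrow> qbar" where
  "char_inv \<eta> = (\<lambda>x. inverse (\<eta> x))"

definition generates_mult_chars :: "'f::field set \<Rightarrow> ('f \<Rightarrow> qbar) \<Rightarrow> bool" where
  "generates_mult_chars K \<phi> \<longleftrightarrow>
     \<phi> \<in> mult_chars K \<and> (\<forall>\<eta>\<in>mult_chars K. \<exists>k. \<eta> = char_pow \<phi> k)"

definition nontriv_add_char :: "'f::field set \<Rightarrow> ('f \<Rightarrow> qbar) \<Rightarrow> bool" where
  "nontriv_add_char K \<psi> \<longleftrightarrow>
     (\<forall>x\<in>K. \<psi> x \<noteq> 0) \<and> (\<forall>x\<in>K. \<forall>y\<in>K. \<psi> (x + y) = \<psi> x * \<psi> y) \<and> (\<exists>x\<in>K. \<psi> x \<noteq> 1)"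

definition gauss :: "'f::field set \<Rightarrow> ('f \<Rightarrow> qbar) \<Rightarrow> ('f \<Rightarrow> qbar) \<Rightarrow> qbar" where
  "gauss K \<psi> \<eta> = - (\<Sum>x\<in>K - {0}. \<psi> x * \<eta> x)"

definition gauss0 :: "'f::field set \<Rightarrow> ('f \<Rightarrow> qbar) \<Rightarrow> ('f \<Rightarrow> qbar) \<Rightarrow> qbar" where
  "gauss0 K \<psi> \<eta> = of_nat (card K) ^ (if \<eta> = triv_char K then 1 else 0) * gauss K \<psi> \<eta>"

definition jacobi :: "'f::field set \<Rightarrow> nat \<Rightarrow> (nat \<Rightarrow> 'f \<Rightarrow> qbar) \<Rightarrow> qbar" where
  "jacobi K k \<eta> =
     (-1) ^ (k - 1) *
     (\<Sum>x \<in> {x \<in> {..<k} \<rightarrow>\<^sub>E (K - {0}). (\<Sum>i<k. x i) = 1}. \<Prod>i<k. \<eta> i (x i))"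

definition poch ::
  "'f::field set \<Rightarrow> ('f \<Rightarrow> qbar) \<Rightarrow> ('f \<Rightarrow> qbar) \<Rightarrow> ('f \<Rightarrow> qbar) \<Rightarrow> qbar" where
  "poch K \<psi> \<alpha> \<nu> = gauss K \<psi> (char_mult \<alpha> \<nu>) / gauss K \<psi> \<alpha>"

definition poch0 ::
  "'f::field set \<Rightarrow> ('f \<Rightarrow> qbar) \<Rightarrow> ('f \<Rightarrow> qbar) \<Rightarrow> ('f \<Rightarrow> qbar) \<Rightarrow> qbar" where
  "poch0 K \<psi> \<alpha> \<nu> = gauss0 K \<psi> (char_mult \<alpha> \<nu>) / gauss0 K \<psi> \<alpha>"

definition lauricella_C ::
  "'f::field set \<Rightarrow> ('f \<Rightarrow> qbar) \<Rightarrow> nat \<Rightarrow> ('f \<Rightarrow> qbar) \<Rightarrow> ('f \<Rightarrow> qbar) \<Rightarrow>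
   (nat \<Rightarrow> 'f \<Rightarrow> qbar) \<Rightarrow> (nat \<Rightarrow> 'f) \<Rightarrow> qbar" where
  "lauricella_C K \<psi> n \<alpha> \<beta> \<gamma> lam =
     1 / (1 - of_nat (card K)) ^ n *
     (\<Sum>\<nu> \<in> {..<n} \<rightarrow>\<^sub>E mult_chars K.
        (poch K \<psi> \<alpha> (\<lambda>x. \<Prod>i<n. \<nu> i x) * poch K \<psi> \<beta> (\<lambda>x. \<Prod>i<n. \<nu> i x)) /
        ((\<Prod>i<n. poch0 K \<psi> (\<gamma> i) (\<nu> i)) * (\<Prod>i<n. poch0 K \<psi> (triv_char K) (\<nu> i))) *
        (\<Prod>i<n. \<nu> i (lam i)))"

text \<open>The extension of degree \<open>r\<close> of the finite field \<open>'k\<close> inside its algebraic closure.\<close>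

definition ext :: "nat \<Rightarrow> 'k::finite_field alg_closure set" where
  "ext r = {x. x ^ (CARD('k) ^ r) = x}"

text \<open>\<open>ext r\<close> is the subfield of the algebraic closure with \<open>CARD('k) ^ r\<close> elements.\<close>

lemma of_nat_CARD_eq_0: "of_nat CARD('k) = (0 :: 'k::finite_field)"
proof -
  have "(\<Sum>x\<in>UNIV. x) = (\<Sum>x\<in>UNIV. x + (1::'k))"
    by (rule sum.reindex_bij_witness[of _ "\<lambda>x. x + 1" "\<lambda>x. x - 1"]) auto
  then show ?thesis
    by (simp add: sum.distrib)
qed

lemma CARD_finite_field_ge_2: "2 \<le> CARD('k::finite_field)"
proof -
  have "card {0, 1 :: 'k} \<le> CARD('k)"
    by (intro card_mono) auto
  then show ?thesis
    by simp
qed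

lemma degree_monic_linear_power_diff:
  fixes x :: "'a::field"
  assumes "n > 0"
  shows "degree ([:x, 1:] ^ n - monom 1 n - [:z:]) < n"
proof -
  have "degree ([:x, 1:] ^ n) = n"
    by (simp add: degree_power_eq)
  moreover have "lead_coeff ([:x, 1:] ^ n) = 1"
    by (simp add: lead_coeff_power)
  ultimately have "coeff ([:x, 1:] ^ n - monom 1 n - [:z:]) i = 0" if "i \<ge> n" for i
    using that assms by (cases "i = n") (auto simp: coeff_eq_0 coeff_pCons split: nat.splits)
  then show ?thesis
    using assms by (meson degree_lessI)
qed

lemma frobenius_add:
  fixes x y :: "'k::finite_field alg_closure"
  shows "(x + y) ^ CARD('k) = x ^ CARD('k) + y ^ CARD('k)"
proof -
  define q where "q = CARD('k)"
  have q: "q > 0"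
    by (simp add: q_def finite_UNIV_card_ge_0)
  have card: "card (range (to_ac :: 'k \<Rightarrow> _)) = q"
    unfolding q_def by (rule card_image[OF inj_to_ac])
  have power: "to_ac u ^ q = to_ac u" for u :: 'k
    by (simp add: q_def finite_field_power_card_eq_same flip: to_ac_power)
  have key: "p = 0" if "degree p < q" "\<And>u :: 'k. poly p (to_ac u) = 0"
    for p :: "'k alg_closure poly"
  proof (rule poly_eqI_degree[of "range to_ac"])
    show "poly p u = poly 0 u" if "u \<in> range to_ac" for u
      using that \<open>\<And>u :: 'k. poly p (to_ac u) = 0\<close> by auto
  qed (use that(1) card q in auto)
  have 1: "(x + to_ac v) ^ q = x ^ q + to_ac v" for x and v :: 'k
  proof -
    define p where "p = [:to_ac v, 1:] ^ q - monom 1 q - [:to_ac v:]"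
    have "p = 0"
    proof (rule key)
      show "degree p < q"
        unfolding p_def by (rule degree_monic_linear_power_diff[OF q])
      show "poly p (to_ac u) = 0" for u
        using power[of "u + v"] power[of u] by (simp add: p_def poly_monom add.commute)
    qed
    then have "poly p x = 0"
      by simp
    then show ?thesis
      by (simp add: p_def poly_monom algebra_simps)
  qed
  define p where "p = [:x, 1:] ^ q - monom 1 q - [:x ^ q:]"
  have "p = 0"
  proof (rule key)
    show "degree p < q"
      unfolding p_def by (rule degree_monic_linear_power_diff[OF q])
    show "poly p (to_ac u) = 0" for u
      using 1[of x u] power[of u] by (simp add: p_def poly_monom)
  qed
  then have "poly p y = 0"
    by simp
  then show ?thesis
    by (simp add: p_def poly_monom q_def algebra_simps)
qed

lemma frobenius_power_add:
  fixes x y :: "'k::finite_field alg_closure"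
  shows "(x + y) ^ (CARD('k) ^ r) = x ^ (CARD('k) ^ r) + y ^ (CARD('k) ^ r)"
proof (induction r)
  case (Suc r)
  have "z ^ (CARD('k) ^ Suc r) = (z ^ (CARD('k) ^ r)) ^ CARD('k)" for z :: "'k alg_closure"
    by (simp add: mult.commute flip: power_mult)
  then show ?case
    by (simp add: Suc.IH frobenius_add del: power_Suc)
qed simp

lemma ext_subfield:
  fixes x y :: "'k::finite_field alg_closure"
  shows "0 \<in> ext r" "1 \<in> ext r"
    and "x \<in> ext r \<Longrightarrow> y \<in> ext r \<Longrightarrow> x + y \<in> ext r"
    and "x \<in> ext r \<Longrightarrow> y \<in> ext r \<Longrightarrow> x * y \<in> ext r"
    and "x \<in> ext r \<Longrightarrow> - x \<in> ext r"
    and "x \<in> ext r \<Longrightarrow> inverse x \<in> ext r"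
    and "to_ac u \<in> ext r"
proof -
  have pos: "CARD('k) ^ r > 0"
    by (simp add: finite_UNIV_card_ge_0)
  show "0 \<in> ext r" "1 \<in> ext r"
    using pos by (auto simp: ext_def)
  show "x \<in> ext r \<Longrightarrow> y \<in> ext r \<Longrightarrow> x + y \<in> ext r"
    by (simp add: ext_def frobenius_power_add)
  show "x \<in> ext r \<Longrightarrow> y \<in> ext r \<Longrightarrow> x * y \<in> ext r"
    by (simp add: ext_def power_mult_distrib)
  show "x \<in> ext r \<Longrightarrow> inverse x \<in> ext r"
    by (simp add: ext_def power_inverse)
  show "to_ac u \<in> ext r"
    by (simp add: ext_def finite_field_power_card_power_eq_same flip: to_ac_power)
  show "- x \<in> ext r" if "x \<in> ext r"
    using frobenius_power_add[of x "- x" r] that pos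
    by (simp add: ext_def zero_power eq_neg_iff_add_eq_0 add.commute)
qed

lemma card_ext:
  assumes "r \<ge> 1"
  shows "card (ext r :: 'k::finite_field alg_closure set) = CARD('k) ^ r"
proof -
  define N where "N = CARD('k) ^ r"
  have "N \<ge> 2"
    using CARD_finite_field_ge_2[where ?'k = 'k] assms self_le_power[of "CARD('k)" r]
    unfolding N_def by linarith
  define p :: "'k alg_closure poly" where "p = monom 1 N - monom 1 1"
  have deg: "degree p = N"
    using \<open>N \<ge> 2\<close> degree_add_eq_left[of "- monom 1 1" "monom (1 :: 'k alg_closure) N"]
    by (simp add: p_def degree_monom_eq)
  then have "p \<noteq> 0"
    using \<open>N \<ge> 2\<close> by auto
  have "of_nat N = (0 :: 'k alg_closure)"
    using assms of_nat_CARD_eq_0[where ?'k = 'k]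
    by (simp add: N_def power_0_left flip: to_ac_of_nat)
  then have "pderiv p = - 1"
    by (simp add: p_def pderiv_diff pderiv_monom monom_0 one_pCons)
  then have deriv: "poly (pderiv p) x \<noteq> 0" for x
    by simp
  have simple: "order x p = 1" if "poly p x = 0" for x
  proof -
    have "\<not> 2 \<le> order x p"
    proof
      assume "2 \<le> order x p"
      then have "[:-x, 1:] ^ 2 dvd p"
        using order_divides by blast
      then obtain u where "p = [:-x, 1:] * ([:-x, 1:] * u)"
        by (metis dvdE power2_eq_square mult.assoc)
      then have "poly (pderiv p) x = 0"
        by (simp add: pderiv_mult del: mult_pCons_left)
      with deriv show False
        by blast
    qed
    moreover have "order x p \<noteq> 0"
      using that \<open>p \<noteq> 0\<close> by (simp add: order_root)
    ultimately show ?thesis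
      by linarith
  qed
  obtain A where A: "size A = degree p" "p = smult (lead_coeff p) (\<Prod>x\<in>#A. [:-x, 1:])"
    using alg_closed_imp_factorization[OF \<open>p \<noteq> 0\<close>] by blast
  have "proots p = proots (\<Prod>x\<in>#A. [:-x, 1:])"
    by (subst A(2), subst proots_smult) (use \<open>p \<noteq> 0\<close> in auto)
  also have "\<dots> = A"
    by (induction A) (simp_all add: proots_mult prod_mset_zero_iff image_iff del: mult_pCons_left)
  finally have "size (proots p) = N"
    using A(1) deg by simp
  also have "size (proots p) = (\<Sum>x | poly p x = 0. order x p)"
    using \<open>p \<noteq> 0\<close> by (simp add: size_multiset_overloaded_eq)
  also have "\<dots> = (\<Sum>x | poly p x = 0. 1)"
    using simple by (intro sum.cong) auto
  also have "{x. poly p x = 0} = ext r"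
    by (auto simp: p_def ext_def poly_monom N_def)
  finally show ?thesis
    by (simp add: N_def)
qed

lemma ext_1: "ext 1 = range (to_ac :: 'k::finite_field \<Rightarrow> _)"
proof (rule sym, rule card_subset_eq)
  have "card (ext 1 :: 'k alg_closure set) > 0"
    by (simp add: card_ext finite_UNIV_card_ge_0 del: One_nat_def)
  then show "finite (ext 1 :: 'k alg_closure set)"
    using card_gt_0_iff by blast
  show "card (range (to_ac :: 'k \<Rightarrow> _)) = card (ext 1 :: 'k alg_closure set)"
    by (simp add: card_ext card_image[OF inj_to_ac] del: One_nat_def)
qed (auto intro: ext_subfield)

text \<open>The norm from \<open>ext r\<close> to \<open>'k\<close>, as the product of the Galois conjugates.\<close>

definition ext_norm :: "nat \<Rightarrow> 'k::finite_field alg_closure \<Rightarrow> 'k" where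
  "ext_norm r x = of_ac (\<Prod>i<r. x ^ (CARD('k) ^ i))"

lemma to_ac_ext_norm:
  fixes x :: "'k::finite_field alg_closure"
  assumes "x \<in> ext r"
  shows "to_ac (ext_norm r x) = (\<Prod>i<r. x ^ (CARD('k) ^ i))"
proof -
  define q where "q = CARD('k)"
  have "x * (\<Prod>i<r. x ^ (q ^ i)) ^ q = x * (\<Prod>i<r. x ^ (q ^ Suc i))"
    by (simp add: prod_power_distrib mult.commute flip: power_mult)
  also have "\<dots> = (\<Prod>i<Suc r. x ^ (q ^ i))"
    by (subst prod.lessThan_Suc_shift) simp
  also have "\<dots> = x * (\<Prod>i<r. x ^ (q ^ i))"
    using assms by (simp add: ext_def q_def)
  finally have "(\<Prod>i<r. x ^ (q ^ i)) ^ q = (\<Prod>i<r. x ^ (q ^ i))"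
    by (cases "x = 0"; cases r) (auto simp: prod.lessThan_Suc_shift power_0_left q_def)
  then have "(\<Prod>i<r. x ^ (q ^ i)) \<in> ext 1"
    by (simp add: ext_def q_def)
  then show ?thesis
    unfolding ext_norm_def ext_1 q_def by (rule to_ac_of_ac)
qed

definition lift_char :: "nat \<Rightarrow> ('k::finite_field \<Rightarrow> qbar) \<Rightarrow> 'k alg_closure \<Rightarrow> qbar" where
  "lift_char r \<eta> = (\<lambda>x. if x \<in> ext r then \<eta> (ext_norm r x) else 0)"

definition char_of_order :: "('k::finite_field \<Rightarrow> qbar) \<Rightarrow> nat \<Rightarrow> 'k \<Rightarrow> qbar" where
  "char_of_order \<phi> d = char_pow \<phi> (int ((CARD('k) - 1) div d))"

text \<open>
  A variety over \<open>\<kappa>\<close> with an action of a finite group enters only through its set \<open>V\<close> of geometric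
  points, the Frobenius \<open>F\<close> on \<open>V\<close> and the action \<open>act\<close> of \<open>G\<close> on \<open>V\<close>.
\<close>

definition N_points ::
  "'v set \<Rightarrow> ('v \<Rightarrow> 'v) \<Rightarrow> 'g set \<Rightarrow> ('g \<Rightarrow> 'v \<Rightarrow> 'v) \<Rightarrow> ('g \<Rightarrow> qbar) \<Rightarrow> nat \<Rightarrow> qbar" where
  "N_points V F G act \<theta> r =
     1 / of_nat (card G) *
     (\<Sum>g\<in>G. \<theta> g * of_nat (card {x \<in> V. (F ^^ r) x = act g x}))"

text \<open>\<open>\<Sum>\<^bsub>r\<ge>1\<^esub> s\<^sub>r t\<^sup>r / r\<close>, followed by the exponential (the constant term is zero).\<close>

definition exp_gen :: "(nat \<Rightarrow> qbar) \<Rightarrow> qbar fps" where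
  "exp_gen s = fps_exp 1 oo Abs_fps (\<lambda>r. if r = 0 then 0 else s r / of_nat r)"

definition L_function ::
  "'v set \<Rightarrow> ('v \<Rightarrow> 'v) \<Rightarrow> 'g set \<Rightarrow> ('g \<Rightarrow> 'v \<Rightarrow> 'v) \<Rightarrow> ('g \<Rightarrow> qbar) \<Rightarrow> qbar fps" where
  "L_function V F G act \<theta> = exp_gen (N_points V F G act \<theta>)"

definition roots_of_unity :: "nat \<Rightarrow> 'k::field set" where
  "roots_of_unity d = {\<xi>. \<xi> ^ d = 1}"

text \<open>
  The geometric points of \<open>S\<^bsub>C,\<lambda>\<^esub>\<close>. Coordinates are indexed by \<open>{..<n}\<close>; extensional functions make
  the tuple \<open>x\<close> unique.
\<close>

definition S_C ::
  "nat \<Rightarrow> nat \<Rightarrow> nat \<Rightarrow> nat \<Rightarrow> (nat \<Rightarrow> nat) \<Rightarrow> (nat \<Rightarrow> 'k::field) \<Rightarrow>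
   ((nat \<Rightarrow> 'k alg_closure) \<times> 'k alg_closure) set" where
  "S_C n d a b c lam =
     {(x, y). x \<in> {..<n} \<rightarrow>\<^sub>E UNIV \<and>
        y ^ d = (\<Prod>i<n. x i ^ c i) * (1 - (\<Sum>i<n. x i)) ^ a *
          ((\<Prod>i<n. x i) - (\<Sum>i<n. to_ac (lam i) * (\<Prod>j\<in>{..<n} - {i}. x j))) ^ b}"

definition frob ::
  "nat \<Rightarrow> (nat \<Rightarrow> 'k::finite_field alg_closure) \<times> 'k alg_closure \<Rightarrow>
   (nat \<Rightarrow> 'k alg_closure) \<times> 'k alg_closure" where
  "frob n = (\<lambda>(x, y). ((\<lambda>i\<in>{..<n}. x i ^ CARD('k)), y ^ CARD('k)))"

definition scale_y ::
  "'k::field \<Rightarrow> 'x \<times> 'k alg_closure \<Rightarrow> 'x \<times> 'k alg_closure" where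
  "scale_y \<xi> = (\<lambda>(x, y). (x, to_ac \<xi> * y))"

end

theory Submission
  imports Defs
begin

text \<open>
  The statement is an identity between the point counts \<open>N\<^sub>r\<close> for \<open>r \<ge> 1\<close>, since both sides are
  exponentials of generating series. Write \<open>h\<close> for the right-hand side of the equation of the
  hypersurface, \<open>\<kappa>\<^sub>r\<close> for \<open>ext r\<close> and \<open>\<phi>\<^sub>d\<^sub>,\<^sub>r\<close> for the lift of \<open>\<phi>\<^sub>d\<close> along the norm.

  A point \<open>(x, y)\<close> on which the \<open>r\<close>-th power of Frobenius acts like \<open>\<xi> \<in> \<mu>\<^sub>d\<close> has \<open>x\<close> in \<open>\<kappa>\<^sub>r\<close>. If
  \<open>h x \<noteq> 0\<close>, Frobenius multiplies every \<open>d\<close>-th root \<open>y\<close> of \<open>h x\<close> by the same \<open>\<xi>\<close>, namely the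
  \<open>(q - 1)/d\<close>-th power of the norm of \<open>h x\<close>; if \<open>h x = 0\<close>, each \<open>\<xi>\<close> has exactly one point. The average
  against \<open>\<chi>\<^sup>m\<close> therefore turns \<open>N\<^sub>r\<close> into the sum of \<open>\<phi>\<^sub>d\<^sub>,\<^sub>r\<^sup>m (h x)\<close> over \<open>x\<close>
  (\<open>twisted_count_over_value\<close>). For \<open>m = 0\<close> every \<open>x\<close> contributes \<open>1\<close>, so \<open>N\<^sub>r = q\<^sup>n\<^sup>r\<close>.

  For \<open>m \<noteq> 0\<close> put \<open>A = \<phi>\<^sub>d\<^sub>,\<^sub>r\<^sup>m\<^sup>a\<close>, \<open>B = \<phi>\<^sub>d\<^sub>,\<^sub>r\<^sup>m\<^sup>b\<close> and \<open>\<chi>\<^sub>i = \<phi>\<^sub>d\<^sub>,\<^sub>r\<close> to the power \<open>m (b + c\<^sub>i)\<close>. Pulling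
  \<open>\<Prod>x\<^sub>i\<close> out of the last factor of \<open>h\<close> gives
  \<open>N\<^sub>r = \<Sum> \<Prod>\<chi>\<^sub>i(x\<^sub>i) A(1 - \<Sum>x\<^sub>i) B(1 - \<Sum>\<lambda>\<^sub>i/x\<^sub>i)\<close>, summed over nonzero \<open>x\<^sub>i\<close>. The conditions on the gcds make
      \<open>A\<close>
  and \<open>B\<close> nontrivial, hence Fourier transforms of their inverses; this separates the variables. A
  multiplicative Fourier expansion of \<open>\<psi>(- t \<lambda>\<^sub>i/x\<^sub>i)\<close> then leaves only Gauss sums
  (\<open>char_sum_eq_gauss_series\<close>). The same series of Gauss sums is obtained from \<open>F\<^sub>C\<close> by the reflection
  formula, and comparing the constants gives \<open>N\<^sub>r = (- 1)\<^sup>n j\<^sub>r F\<^sub>C\<close>, where \<open>j\<^sub>r\<close> is the Jacobi sum of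
  \<open>A, \<chi>\<^sub>1, \<dots>, \<chi>\<^sub>n\<close> over \<open>\<kappa>\<^sub>r\<close> (\<open>char_sum_eq_lauricella\<close>).

  It remains to see that \<open>j\<^sub>r = J\<^sup>r\<close> (\<open>jacobi_lift\<close>). Jacobi sums are quotients of Gauss sums, so this is
  the theorem of Hasse and Davenport (\<open>hasse_davenport\<close>). Its proof attaches to a monic polynomial over
  \<open>\<kappa>\<close> the value of \<open>\<psi>\<close> at the sum of its roots times the value of \<open>\<eta>\<close> at their product. This weight is
  multiplicative, its sum over all monic polynomials of a fixed degree \<open>\<ge> 2\<close> is zero, and Newton's
  identities relate these sums to the Gauss sums over all the fields \<open>\<kappa>\<^sub>r\<close>.
\<close>

section \<open>Roots of polynomials over algebraically closed fields\<close>

lemma sum_order_eq_degree: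
  fixes p :: "'a::alg_closed_field poly"
  assumes "p \<noteq> 0"
  shows "(\<Sum>x | poly p x = 0. order x p) = degree p"
proof -
  obtain A where A: "size A = degree p" "p = smult (lead_coeff p) (\<Prod>x\<in>#A. [:-x, 1:])"
    using alg_closed_imp_factorization[OF assms] by blast
  have "proots p = proots (\<Prod>x\<in>#A. [:-x, 1:])"
    by (subst A(2), subst proots_smult) (use assms in auto)
  also have "\<dots> = A"
    by (induction A) (simp_all add: proots_mult prod_mset_zero_iff image_iff del: mult_pCons_left)
  finally have "size (proots p) = degree p"
    using A(1) by simp
  then show ?thesis
    using assms by (simp add: size_multiset_overloaded_eq)
qed

lemma card_roots_of_unity_alg_closed:
  assumes "n > 0"
  shows "card {z :: 'a::{alg_closed_field,field_char_0}. z ^ n = 1} = n"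
proof -
  define p :: "'a poly" where "p = monom 1 n - 1"
  have deg: "degree p = n"
    using assms degree_add_eq_left[of "- 1" "monom (1 :: 'a) n"]
    by (simp add: p_def degree_monom_eq)
  have "p \<noteq> 0" using deg assms by auto
  have pd: "poly (pderiv p) z \<noteq> 0" if "poly p z = 0" for z
  proof -
    have "z \<noteq> 0" using that assms by (auto simp: p_def poly_monom power_0_left)
    then show ?thesis using assms by (simp add: p_def pderiv_diff pderiv_monom poly_monom)
  qed
  then have sq: "rsquarefree p"
    by (auto simp: rsquarefree_roots)
  have "n = (\<Sum>x | poly p x = 0. order x p)"
    using sum_order_eq_degree[OF \<open>p \<noteq> 0\<close>] deg by simp
  also have "\<dots> = (\<Sum>x | poly p x = 0. 1)"
  proof (intro sum.cong refl)
    fix x assume "x \<in> {x. poly p x = 0}"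
    then show "order x p = 1"
      using sq \<open>p \<noteq> 0\<close> order_root[of p x] unfolding rsquarefree_def by force
  qed
  also have "{x. poly p x = 0} = {z. z ^ n = 1}"
    by (auto simp: p_def poly_monom)
  finally show ?thesis by simp
qed

lemma card_roots_of_unity_le:
  assumes "n > 0"
  shows "finite {z :: 'a::field. z ^ n = 1}" "card {z :: 'a::field. z ^ n = 1} \<le> n"
proof -
  define p :: "'a poly" where "p = monom 1 n - 1"
  have deg: "degree p = n"
    using assms degree_add_eq_left[of "- 1" "monom (1 :: 'a) n"]
    by (simp add: p_def degree_monom_eq)
  then have "p \<noteq> 0" using assms by auto
  moreover have "{x. poly p x = 0} = {z. z ^ n = 1}"
    by (auto simp: p_def poly_monom)
  ultimately show "finite {z :: 'a::field. z ^ n = 1}" "card {z :: 'a::field. z ^ n = 1} \<le> n"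
    using poly_roots_finite[of p] card_poly_roots_bound[of p] deg by auto
qed

text \<open>
  Otherwise all \<open>n\<close> of the \<open>n\<close>-th roots of unity would be roots of \<open>X\<^sup>i - 1\<close>. This supplies the values of
  a multiplicative character that separates a given element from \<open>1\<close>.
\<close>

lemma ex_root_of_unity_separating:
  assumes "0 < i" "i < n"
  shows "\<exists>z :: 'a::{alg_closed_field,field_char_0}. z ^ n = 1 \<and> z ^ i \<noteq> 1"
proof (rule ccontr)
  assume "\<not> ?thesis"
  then have "{z :: 'a. z ^ n = 1} \<subseteq> {z. z ^ i = 1}" by auto
  then have "n \<le> i"
    using card_mono[OF card_roots_of_unity_le(1)[OF assms(1)]] card_roots_of_unity_le(2)[OF assms(1)]
      card_roots_of_unity_alg_closed[of n, where 'a='a] assms by (metis le_trans less_trans)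
  with assms show False by simp
qed

section \<open>Multiplicative characters of a finite field\<close>

locale finite_subfield =
  fixes K :: "'f::field set"
  assumes finite_K: "finite K"
    and zero_in: "0 \<in> K" and one_in: "1 \<in> K"
    and add_in: "x \<in> K \<Longrightarrow> y \<in> K \<Longrightarrow> x + y \<in> K"
    and mult_in: "x \<in> K \<Longrightarrow> y \<in> K \<Longrightarrow> x * y \<in> K"
    and uminus_in: "x \<in> K \<Longrightarrow> - x \<in> K"
    and inverse_in: "x \<in> K \<Longrightarrow> inverse x \<in> K"
begin

lemma diff_in: "x \<in> K \<Longrightarrow> y \<in> K \<Longrightarrow> x - y \<in> K"
  using add_in[of x "- y"] uminus_in by simp

lemma divide_in: "x \<in> K \<Longrightarrow> y \<in> K \<Longrightarrow> x / y \<in> K"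
  using mult_in[of x "inverse y"] inverse_in by (simp add: field_simps)

lemma sum_in: "(\<And>i. i \<in> I \<Longrightarrow> h i \<in> K) \<Longrightarrow> sum h I \<in> K"
  by (induction I rule: infinite_finite_induct) (auto simp: zero_in add_in)

lemma prod_in: "(\<And>i. i \<in> I \<Longrightarrow> h i \<in> K) \<Longrightarrow> prod h I \<in> K"
  by (induction I rule: infinite_finite_induct) (auto simp: one_in mult_in)

lemma power_in: "x \<in> K \<Longrightarrow> x ^ i \<in> K"
  by (induction i) (auto simp: one_in mult_in)

lemma finite_units: "finite (K - {0})"
  using finite_K by simp

lemma card_units: "card (K - {0}) = card K - 1"
  using zero_in finite_K by simp

lemma card_ge_2: "card K \<ge> 2"
proof -
  have "card {0, 1 :: 'f} \<le> card K"
    by (intro card_mono) (auto simp: finite_K zero_in one_in)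
  then show ?thesis by simp
qed

lemma units_cyclic: "\<exists>g \<in> K - {0}. \<forall>x \<in> K - {0}. \<exists>i::nat. x = g ^ i"
proof -
  define R :: "'f ring" where
    "R = \<lparr>carrier = K, monoid.mult = (*), one = 1, ring.zero = 0, add = (+)\<rparr>"
  have inv_add: "\<exists>y\<in>K. x + y = 0" if "x \<in> K" for x
    using uminus_in[OF that] by (intro bexI[of _ "- x"]) auto
  have inv_mult: "\<exists>y\<in>K. x * y = 1" if "x \<in> K" "x \<noteq> 0" for x
    using inverse_in[OF that(1)] that(2) by (intro bexI[of _ "inverse x"]) auto
  interpret R: field R
    by unfold_locales
       (use inv_add inv_mult in \<open>auto simp: R_def Units_def algebra_simps zero_in one_in add_in mult_in\<close>)
  have pow: "x [^]\<^bsub>R\<^esub> (i::nat) = x ^ i" for x i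
    by (induction i) (auto simp: R_def nat_pow_def mult.commute)
  have "finite (carrier R)" using finite_K by (simp add: R_def)
  from R.finite_field_mult_group_has_gen[OF this]
  obtain g where "g \<in> K - {0}" "K - {0} = {g [^]\<^bsub>R\<^esub> i |i::nat. True}"
    by (auto simp: R_def carrier_mult_of)
  then show ?thesis unfolding pow by blast
qed

lemma unit_power_card:
  assumes "x \<in> K - {0}"
  shows "x ^ (card K - 1) = 1"
proof -
  have "(\<Prod>y\<in>K - {0}. y) = (\<Prod>y\<in>K - {0}. x * y)"
    by (rule prod.reindex_bij_witness[of _ "\<lambda>y. x * y" "\<lambda>y. y / x"])
       (use assms in \<open>auto simp: mult_in divide_in\<close>)
  also have "\<dots> = x ^ (card K - 1) * (\<Prod>y\<in>K - {0}. y)"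
    by (simp add: prod.distrib card_units)
  finally show ?thesis using finite_units by (simp add: prod_zero_iff)
qed

lemma units_generator:
  obtains g where "g \<in> K - {0}" "bij_betw (\<lambda>i. g ^ i) {..<card K - 1} (K - {0})"
proof -
  obtain g where g: "g \<in> K - {0}" "\<And>x. x \<in> K - {0} \<Longrightarrow> \<exists>i::nat. x = g ^ i"
    using units_cyclic by blast
  have im: "(\<lambda>i. g ^ i) ` {..<card K - 1} = K - {0}"
  proof (intro equalityI subsetI)
    fix x assume "x \<in> K - {0}"
    then obtain i where "x = g ^ i" using g by blast
    also have "\<dots> = g ^ (i mod (card K - 1) + (card K - 1) * (i div (card K - 1)))"
      by (simp del: mult.commute)
    also have "\<dots> = g ^ (i mod (card K - 1))"
      using unit_power_card[OF g(1)] by (simp only: power_add power_mult power_one mult_1_right)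
    finally have "x = g ^ (i mod (card K - 1))" .
    then show "x \<in> (\<lambda>i. g ^ i) ` {..<card K - 1}" using card_ge_2 by auto
  qed (use g power_in in auto)
  moreover have "inj_on (\<lambda>i. g ^ i) {..<card K - 1}"
    by (rule eq_card_imp_inj_on) (use im card_units in auto)
  ultimately show ?thesis using that[of g] g(1) by (auto simp: bij_betw_def)
qed

lemma mult_charsD:
  assumes "\<eta> \<in> mult_chars K"
  shows "x \<in> K - {0} \<Longrightarrow> \<eta> x \<noteq> 0" "x \<in> K \<Longrightarrow> y \<in> K \<Longrightarrow> \<eta> (x * y) = \<eta> x * \<eta> y"
    "x \<notin> K - {0} \<Longrightarrow> \<eta> x = 0" "\<eta> 0 = 0" "\<eta> 1 = 1"
    "x \<in> K \<Longrightarrow> \<eta> (inverse x) = inverse (\<eta> x)"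
    "x \<in> K \<Longrightarrow> y \<in> K \<Longrightarrow> \<eta> (x / y) = \<eta> x / \<eta> y"
    "x \<in> K \<Longrightarrow> \<eta> (x ^ i) = (if x = 0 \<and> i = 0 then 1 else \<eta> x ^ i)"
proof -
  show 1: "x \<in> K - {0} \<Longrightarrow> \<eta> x \<noteq> 0" for x using assms by (auto simp: mult_chars_def)
  show 3: "x \<notin> K - {0} \<Longrightarrow> \<eta> x = 0" for x using assms by (auto simp: mult_chars_def)
  show 4: "\<eta> 0 = 0" using 3 by auto
  show 2: "x \<in> K \<Longrightarrow> y \<in> K \<Longrightarrow> \<eta> (x * y) = \<eta> x * \<eta> y" for x y
    using assms 4 by (cases "x = 0 \<or> y = 0") (auto simp: mult_chars_def)
  show 5: "\<eta> 1 = 1" using 2[of 1 1] 1[of 1] one_in by simp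
  show 6: "\<eta> (inverse x) = inverse (\<eta> x)" if "x \<in> K" for x
  proof (cases "x = 0")
    case False
    then have "\<eta> x * \<eta> (inverse x) = 1" using 2[of x "inverse x"] 5 inverse_in that by simp
    then show ?thesis by (metis inverse_unique)
  qed (simp add: 4)
  show "x \<in> K \<Longrightarrow> y \<in> K \<Longrightarrow> \<eta> (x / y) = \<eta> x / \<eta> y"
    by (simp add: divide_inverse 2 6 inverse_in)
  show "x \<in> K \<Longrightarrow> \<eta> (x ^ i) = (if x = 0 \<and> i = 0 then 1 else \<eta> x ^ i)"
    by (induction i) (auto simp: 5 2 4 power_in)
qed

lemma mult_char_prod:
  assumes "\<eta> \<in> mult_chars K" "\<And>i. i \<in> I \<Longrightarrow> h i \<in> K"
  shows "\<eta> (\<Prod>i\<in>I. h i) = (\<Prod>i\<in>I. \<eta> (h i))"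
  using assms(2)
  by (induction I rule: infinite_finite_induct) (auto simp: mult_charsD[OF assms(1)] prod_in)

lemma mult_chars_eqI:
  assumes "\<eta> \<in> mult_chars K" "\<theta> \<in> mult_chars K" "\<And>x. x \<in> K - {0} \<Longrightarrow> \<eta> x = \<theta> x"
  shows "\<eta> = \<theta>"
proof
  show "\<eta> x = \<theta> x" for x
    using assms(3)[of x] mult_charsD(3)[OF assms(1), of x] mult_charsD(3)[OF assms(2), of x]
    by (cases "x \<in> K - {0}") auto
qed

lemma triv_in: "triv_char K \<in> mult_chars K"
  by (auto simp: mult_chars_def triv_char_def mult_in)

lemma char_mult_in: "\<eta> \<in> mult_chars K \<Longrightarrow> \<theta> \<in> mult_chars K \<Longrightarrow> char_mult \<eta> \<theta> \<in> mult_chars K"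
  by (auto simp: mult_chars_def char_mult_def)

lemma char_inv_in: "\<eta> \<in> mult_chars K \<Longrightarrow> char_inv \<eta> \<in> mult_chars K"
  by (auto simp: mult_chars_def char_inv_def)

lemma char_pow_in: "\<eta> \<in> mult_chars K \<Longrightarrow> char_pow \<eta> k \<in> mult_chars K"
  by (auto simp: mult_chars_def char_pow_def power_int_mult_distrib)

lemma char_prod_in:
  "finite I \<Longrightarrow> I \<noteq> {} \<Longrightarrow> (\<And>i. i \<in> I \<Longrightarrow> \<eta> i \<in> mult_chars K) \<Longrightarrow> (\<lambda>x. \<Prod>i\<in>I. \<eta> i x) \<in> mult_chars K"
proof (induction I rule: finite_ne_induct)
  case (insert i I)
  then have "char_mult (\<eta> i) (\<lambda>x. \<Prod>i\<in>I. \<eta> i x) \<in> mult_chars K"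
    by (intro char_mult_in) auto
  then show ?case using insert by (simp add: char_mult_def)
qed (auto simp: eta_contract_eq)

lemma char_inv_inv [simp]: "char_inv (char_inv \<eta>) = \<eta>"
  by (auto simp: char_inv_def fun_eq_iff)

lemma finite_mult_chars: "finite (mult_chars K)"
proof -
  obtain g where g: "g \<in> K - {0}" "bij_betw (\<lambda>i. g ^ i) {..<card K - 1} (K - {0})"
    by (rule units_generator)
  have "inj_on (\<lambda>\<eta>. \<eta> g) (mult_chars K)"
  proof (rule inj_onI)
    fix \<eta> \<theta> assume A: "\<eta> \<in> mult_chars K" "\<theta> \<in> mult_chars K" "\<eta> g = \<theta> g"
    show "\<eta> = \<theta>"
    proof (rule mult_chars_eqI[OF A(1,2)])
      fix x assume "x \<in> K - {0}"
      then obtain i where "x = g ^ i" using g(2) by (auto simp: bij_betw_def)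
      then show "\<eta> x = \<theta> x" using A g(1) by (simp add: mult_charsD)
    qed
  qed
  moreover have "(\<lambda>\<eta>. \<eta> g) ` mult_chars K \<subseteq> {z. z ^ (card K - 1) = 1}"
  proof clarify
    fix \<eta> assume A: "\<eta> \<in> mult_chars K"
    have "\<eta> (g ^ (card K - 1)) = 1" using unit_power_card[OF g(1)] A by (simp add: mult_charsD)
    then show "\<eta> g ^ (card K - 1) = 1" using A g(1) by (simp add: mult_charsD)
  qed
  moreover have "finite {z :: qbar. z ^ (card K - 1) = 1}"
    using card_ge_2 by (intro card_roots_of_unity_le(1)) auto
  ultimately show ?thesis by (metis finite_imageD finite_subset)
qed

text \<open>
  Characters separate the points of the cyclic group \<open>K - {0}\<close>: a generator may be sent to any root of
  unity of order dividing \<open>card K - 1\<close>. The two orthogonality relations rest on this.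
\<close>

lemma mult_chars_separate:
  assumes "x \<in> K - {0}" "x \<noteq> 1"
  obtains \<eta> where "\<eta> \<in> mult_chars K" "\<eta> x \<noteq> 1"
proof -
  define N where "N = card K - 1"
  have N: "N > 0" using card_ge_2 by (simp add: N_def)
  obtain g where g: "g \<in> K - {0}" "bij_betw (\<lambda>i. g ^ i) {..<N} (K - {0})"
    unfolding N_def by (rule units_generator)
  \<comment> \<open>the discrete logarithm to the base \<open>g\<close>\<close>
  define e where "e = the_inv_into {..<N} (\<lambda>i. g ^ i)"
  have e: "e y < N" "g ^ e y = y" if "y \<in> K - {0}" for y
    using that g(2) f_the_inv_into_f_bij_betw[OF g(2), of y] the_inv_into_into[of "\<lambda>i. g ^ i"
        "{..<N}" y]
    by (auto simp: e_def bij_betw_def)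
  have gN: "g ^ N = 1" using unit_power_card[OF g(1)] by (simp add: N_def)
  have gmod: "g ^ i = g ^ (i mod N)" for i
  proof -
    have "g ^ i = g ^ (i mod N + N * (i div N))" by simp
    also have "\<dots> = g ^ (i mod N)" by (simp only: power_add power_mult gN power_one mult_1_right)
    finally show ?thesis .
  qed
  have exp_mult: "e (y * z) = (e y + e z) mod N" if "y \<in> K - {0}" "z \<in> K - {0}" for y z
  proof -
    have yz: "y * z \<in> K - {0}" using that mult_in by auto
    have "g ^ e (y * z) = g ^ e y * g ^ e z"
      using e(2)[OF that(1)] e(2)[OF that(2)] e(2)[OF yz] by simp
    also have "\<dots> = g ^ (e y + e z)" by (rule power_add[symmetric])
    also have "\<dots> = g ^ ((e y + e z) mod N)" by (rule gmod)
    finally have "g ^ e (y * z) = g ^ ((e y + e z) mod N)" .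
    then show ?thesis
      using g(2) e(1)[OF yz] N by (auto simp: bij_betw_def dest!: inj_onD)
  qed
  have "e x \<noteq> 0" using e(2)[OF assms(1)] assms(2) by (metis power_0)
  then obtain w :: qbar where w: "w ^ N = 1" "w ^ e x \<noteq> 1"
    using ex_root_of_unity_separating[of "e x" N] e(1)[OF assms(1)] by auto
  have wmod: "w ^ (i mod N) = w ^ i" for i
  proof -
    have "w ^ i = w ^ (i mod N + N * (i div N))" by simp
    also have "\<dots> = w ^ (i mod N)" by (simp only: power_add power_mult w(1) power_one mult_1_right)
    finally show ?thesis by simp
  qed
  have "w \<noteq> 0" using w(1) N by (auto simp: power_0_left)
  define \<eta> where "\<eta> = (\<lambda>y. if y \<in> K - {0} then w ^ e y else 0)"
  have "\<eta> \<in> mult_chars K"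
    using \<open>w \<noteq> 0\<close> by (auto simp: mult_chars_def \<eta>_def mult_in exp_mult wmod power_add)
  moreover have "\<eta> x \<noteq> 1" using w(2) assms by (simp add: \<eta>_def)
  ultimately show ?thesis by (rule that)
qed

lemma sum_mult_char:
  assumes "\<eta> \<in> mult_chars K"
  shows "(\<Sum>x\<in>K - {0}. \<eta> x) = (if \<eta> = triv_char K then of_nat (card K) - 1 else 0)"
proof (cases "\<eta> = triv_char K")
  case True
  then have "(\<Sum>x\<in>K - {0}. \<eta> x) = (\<Sum>x\<in>K - {0}. 1)"
    by (intro sum.cong) (auto simp: triv_char_def)
  then show ?thesis using True card_units card_ge_2 by (simp add: of_nat_diff)
next
  case False
  then obtain y where y: "y \<in> K - {0}" "\<eta> y \<noteq> 1"
    using mult_chars_eqI[OF assms triv_in] by (auto simp: triv_char_def)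
  have "(\<Sum>x\<in>K - {0}. \<eta> x) = (\<Sum>x\<in>K - {0}. \<eta> (y * x))"
    by (rule sum.reindex_bij_witness[of _ "\<lambda>x. y * x" "\<lambda>x. x / y"])
       (use y in \<open>auto simp: mult_in divide_in\<close>)
  also have "\<dots> = \<eta> y * (\<Sum>x\<in>K - {0}. \<eta> x)"
    using y by (simp add: sum_distrib_left mult_charsD[OF assms])
  finally show ?thesis using y(2) False by (metis mult_cancel_right1)
qed

lemma sum_over_mult_chars_neq:
  assumes "x \<in> K - {0}" "x \<noteq> 1"
  shows "(\<Sum>\<nu>\<in>mult_chars K. \<nu> x) = 0"
proof -
  obtain \<eta> where \<eta>: "\<eta> \<in> mult_chars K" "\<eta> x \<noteq> 1"
    using mult_chars_separate[OF assms] by blast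
  have "(\<Sum>\<nu>\<in>mult_chars K. \<nu> x) = (\<Sum>\<nu>\<in>mult_chars K. char_mult \<eta> \<nu> x)"
  proof (rule sum.reindex_bij_witness[of _ "char_mult \<eta>" "char_mult (char_inv \<eta>)"])
    fix \<nu> assume \<nu>: "\<nu> \<in> mult_chars K"
    show *: "char_mult \<eta> (char_mult (char_inv \<eta>) \<nu>) = \<nu>"
      by (intro mult_chars_eqI char_mult_in char_inv_in \<eta> \<nu>)
         (use mult_charsD(1)[OF \<eta>(1)] in \<open>auto simp: char_mult_def char_inv_def\<close>)
    show "char_mult (char_inv \<eta>) (char_mult \<eta> \<nu>) = \<nu>"
      by (intro mult_chars_eqI char_mult_in char_inv_in \<eta> \<nu>)
         (use mult_charsD(1)[OF \<eta>(1)] in \<open>auto simp: char_mult_def char_inv_def\<close>)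
    show "char_mult \<eta> (char_mult (char_inv \<eta>) \<nu>) x = \<nu> x"
      by (simp only: *)
  qed (use \<eta> in \<open>auto intro: char_mult_in char_inv_in\<close>)
  also have "\<dots> = \<eta> x * (\<Sum>\<nu>\<in>mult_chars K. \<nu> x)"
    by (simp add: sum_distrib_left char_mult_def)
  finally show ?thesis using \<eta>(2) by (metis mult_cancel_right1)
qed

text \<open>
  Summing \<open>\<nu> x\<close> over all \<open>\<nu>\<close> and \<open>x\<close> in both orders counts the characters on one side and the units on the
  other.
\<close>

lemma card_mult_chars: "card (mult_chars K) = card K - 1"
proof -
  have "(of_nat (card (mult_chars K)) :: qbar) = (\<Sum>\<nu>\<in>mult_chars K. \<nu> 1)"
    by (simp add: mult_charsD)
  also have "\<dots> = (\<Sum>x\<in>K - {0}. if x = 1 then (\<Sum>\<nu>\<in>mult_chars K. \<nu> 1) else 0)"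
    using one_in finite_units by (simp add: sum.delta)
  also have "\<dots> = (\<Sum>x\<in>K - {0}. \<Sum>\<nu>\<in>mult_chars K. \<nu> x)"
    by (intro sum.cong) (auto simp: sum_over_mult_chars_neq)
  also have "\<dots> = (\<Sum>\<nu>\<in>mult_chars K. \<Sum>x\<in>K - {0}. \<nu> x)" by (rule sum.swap)
  also have "\<dots> = (\<Sum>\<nu>\<in>mult_chars K. if \<nu> = triv_char K then of_nat (card K - 1) else 0)"
    using card_ge_2 by (intro sum.cong) (auto simp: sum_mult_char of_nat_diff)
  also have "\<dots> = of_nat (card K - 1)"
    using finite_mult_chars triv_in by (simp add: sum.delta)
  finally show ?thesis by (simp only: of_nat_eq_iff)
qed

lemma sum_over_mult_chars:
  assumes "x \<in> K - {0}"
  shows "(\<Sum>\<nu>\<in>mult_chars K. \<nu> x) = (if x = 1 then of_nat (card K) - 1 else 0)"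
  using sum_over_mult_chars_neq[OF assms] card_mult_chars card_ge_2
  by (auto simp: mult_charsD of_nat_diff)

end

section \<open>Gauss and Jacobi sums\<close>

locale finite_subfield_add_char = finite_subfield K for K :: "'f::field set" +
  fixes \<psi> :: "'f \<Rightarrow> qbar"
  assumes add_char: "nontriv_add_char K \<psi>"
begin

lemma add_char_add: "x \<in> K \<Longrightarrow> y \<in> K \<Longrightarrow> \<psi> (x + y) = \<psi> x * \<psi> y"
  using add_char by (auto simp: nontriv_add_char_def)

lemma add_char_0: "\<psi> 0 = 1"
  using add_char_add[of 0 0] zero_in add_char by (auto simp: nontriv_add_char_def)

lemma add_char_sum:
  "(\<And>i. i \<in> I \<Longrightarrow> h i \<in> K) \<Longrightarrow> \<psi> (\<Sum>i\<in>I. h i) = (\<Prod>i\<in>I. \<psi> (h i))"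
  by (induction I rule: infinite_finite_induct) (auto simp: add_char_0 add_char_add sum_in)

lemma sum_add_char: "a \<in> K \<Longrightarrow> (\<Sum>x\<in>K. \<psi> (x * a)) = (if a = 0 then of_nat (card K) else 0)"
proof (cases "a = 0")
  case False
  assume a: "a \<in> K"
  obtain y where y: "y \<in> K" "\<psi> y \<noteq> 1"
    using add_char by (auto simp: nontriv_add_char_def)
  have "(\<Sum>x\<in>K. \<psi> (x * a)) = (\<Sum>x\<in>K. \<psi> (y + x * a))"
    by (rule sum.reindex_bij_witness[of _ "\<lambda>x. x + y / a" "\<lambda>x. x - y / a"])
       (use y a False in \<open>auto simp: add_in diff_in divide_in ring_distribs add.commute\<close>)
  also have "\<dots> = \<psi> y * (\<Sum>x\<in>K. \<psi> (x * a))"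
    using y a by (simp add: sum_distrib_left add_char_add mult_in)
  finally show ?thesis using y(2) False by (metis mult_cancel_right1)
qed (simp add: add_char_0)

text \<open>
  The Fourier transform of a multiplicative character. For nontrivial \<open>\<eta>\<close> it holds at \<open>a = 0\<close> as well,
  where both sides vanish; this makes it possible to expand \<open>\<eta>\<close> at points that might be zero.
\<close>

lemma sum_add_char_mult_char:
  assumes "\<eta> \<in> mult_chars K" "a \<in> K" "a \<noteq> 0 \<or> \<eta> \<noteq> triv_char K"
  shows "(\<Sum>x\<in>K - {0}. \<psi> (a * x) * \<eta> x) = - char_inv \<eta> a * gauss K \<psi> \<eta>"
proof (cases "a = 0")
  case True
  then show ?thesis
    using assms sum_mult_char[OF assms(1)] by (simp add: add_char_0 char_inv_def mult_charsD)
next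
  case False
  have "(\<Sum>x\<in>K - {0}. \<psi> (a * x) * \<eta> x) = (\<Sum>x\<in>K - {0}. \<psi> x * \<eta> (x / a))"
    by (rule sum.reindex_bij_witness[of _ "\<lambda>x. x / a" "\<lambda>x. a * x"])
       (use assms False in \<open>auto simp: mult_in divide_in\<close>)
  also have "\<dots> = char_inv \<eta> a * (\<Sum>x\<in>K - {0}. \<psi> x * \<eta> x)"
    unfolding sum_distrib_left
    by (intro sum.cong) (use assms in \<open>auto simp: mult_charsD char_inv_def field_simps\<close>)
  finally show ?thesis by (simp add: gauss_def)
qed

lemma gauss_triv: "gauss K \<psi> (triv_char K) = 1"
proof -
  have "(\<Sum>x\<in>K - {0}. \<psi> x * triv_char K x) = (\<Sum>x\<in>K - {0}. \<psi> x)"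
    by (intro sum.cong) (auto simp: triv_char_def)
  also have "\<dots> = (\<Sum>x\<in>K. \<psi> x) - 1"
    using zero_in finite_K by (simp add: sum_diff1 add_char_0)
  also have "(\<Sum>x\<in>K. \<psi> x) = 0" using sum_add_char[OF one_in] by simp
  finally show ?thesis by (simp add: gauss_def)
qed

lemma minus_one_in: "-1 \<in> K - {0}"
  using uminus_in[OF one_in] by simp

lemma mult_char_minus_one_sq: "\<eta> \<in> mult_chars K \<Longrightarrow> \<eta> (- 1) * \<eta> (- 1) = 1"
  using mult_charsD(2)[of \<eta> "-1" "-1"] minus_one_in by (simp add: mult_charsD)

lemma mult_char_minus_one_inverse: "\<eta> \<in> mult_chars K \<Longrightarrow> inverse (\<eta> (- 1)) = \<eta> (- 1)"
  using mult_char_minus_one_sq[of \<eta>] by (metis inverse_unique)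

lemma char_inv_triv: "char_inv (triv_char K) = triv_char K"
  by (auto simp: char_inv_def triv_char_def fun_eq_iff)

lemma char_inv_triv_iff: "char_inv \<eta> = triv_char K \<longleftrightarrow> \<eta> = triv_char K"
  by (metis char_inv_triv char_inv_inv)

text \<open>
  The reflection formula. The factor \<open>card K\<close> that \<open>gauss0\<close> carries for the trivial character is exactly
  what makes it hold without exception.
\<close>

lemma gauss0_mult_gauss_inv:
  assumes "\<eta> \<in> mult_chars K"
  shows "gauss0 K \<psi> \<eta> * gauss K \<psi> (char_inv \<eta>) = \<eta> (- 1) * of_nat (card K)"
proof (cases "\<eta> = triv_char K")
  case True
  then show ?thesis using minus_one_in
    by (simp add: gauss0_def char_inv_triv gauss_triv) (simp add: triv_char_def)
next
  case False
  have "gauss K \<psi> \<eta> * gauss K \<psi> (char_inv \<eta>)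
      = (\<Sum>y\<in>K - {0}. \<psi> y * (\<Sum>x\<in>K - {0}. \<psi> (y * x) * \<eta> x))"
    using sum_add_char_mult_char[OF assms] False
    by (simp add: gauss_def[of K \<psi> "char_inv \<eta>"] sum_distrib_left mult_ac flip: sum_negf)
  also have "\<dots> = (\<Sum>y\<in>K. \<psi> y * (\<Sum>x\<in>K - {0}. \<psi> (y * x) * \<eta> x))"
    by (rule sum.mono_neutral_left)
       (use finite_K False sum_mult_char[OF assms] in \<open>auto simp: add_char_0\<close>)
  also have "\<dots> = (\<Sum>y\<in>K. \<Sum>x\<in>K - {0}. \<psi> (y * (1 + x)) * \<eta> x)"
    unfolding sum_distrib_left
    by (intro sum.cong refl) (auto simp: distrib_left add_char_add mult_in)
  also have "\<dots> = (\<Sum>x\<in>K - {0}. \<Sum>y\<in>K. \<psi> (y * (1 + x)) * \<eta> x)"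
    by (rule sum.swap)
  also have "\<dots> = (\<Sum>x\<in>K - {0}. if x = - 1 then \<eta> x * of_nat (card K) else 0)"
    by (intro sum.cong)
       (auto simp: sum_add_char add_in one_in eq_neg_iff_add_eq_0 add.commute simp flip:
           sum_distrib_right)
  also have "\<dots> = \<eta> (- 1) * of_nat (card K)"
    using minus_one_in finite_units by (simp add: sum.delta)
  finally show ?thesis using False by (simp add: gauss0_def)
qed

lemma gauss_nonzero:
  assumes "\<eta> \<in> mult_chars K"
  shows "gauss K \<psi> \<eta> \<noteq> 0" "gauss0 K \<psi> \<eta> \<noteq> 0"
proof -
  have "gauss0 K \<psi> \<eta> * gauss K \<psi> (char_inv \<eta>) \<noteq> 0"
    unfolding gauss0_mult_gauss_inv[OF assms]
    using mult_charsD(1)[OF assms minus_one_in] card_ge_2 by simp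
  then show "gauss0 K \<psi> \<eta> \<noteq> 0" by auto
  then show "gauss K \<psi> \<eta> \<noteq> 0" by (auto simp: gauss0_def)
qed

text \<open>
  Fourier inversion on the group \<open>K - {0}\<close>: the Gauss sums are the Fourier coefficients of \<open>\<psi>\<close>.
\<close>

lemma add_char_expansion:
  assumes "z \<in> K - {0}"
  shows "\<psi> z = 1 / (1 - of_nat (card K)) * (\<Sum>\<nu>\<in>mult_chars K. gauss K \<psi> (char_inv \<nu>) * \<nu> z)"
proof -
  have Q: "(1 - of_nat (card K) :: qbar) \<noteq> 0" using card_ge_2 by simp
  have "(\<Sum>\<nu>\<in>mult_chars K. gauss K \<psi> (char_inv \<nu>) * \<nu> z)
      = - (\<Sum>\<nu>\<in>mult_chars K. \<Sum>y\<in>K - {0}. \<psi> y * \<nu> (z / y))"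
    unfolding sum_negf[symmetric] gauss_def minus_mult_left[symmetric] sum_distrib_right
    by (intro sum.cong refl arg_cong[where f=uminus])
       (use assms in \<open>auto simp: char_inv_def mult_charsD field_simps\<close>)
  also have "\<dots> = - (\<Sum>y\<in>K - {0}. \<psi> y * (\<Sum>\<nu>\<in>mult_chars K. \<nu> (z / y)))"
    by (subst sum.swap) (simp add: sum_distrib_left)
  also have "(\<Sum>y\<in>K - {0}. \<psi> y * (\<Sum>\<nu>\<in>mult_chars K. \<nu> (z / y)))
      = (\<Sum>y\<in>K - {0}. if y = z then \<psi> y * (of_nat (card K) - 1) else 0)"
    using assms by (intro sum.cong) (auto simp: sum_over_mult_chars divide_in)
  also have "\<dots> = \<psi> z * (of_nat (card K) - 1)"
    using assms finite_units by (simp add: sum.delta)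
  finally show ?thesis using Q by (simp add: field_simps)
qed

text \<open>
  Multiplying out the Gauss sums and collecting the terms by the sum \<open>s\<close> of the variables produces
  \<open>S s\<close>, the character sum over \<open>x\<^sub>1 + \<dots> + x\<^sub>k = s\<close>. Scaling reduces \<open>S s\<close> for \<open>s \<noteq> 0\<close> to \<open>S 1\<close>, the Jacobi
  sum. The remaining value \<open>S 0\<close> is determined by the vanishing of the sum of all \<open>S s\<close>, and this is where
  a nontrivial character is used. If the product \<open>E\<close> of the characters is trivial, \<open>S 0\<close> contributes and
  accounts for the factor \<open>card K\<close> in \<open>gauss0\<close>.
\<close>

lemma jacobi_eq_gauss:
  assumes \<eta>: "\<And>i. i < k \<Longrightarrow> \<eta> i \<in> mult_chars K" and nt: "\<exists>i<k. \<eta> i \<noteq> triv_char K"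
  shows "jacobi K k \<eta> = (\<Prod>i<k. gauss K \<psi> (\<eta> i)) / gauss0 K \<psi> (\<lambda>x. \<Prod>i<k. \<eta> i x)"
proof -
  define P where "P = {..<k} \<rightarrow>\<^sub>E (K - {0})"
  define S where "S = (\<lambda>s. \<Sum>x\<in>{x\<in>P. (\<Sum>i<k. x i) = s}. \<Prod>i<k. \<eta> i (x i))"
  define E where "E = (\<lambda>x. \<Prod>i<k. \<eta> i x)"
  have k: "k > 0" using nt by auto
  have E: "E \<in> mult_chars K" unfolding E_def using \<eta> k by (intro char_prod_in) auto
  have finP: "finite P" unfolding P_def by (intro finite_PiE finite_units) auto
  have P_sum: "(\<Sum>i<k. x i) \<in> K" if "x \<in> P" for x
    using that by (intro sum_in) (auto simp: P_def)
  have scale: "S s = E s * S 1" if s: "s \<in> K - {0}" for s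
  proof -
    have "S s = (\<Sum>x\<in>{x\<in>P. (\<Sum>i<k. x i) = 1}. \<Prod>i<k. \<eta> i (s * x i))"
      unfolding S_def
    proof (rule sum.reindex_bij_witness[of _ "\<lambda>x. \<lambda>i\<in>{..<k}. s * x i" "\<lambda>x. \<lambda>i\<in>{..<k}. x i / s"])
      fix x assume x: "x \<in> {x\<in>P. (\<Sum>i<k. x i) = 1}"
      then have xP: "x i \<in> K - {0}" if "i < k" for i using that unfolding P_def by blast
      show "(\<lambda>i\<in>{..<k}. (\<lambda>i\<in>{..<k}. s * x i) i / s) = x"
        by (rule ext) (use x s in \<open>auto simp: P_def restrict_def PiE_def extensional_def\<close>)
      show "(\<lambda>i\<in>{..<k}. s * x i) \<in> {x\<in>P. (\<Sum>i<k. x i) = s}"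
      proof -
        have "(\<Sum>i<k. (\<lambda>i\<in>{..<k}. s * x i) i) = s * (\<Sum>i<k. x i)"
          by (simp add: sum_distrib_left)
        moreover have "(\<lambda>i\<in>{..<k}. s * x i) \<in> P"
          unfolding P_def by (intro restrict_PiE_iff[THEN iffD2] ballI)
              (use xP s in \<open>auto simp: mult_in\<close>)
        ultimately show ?thesis using x by simp
      qed
    next
      fix x assume x: "x \<in> {x\<in>P. (\<Sum>i<k. x i) = s}"
      then have xP: "x i \<in> K - {0}" if "i < k" for i using that unfolding P_def by blast
      show "(\<lambda>i\<in>{..<k}. s * (\<lambda>i\<in>{..<k}. x i / s) i) = x"
        by (rule ext) (use x s in \<open>auto simp: P_def restrict_def PiE_def extensional_def\<close>)
      show "(\<lambda>i\<in>{..<k}. x i / s) \<in> {x\<in>P. (\<Sum>i<k. x i) = 1}"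
      proof -
        have "(\<Sum>i<k. (\<lambda>i\<in>{..<k}. x i / s) i) = (\<Sum>i<k. x i) / s"
          by (simp add: sum_divide_distrib)
        moreover have "(\<lambda>i\<in>{..<k}. x i / s) \<in> P"
          unfolding P_def by (intro restrict_PiE_iff[THEN iffD2] ballI)
              (use xP s in \<open>auto simp: divide_in\<close>)
        ultimately show ?thesis using x s by simp
      qed
      show "(\<Prod>i<k. \<eta> i (s * (\<lambda>i\<in>{..<k}. x i / s) i)) = (\<Prod>i<k. \<eta> i (x i))"
        using s by (intro prod.cong) auto
    qed
    also have "\<dots> = (\<Sum>x\<in>{x\<in>P. (\<Sum>i<k. x i) = 1}. E s * (\<Prod>i<k. \<eta> i (x i)))"
      unfolding E_def prod.distrib[symmetric]
      by (intro sum.cong prod.cong refl mult_charsD(2) \<eta>) (use s in \<open>auto simp: P_def\<close>)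
    finally show ?thesis by (simp add: S_def sum_distrib_left)
  qed
  have group: "(\<Sum>x\<in>P. h (\<Sum>i<k. x i) * (\<Prod>i<k. \<eta> i (x i))) = (\<Sum>s\<in>K. h s * S s)" for h :: "'f \<Rightarrow> qbar"
  proof -
    have "(\<Sum>s\<in>K. h s * S s) = (\<Sum>s\<in>K. \<Sum>x\<in>{x\<in>P. (\<Sum>i<k. x i) = s}. h (\<Sum>i<k. x i) * (\<Prod>i<k. \<eta> i (x i)))"
      unfolding S_def sum_distrib_left by (intro sum.cong) auto
    also have "\<dots> = (\<Sum>x\<in>P. h (\<Sum>i<k. x i) * (\<Prod>i<k. \<eta> i (x i)))"
      by (rule sum.group[OF finP finite_K]) (use P_sum in auto)
    finally show ?thesis by simp
  qed
  have split0: "(\<Sum>s\<in>K. h s) = h 0 + (\<Sum>s\<in>K - {0}. h s)" for h :: "'f \<Rightarrow> qbar"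
    using zero_in finite_K by (rule sum.remove[rotated])
  have "(\<Prod>i<k. gauss K \<psi> (\<eta> i)) = (-1) ^ k * (\<Prod>i<k. \<Sum>x\<in>K - {0}. \<psi> x * \<eta> i x)"
    unfolding gauss_def by (simp add: prod_uminus)
  also have "(\<Prod>i<k. \<Sum>x\<in>K - {0}. \<psi> x * \<eta> i x) = (\<Sum>x\<in>P. \<Prod>i<k. \<psi> (x i) * \<eta> i (x i))"
    unfolding P_def by (rule prod_sum_PiE) (auto simp: finite_K)
  also have "\<dots> = (\<Sum>x\<in>P. \<psi> (\<Sum>i<k. x i) * (\<Prod>i<k. \<eta> i (x i)))"
    by (intro sum.cong refl) (subst add_char_sum, auto simp: P_def prod.distrib)
  also have "\<dots> = S 0 + (\<Sum>s\<in>K - {0}. \<psi> s * E s) * S 1"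
    unfolding group split0 sum_distrib_right mult.assoc
    by (intro arg_cong2[where f="(+)"] sum.cong refl) (simp_all add: add_char_0 scale[symmetric])
  finally have *: "(\<Prod>i<k. gauss K \<psi> (\<eta> i)) = (-1) ^ k * (S 0 - gauss K \<psi> E * S 1)"
    by (simp add: gauss_def)
  have "0 = (\<Prod>i<k. \<Sum>x\<in>K - {0}. \<eta> i x)"
    using nt \<eta> by (auto simp: sum_mult_char)
  also have "\<dots> = (\<Sum>x\<in>P. \<Prod>i<k. \<eta> i (x i))"
    unfolding P_def by (rule prod_sum_PiE) (auto simp: finite_K)
  also have "\<dots> = S 0 + (\<Sum>s\<in>K - {0}. E s) * S 1"
    using group[of "\<lambda>_. 1"] split0[of S] by (simp add: sum_distrib_right scale[symmetric])
  finally have S0: "S 0 = - (\<Sum>s\<in>K - {0}. E s) * S 1"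
    by (simp add: eq_neg_iff_add_eq_0)
  have "(-1) ^ k * (S 0 - gauss K \<psi> E * S 1) = (-1) ^ (k - 1) * S 1 * gauss0 K \<psi> E"
    using k by (cases k) (auto simp: S0 sum_mult_char[OF E] gauss_triv gauss0_def algebra_simps)
  moreover have "jacobi K k \<eta> = (-1) ^ (k - 1) * S 1"
    unfolding jacobi_def S_def P_def ..
  ultimately show ?thesis
    using * gauss_nonzero(2)[OF E] by (simp add: E_def)
qed

section \<open>The character sum of the hypersurface and the Lauricella function\<close>

text \<open>
  The common value, up to explicit factors, of the character sum and of the Lauricella function.
\<close>

definition gauss_series where
  "gauss_series n A B \<chi> lam = (\<Sum>\<nu>\<in>{..<n} \<rightarrow>\<^sub>E mult_chars K.
     gauss K \<psi> (char_mult (char_inv (char_mult A (\<lambda>x. \<Prod>i<n. \<chi> i x))) (\<lambda>x. \<Prod>i<n. \<nu> i x)) *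
     gauss K \<psi> (char_mult (char_inv B) (\<lambda>x. \<Prod>i<n. \<nu> i x)) *
     (\<Prod>i<n. gauss K \<psi> (char_mult (\<chi> i) (char_inv (\<nu> i))) * gauss K \<psi> (char_inv (\<nu> i)) * \<nu> i (lam i)))"

lemma char_inv_mult: "char_inv (char_mult \<eta> \<theta>) = char_mult (char_inv \<eta>) (char_inv \<theta>)"
  by (auto simp: char_inv_def char_mult_def fun_eq_iff)

lemma char_mult_triv: "\<eta> \<in> mult_chars K \<Longrightarrow> char_mult (triv_char K) \<eta> = \<eta>"
  by (auto simp: mult_chars_def char_mult_def triv_char_def fun_eq_iff)

lemma gauss0_eq:
  assumes "\<eta> \<in> mult_chars K"
  shows "gauss0 K \<psi> \<eta> = \<eta> (- 1) * of_nat (card K) / gauss K \<psi> (char_inv \<eta>)"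
  using gauss0_mult_gauss_inv[OF assms] gauss_nonzero(1)[OF char_inv_in[OF assms]]
  by (simp add: field_simps)

text \<open>
  The reflection formula moves the Gauss sums in the denominators of the Lauricella function into the
  numerator; the signs \<open>\<chi> (- 1)\<close> and \<open>\<nu> (- 1)\<close> and the factors \<open>card K\<close> cancel.
\<close>

lemma poch0_factor:
  assumes "\<chi> \<in> mult_chars K" "\<nu> \<in> mult_chars K"
  shows "1 / (poch0 K \<psi> (char_inv \<chi>) \<nu> * poch0 K \<psi> (triv_char K) \<nu>) =
    gauss K \<psi> (char_mult \<chi> (char_inv \<nu>)) * gauss K \<psi> (char_inv \<nu>) / gauss K \<psi> \<chi>"
proof -
  have nz: "gauss K \<psi> \<chi> \<noteq> 0" "gauss K \<psi> (char_inv \<nu>) \<noteq> 0"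
    "gauss K \<psi> (char_mult \<chi> (char_inv \<nu>)) \<noteq> 0"
    "\<chi> (- 1) \<noteq> 0" "\<nu> (- 1) \<noteq> 0" "(of_nat (card K) :: qbar) \<noteq> 0"
    using assms gauss_nonzero mult_charsD(1)[OF _ minus_one_in] card_ge_2
    by (auto simp: char_mult_in char_inv_in)
  have inv_apply: "char_inv \<eta> x = inverse (\<eta> x)" for \<eta> x by (simp add: char_inv_def)
  have 1: "gauss0 K \<psi> (char_inv \<chi>) = inverse (\<chi> (- 1)) * of_nat (card K) / gauss K \<psi> \<chi>"
    using gauss0_eq[OF char_inv_in[OF assms(1)]] by (simp add: inv_apply)
  have 2: "gauss0 K \<psi> (char_mult (char_inv \<chi>) \<nu>)
     = inverse (\<chi> (- 1)) * \<nu> (- 1) * of_nat (card K) / gauss K \<psi> (char_mult \<chi> (char_inv \<nu>))"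
    using gauss0_eq[OF char_mult_in[OF char_inv_in[OF assms(1)] assms(2)]]
    by (simp add: char_inv_mult) (simp add: inv_apply char_mult_def)
  have 3: "gauss0 K \<psi> (triv_char K) = of_nat (card K)"
    by (simp add: gauss0_def gauss_triv)
  have "1 / (poch0 K \<psi> (char_inv \<chi>) \<nu> * poch0 K \<psi> (triv_char K) \<nu>) =
    gauss K \<psi> (char_mult \<chi> (char_inv \<nu>)) * gauss K \<psi> (char_inv \<nu>) /
      (gauss K \<psi> \<chi> * (\<nu> (- 1) * \<nu> (- 1)))"
    unfolding poch0_def char_mult_triv[OF assms(2)] 1 2 3 gauss0_eq[OF assms(2)]
    using nz by simp
  then show ?thesis
    by (simp add: mult_char_minus_one_sq[OF assms(2)])
qed

lemma lauricella_C_eq_gauss_series: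
  assumes "\<And>i. i < n \<Longrightarrow> \<chi> i \<in> mult_chars K"
  shows "lauricella_C K \<psi> n (char_inv (char_mult A (\<lambda>x. \<Prod>i<n. \<chi> i x))) (char_inv B)
      (\<lambda>i. char_inv (\<chi> i)) lam =
    gauss_series n A B \<chi> lam /
      ((1 - of_nat (card K)) ^ n * gauss K \<psi> (char_inv (char_mult A (\<lambda>x. \<Prod>i<n. \<chi> i x))) *
       gauss K \<psi> (char_inv B) * (\<Prod>i<n. gauss K \<psi> (\<chi> i)))"
proof -
  define \<alpha> where "\<alpha> = char_inv (char_mult A (\<lambda>x. \<Prod>i<n. \<chi> i x))"
  have *: "poch K \<psi> \<alpha> (\<lambda>x. \<Prod>i<n. \<nu> i x) * poch K \<psi> (char_inv B) (\<lambda>x. \<Prod>i<n. \<nu> i x) /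
        ((\<Prod>i<n. poch0 K \<psi> (char_inv (\<chi> i)) (\<nu> i)) * (\<Prod>i<n. poch0 K \<psi> (triv_char K) (\<nu> i))) *
        (\<Prod>i<n. \<nu> i (lam i)) =
      gauss K \<psi> (char_mult \<alpha> (\<lambda>x. \<Prod>i<n. \<nu> i x)) *
      gauss K \<psi> (char_mult (char_inv B) (\<lambda>x. \<Prod>i<n. \<nu> i x)) *
      (\<Prod>i<n. gauss K \<psi> (char_mult (\<chi> i) (char_inv (\<nu> i))) * gauss K \<psi> (char_inv (\<nu> i)) * \<nu> i (lam i)) /
      (gauss K \<psi> \<alpha> * gauss K \<psi> (char_inv B) * (\<Prod>i<n. gauss K \<psi> (\<chi> i)))"
    if "\<nu> \<in> {..<n} \<rightarrow>\<^sub>E mult_chars K" for \<nu>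
  proof -
    have "(\<Prod>i<n. 1 / (poch0 K \<psi> (char_inv (\<chi> i)) (\<nu> i) * poch0 K \<psi> (triv_char K) (\<nu> i))) =
       (\<Prod>i<n. gauss K \<psi> (char_mult (\<chi> i) (char_inv (\<nu> i))) * gauss K \<psi> (char_inv (\<nu> i)) /
           gauss K \<psi> (\<chi> i))"
      by (intro prod.cong refl poch0_factor) (use assms that in auto)
    then have *: "1 / ((\<Prod>i<n. poch0 K \<psi> (char_inv (\<chi> i)) (\<nu> i)) * (\<Prod>i<n. poch0 K \<psi> (triv_char K) (\<nu> i)))
      = (\<Prod>i<n. gauss K \<psi> (char_mult (\<chi> i) (char_inv (\<nu> i))) * gauss K \<psi> (char_inv (\<nu> i))) /
          (\<Prod>i<n. gauss K \<psi> (\<chi> i))"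
      by (simp add: prod.distrib prod_dividef)
    have div: "x / y * z = x * (1 / y) * z" for x y z :: qbar by simp
    show ?thesis unfolding div[of _ "_ * _"] *
      by (simp add: poch_def prod.distrib)
  qed
  show ?thesis
    unfolding lauricella_C_def gauss_series_def \<alpha>_def[symmetric]
    by (subst sum.cong[OF refl *], assumption) (simp add: mult.assoc flip: sum_divide_distrib)
qed

text \<open>
  The sum over a single variable \<open>x\<^sub>i\<close> after \<open>A\<close> and \<open>B\<close> have been expanded with frequencies \<open>s\<close> and \<open>t\<close>. The
  second additive character is expanded in multiplicative characters \<open>\<nu>\<close>, which turns the sum over \<open>x\<close> into
  the Gauss sum of \<open>\<chi>\<close> times the inverse of \<open>\<nu>\<close>. The right-hand side depends on \<open>s\<close> and \<open>t\<close> only through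
  characters, so that the outer sums are again Gauss sums.
\<close>

lemma char_sum_inner:
  assumes "\<chi> \<in> mult_chars K" and st: "s \<in> K - {0}" "t \<in> K - {0}" "l \<in> K - {0}"
  shows "(\<Sum>x\<in>K - {0}. \<chi> x * (\<psi> (- s * x) * \<psi> (- (t * l / x)))) =
    (\<Sum>\<nu>\<in>mult_chars K. - 1 / (1 - of_nat (card K)) * \<chi> (- 1) * inverse (\<chi> s) *
       (gauss K \<psi> (char_mult \<chi> (char_inv \<nu>)) * gauss K \<psi> (char_inv \<nu>) * \<nu> l) * (\<nu> s * \<nu> t))"
proof -
  let ?Q = "of_nat (card K) :: qbar"
  have neg: "\<eta> (- z) = \<eta> (- 1) * \<eta> z" if "\<eta> \<in> mult_chars K" "z \<in> K" for \<eta> z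
    using mult_charsD(2)[OF that(1) _ that(2), of "-1"] minus_one_in by simp
  have in_K: "- s \<in> K" using st uminus_in by auto
  have "(\<Sum>x\<in>K - {0}. \<chi> x * (\<psi> (- s * x) * \<psi> (- (t * l / x)))) =
     (\<Sum>x\<in>K - {0}. \<Sum>\<nu>\<in>mult_chars K. 1 / (1 - ?Q) * gauss K \<psi> (char_inv \<nu>) * \<nu> (- (t * l)) *
        (\<psi> (- s * x) * char_mult \<chi> (char_inv \<nu>) x))"
  proof (intro sum.cong refl)
    fix x assume x: "x \<in> K - {0}"
    have "\<psi> (- (t * l / x)) = 1 / (1 - ?Q) *
        (\<Sum>\<nu>\<in>mult_chars K. gauss K \<psi> (char_inv \<nu>) * \<nu> (- (t * l / x)))"
      by (rule add_char_expansion) (use x st in \<open>auto intro!: uminus_in divide_in mult_in\<close>)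
    also have "\<dots> = 1 / (1 - ?Q) * (\<Sum>\<nu>\<in>mult_chars K. gauss K \<psi> (char_inv \<nu>) * (\<nu> (- (t * l)) / \<nu> x))"
    proof -
      have "\<nu> (- (t * l / x)) = \<nu> (- (t * l)) / \<nu> x" if "\<nu> \<in> mult_chars K" for \<nu>
        using mult_charsD(7)[OF that, of "- (t * l)" x] x st by (simp add: uminus_in mult_in)
      then show ?thesis by simp
    qed
    finally show "\<chi> x * (\<psi> (- s * x) * \<psi> (- (t * l / x))) =
       (\<Sum>\<nu>\<in>mult_chars K. 1 / (1 - ?Q) * gauss K \<psi> (char_inv \<nu>) * \<nu> (- (t * l)) *
        (\<psi> (- s * x) * char_mult \<chi> (char_inv \<nu>) x))"
      by (simp add: sum_distrib_left char_mult_def char_inv_def divide_inverse mult_ac)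
  qed
  also have "\<dots> = (\<Sum>\<nu>\<in>mult_chars K. 1 / (1 - ?Q) * gauss K \<psi> (char_inv \<nu>) * \<nu> (- (t * l)) *
        (\<Sum>x\<in>K - {0}. \<psi> (- s * x) * char_mult \<chi> (char_inv \<nu>) x))"
    by (subst sum.swap) (simp only: sum_distrib_left)
  also have "\<dots> = (\<Sum>\<nu>\<in>mult_chars K. - 1 / (1 - ?Q) * \<chi> (- 1) * inverse (\<chi> s) *
       (gauss K \<psi> (char_mult \<chi> (char_inv \<nu>)) * gauss K \<psi> (char_inv \<nu>) * \<nu> l) * (\<nu> s * \<nu> t))"
  proof (intro sum.cong refl)
    fix \<nu> assume \<nu>: "\<nu> \<in> mult_chars K"
    have 1: "(\<Sum>x\<in>K - {0}. \<psi> (- s * x) * char_mult \<chi> (char_inv \<nu>) x) =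
        - (inverse (\<chi> (- s)) * \<nu> (- s)) * gauss K \<psi> (char_mult \<chi> (char_inv \<nu>))"
      using sum_add_char_mult_char[OF char_mult_in[OF assms(1) char_inv_in[OF \<nu>]] in_K] st
      by (simp add: char_inv_def char_mult_def)
    have 2: "\<nu> (- (t * l)) * \<nu> (- s) = \<nu> l * (\<nu> s * \<nu> t)"
      using mult_char_minus_one_sq[OF \<nu>] neg[OF \<nu>, of s] neg[OF \<nu>, of "t * l"] st
        mult_charsD(2)[OF \<nu>, of t l] mult_in[of t l]
      by (simp add: mult_ac)
    have 3: "inverse (\<chi> (- s)) = \<chi> (- 1) * inverse (\<chi> s)"
      using neg[OF assms(1), of s] st mult_char_minus_one_inverse[OF assms(1)] by simp
    have "1 / (1 - ?Q) * gauss K \<psi> (char_inv \<nu>) * \<nu> (- (t * l)) *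
        (- (inverse (\<chi> (- s)) * \<nu> (- s)) * gauss K \<psi> (char_mult \<chi> (char_inv \<nu>)))
      = - 1 / (1 - ?Q) * inverse (\<chi> (- s)) *
       (gauss K \<psi> (char_mult \<chi> (char_inv \<nu>)) * gauss K \<psi> (char_inv \<nu>)) * (\<nu> (- (t * l)) * \<nu> (- s))"
      by simp
    then show "1 / (1 - ?Q) * gauss K \<psi> (char_inv \<nu>) * \<nu> (- (t * l)) *
        (\<Sum>x\<in>K - {0}. \<psi> (- s * x) * char_mult \<chi> (char_inv \<nu>) x) =
      - 1 / (1 - ?Q) * \<chi> (- 1) * inverse (\<chi> s) *
       (gauss K \<psi> (char_mult \<chi> (char_inv \<nu>)) * gauss K \<psi> (char_inv \<nu>) * \<nu> l) * (\<nu> s * \<nu> t)"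
      unfolding 1 2 3 by (simp only: mult_ac)
  qed
  finally show ?thesis .
qed

text \<open>
  After Fourier expansion of \<open>A\<close> and \<open>B\<close> the summand is a product over the variables \<open>x\<^sub>i\<close>, so the sum over
  \<open>x\<close> is a product of one-variable sums. Multiplying these out again yields the sum over tuples \<open>\<nu>\<close>.
\<close>

lemma char_sum_eq_gauss_series:
  assumes "A \<in> mult_chars K" "A \<noteq> triv_char K" "B \<in> mult_chars K" "B \<noteq> triv_char K"
    and \<chi>: "\<And>i. i < n \<Longrightarrow> \<chi> i \<in> mult_chars K" and lam: "\<And>i. i < n \<Longrightarrow> lam i \<in> K - {0}"
  shows "gauss K \<psi> (char_inv A) * gauss K \<psi> (char_inv B) *
     (\<Sum>x\<in>{..<n} \<rightarrow>\<^sub>E (K - {0}). (\<Prod>i<n. \<chi> i (x i)) * A (1 - (\<Sum>i<n. x i)) * B (1 - (\<Sum>i<n. lam i / x i)))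
   = (- 1 / (1 - of_nat (card K))) ^ n * (\<Prod>i<n. \<chi> i (- 1)) * gauss_series n A B \<chi> lam"
proof -
  let ?P = "{..<n} \<rightarrow>\<^sub>E (K - {0})" and ?U = "K - {0}" and ?c = "- 1 / (1 - of_nat (card K)) :: qbar"
  have fourier: "gauss K \<psi> (char_inv \<eta>) * \<eta> u = - (\<Sum>t\<in>?U. \<psi> (u * t) * char_inv \<eta> t)"
    if "\<eta> \<in> mult_chars K" "\<eta> \<noteq> triv_char K" "u \<in> K" for \<eta> u
    using sum_add_char_mult_char[OF char_inv_in[OF that(1)] that(3)] that
    by (simp add: char_inv_triv_iff mult.commute)
  \<comment> \<open>\<open>W\<close> is the part of the expanded summand free of \<open>x\<close>, \<open>h\<close> the part that depends on one variable.\<close>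
  define W where "W = (\<lambda>s t. char_inv A s * char_inv B t * (\<psi> s * \<psi> t))"
  define h where "h = (\<lambda>s t i x. \<chi> i x * (\<psi> (- s * x) * \<psi> (- (t * lam i / x))))"
  define G where "G = (\<lambda>\<nu>. (\<Prod>i<n. gauss K \<psi> (char_mult (\<chi> i) (char_inv (\<nu> i))) *
      gauss K \<psi> (char_inv (\<nu> i)) * \<nu> i (lam i)))"
  have "gauss K \<psi> (char_inv A) * gauss K \<psi> (char_inv B) *
     (\<Sum>x\<in>?P. (\<Prod>i<n. \<chi> i (x i)) * A (1 - (\<Sum>i<n. x i)) * B (1 - (\<Sum>i<n. lam i / x i)))
    = (\<Sum>x\<in>?P. (\<Prod>i<n. \<chi> i (x i)) * (gauss K \<psi> (char_inv A) * A (1 - (\<Sum>i<n. x i))) *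
         (gauss K \<psi> (char_inv B) * B (1 - (\<Sum>i<n. lam i / x i))))"
    by (simp add: sum_distrib_left mult_ac)
  also have "\<dots> = (\<Sum>x\<in>?P. \<Sum>s\<in>?U. \<Sum>t\<in>?U. W s t * (\<Prod>i<n. h s t i (x i)))"
  proof (intro sum.cong refl)
    fix x assume x: "x \<in> ?P"
    have xi: "x i \<in> K" "x i \<noteq> 0" if "i < n" for i using x that by auto
    have 1: "1 - (\<Sum>i<n. x i) \<in> K" "1 - (\<Sum>i<n. lam i / x i) \<in> K"
      using xi lam by (auto intro!: diff_in sum_in divide_in one_in)
    have 2: "\<psi> ((1 - (\<Sum>i<n. x i)) * s) * \<psi> ((1 - (\<Sum>i<n. lam i / x i)) * t) * (\<Prod>i<n. \<chi> i (x i)) =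
       \<psi> s * \<psi> t * (\<Prod>i<n. h s t i (x i))" if "s \<in> ?U" "t \<in> ?U" for s t
    proof -
      have "(1 - (\<Sum>i<n. x i)) * s = s + (\<Sum>i<n. - s * x i)"
        by (simp add: sum_distrib_left sum_negf algebra_simps)
      moreover have "(1 - (\<Sum>i<n. lam i / x i)) * t = t + (\<Sum>i<n. - (t * lam i / x i))"
        by (simp add: sum_distrib_left sum_negf algebra_simps)
      moreover have "\<psi> (s + (\<Sum>i<n. - s * x i)) = \<psi> s * (\<Prod>i<n. \<psi> (- s * x i))"
      proof -
        have "- s * x i \<in> K" if "i \<in> {..<n}" for i
          using that \<open>s \<in> ?U\<close> xi by (auto intro!: mult_in uminus_in)
        then show ?thesis using \<open>s \<in> ?U\<close> by (subst add_char_add) (auto simp only: add_char_sum sum_in)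
      qed
      moreover have "\<psi> (t + (\<Sum>i<n. - (t * lam i / x i))) = \<psi> t * (\<Prod>i<n. \<psi> (- (t * lam i / x i)))"
      proof -
        have "- (t * lam i / x i) \<in> K" if "i \<in> {..<n}" for i
          using that \<open>t \<in> ?U\<close> xi lam by (auto intro!: mult_in uminus_in divide_in)
        then show ?thesis using \<open>t \<in> ?U\<close> by (subst add_char_add) (auto simp only: add_char_sum sum_in)
      qed
      ultimately show ?thesis unfolding h_def prod.distrib by (simp only: mult_ac)
    qed
    have "(\<Prod>i<n. \<chi> i (x i)) * (gauss K \<psi> (char_inv A) * A (1 - (\<Sum>i<n. x i))) *
         (gauss K \<psi> (char_inv B) * B (1 - (\<Sum>i<n. lam i / x i)))
      = (\<Prod>i<n. \<chi> i (x i)) * ((\<Sum>s\<in>?U. \<psi> ((1 - (\<Sum>i<n. x i)) * s) * char_inv A s) *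
          (\<Sum>t\<in>?U. \<psi> ((1 - (\<Sum>i<n. lam i / x i)) * t) * char_inv B t))"
      using fourier[OF assms(1,2) 1(1)] fourier[OF assms(3,4) 1(2)] by simp
    also have "\<dots> = (\<Sum>s\<in>?U. \<Sum>t\<in>?U. char_inv A s * char_inv B t *
        (\<psi> ((1 - (\<Sum>i<n. x i)) * s) * \<psi> ((1 - (\<Sum>i<n. lam i / x i)) * t) * (\<Prod>i<n. \<chi> i (x i))))"
      by (subst sum_product) (simp only: sum_distrib_left mult_ac)
    also have "\<dots> = (\<Sum>s\<in>?U. \<Sum>t\<in>?U. W s t * (\<Prod>i<n. h s t i (x i)))"
      by (intro sum.cong refl) (subst 2, assumption, assumption, simp only: W_def mult.assoc)
    finally show "(\<Prod>i<n. \<chi> i (x i)) * (gauss K \<psi> (char_inv A) * A (1 - (\<Sum>i<n. x i))) *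
         (gauss K \<psi> (char_inv B) * B (1 - (\<Sum>i<n. lam i / x i))) = \<dots>" .
  qed
  also have "\<dots> = (\<Sum>s\<in>?U. \<Sum>t\<in>?U. \<Sum>x\<in>?P. W s t * (\<Prod>i<n. h s t i (x i)))"
    by (subst sum.swap) (intro sum.cong refl sum.swap)
  also have "\<dots> = (\<Sum>s\<in>?U. \<Sum>t\<in>?U. W s t * (\<Prod>i<n. \<Sum>x\<in>?U. h s t i x))"
    unfolding sum_distrib_left[symmetric]
    by (intro sum.cong refl arg_cong2[where f="(*)"] prod_sum_PiE[symmetric]) (auto simp: finite_K)
  also have "\<dots> = (\<Sum>s\<in>?U. \<Sum>t\<in>?U. \<Sum>\<nu>\<in>{..<n} \<rightarrow>\<^sub>E mult_chars K.
      (?c ^ n * (\<Prod>i<n. \<chi> i (- 1)) * G \<nu>) *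
      ((\<psi> s * char_mult (char_inv (char_mult A (\<lambda>x. \<Prod>i<n. \<chi> i x))) (\<lambda>x. \<Prod>i<n. \<nu> i x) s) *
       (\<psi> t * char_mult (char_inv B) (\<lambda>x. \<Prod>i<n. \<nu> i x) t)))"
  proof (intro sum.cong refl)
    fix s t assume st: "s \<in> ?U" "t \<in> ?U"
    have "(\<Prod>i<n. \<Sum>x\<in>?U. h s t i x) = (\<Prod>i<n. \<Sum>\<nu>\<in>mult_chars K. ?c * \<chi> i (- 1) * inverse (\<chi> i s) *
       (gauss K \<psi> (char_mult (\<chi> i) (char_inv \<nu>)) * gauss K \<psi> (char_inv \<nu>) * \<nu> (lam i)) * (\<nu> s * \<nu> t))"
      unfolding h_def by (intro prod.cong refl char_sum_inner) (use \<chi> st lam in auto)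
    also have "\<dots> = (\<Sum>\<nu>\<in>{..<n} \<rightarrow>\<^sub>E mult_chars K. \<Prod>i<n. ?c * \<chi> i (- 1) * inverse (\<chi> i s) *
       (gauss K \<psi> (char_mult (\<chi> i) (char_inv (\<nu> i))) * gauss K \<psi> (char_inv (\<nu> i)) * \<nu> i (lam i)) *
           (\<nu> i s * \<nu> i t))"
      by (rule prod_sum_PiE) (auto simp: finite_mult_chars)
    also have "\<dots> = (\<Sum>\<nu>\<in>{..<n} \<rightarrow>\<^sub>E mult_chars K. ?c ^ n * (\<Prod>i<n. \<chi> i (- 1)) * inverse (\<Prod>i<n. \<chi> i s) *
       G \<nu> * ((\<Prod>i<n. \<nu> i s) * (\<Prod>i<n. \<nu> i t)))"
      unfolding G_def prod.distrib prod_constant prod_inversef[symmetric] o_def card_lessThan ..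
    finally have *: "(\<Prod>i<n. \<Sum>x\<in>?U. h s t i x) = \<dots>" .
    show "W s t * (\<Prod>i<n. \<Sum>x\<in>?U. h s t i x) = (\<Sum>\<nu>\<in>{..<n} \<rightarrow>\<^sub>E mult_chars K.
      (?c ^ n * (\<Prod>i<n. \<chi> i (- 1)) * G \<nu>) *
      ((\<psi> s * char_mult (char_inv (char_mult A (\<lambda>x. \<Prod>i<n. \<chi> i x))) (\<lambda>x. \<Prod>i<n. \<nu> i x) s) *
       (\<psi> t * char_mult (char_inv B) (\<lambda>x. \<Prod>i<n. \<nu> i x) t)))"
      unfolding * W_def char_mult_def char_inv_def sum_distrib_left inverse_mult_distrib
      by (simp only: mult_ac)
  qed
  also have "\<dots> = (\<Sum>\<nu>\<in>{..<n} \<rightarrow>\<^sub>E mult_chars K. \<Sum>s\<in>?U. \<Sum>t\<in>?U.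
      (?c ^ n * (\<Prod>i<n. \<chi> i (- 1)) * G \<nu>) *
      ((\<psi> s * char_mult (char_inv (char_mult A (\<lambda>x. \<Prod>i<n. \<chi> i x))) (\<lambda>x. \<Prod>i<n. \<nu> i x) s) *
       (\<psi> t * char_mult (char_inv B) (\<lambda>x. \<Prod>i<n. \<nu> i x) t)))"
    by (subst (2) sum.swap) (intro sum.cong refl sum.swap)
  also have "\<dots> = ?c ^ n * (\<Prod>i<n. \<chi> i (- 1)) * gauss_series n A B \<chi> lam"
    unfolding gauss_series_def sum_distrib_left[of "_ * _" _ "_ \<rightarrow>\<^sub>E _"]
  proof (intro sum.cong refl)
    fix \<nu> assume "\<nu> \<in> {..<n} \<rightarrow>\<^sub>E mult_chars K"
    have "(\<Sum>s\<in>?U. \<Sum>t\<in>?U. c * (\<psi> s * \<eta> s * (\<psi> t * \<theta> t))) = c * (gauss K \<psi> \<eta> * gauss K \<psi> \<theta> * 1)"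
      for c \<eta> \<theta>
      unfolding sum_distrib_left[symmetric] gauss_def by (simp flip: sum_distrib_right)
    then show "(\<Sum>s\<in>?U. \<Sum>t\<in>?U. (?c ^ n * (\<Prod>i<n. \<chi> i (- 1)) * G \<nu>) *
      ((\<psi> s * char_mult (char_inv (char_mult A (\<lambda>x. \<Prod>i<n. \<chi> i x))) (\<lambda>x. \<Prod>i<n. \<nu> i x) s) *
       (\<psi> t * char_mult (char_inv B) (\<lambda>x. \<Prod>i<n. \<nu> i x) t))) =
      ?c ^ n * (\<Prod>i<n. \<chi> i (- 1)) *
      (gauss K \<psi> (char_mult (char_inv (char_mult A (\<lambda>x. \<Prod>i<n. \<chi> i x))) (\<lambda>x. \<Prod>i<n. \<nu> i x)) *
       gauss K \<psi> (char_mult (char_inv B) (\<lambda>x. \<Prod>i<n. \<nu> i x)) *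
       (\<Prod>i<n. gauss K \<psi> (char_mult (\<chi> i) (char_inv (\<nu> i))) * gauss K \<psi> (char_inv (\<nu> i)) * \<nu> i (lam i)))"
      by (simp only: G_def mult_1_right) (simp only: mult_ac)
  qed
  finally show ?thesis .
qed

text \<open>
  Both the character sum and the product of the Jacobi sum with the Lauricella function are explicit
  multiples of \<open>gauss_series\<close>. The quotient of the two factors is the sign \<open>e * e = 1\<close>, where \<open>e\<close> is the
  product of the \<open>\<chi> i (- 1)\<close>.
\<close>

lemma char_sum_eq_lauricella:
  assumes "A \<in> mult_chars K" "A \<noteq> triv_char K" "B \<in> mult_chars K" "B \<noteq> triv_char K"
    and \<chi>: "\<And>i. i < n \<Longrightarrow> \<chi> i \<in> mult_chars K" and lam: "\<And>i. i < n \<Longrightarrow> lam i \<in> K - {0}" and "n > 0"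
  shows "(\<Sum>x\<in>{..<n} \<rightarrow>\<^sub>E (K - {0}). (\<Prod>i<n. \<chi> i (x i)) * A (1 - (\<Sum>i<n. x i)) * B (1 - (\<Sum>i<n. lam i / x i)))
   = (- 1) ^ n * jacobi K (Suc n) (case_nat A \<chi>) *
       lauricella_C K \<psi> n (char_inv (char_mult A (\<lambda>x. \<Prod>i<n. \<chi> i x))) (char_inv B) (\<lambda>i. char_inv (\<chi> i)) lam"
    (is "?S = _")
proof -
  let ?g = "gauss K \<psi>" and ?Q = "of_nat (card K) :: qbar"
  define E where "E = char_mult A (\<lambda>x. \<Prod>i<n. \<chi> i x)"
  define e where "e = (\<Prod>i<n. \<chi> i (- 1))"
  have prod_in: "(\<lambda>x. \<Prod>i<n. \<chi> i x) \<in> mult_chars K" using \<chi> \<open>n > 0\<close> by (intro char_prod_in) auto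
  then have E: "E \<in> mult_chars K" unfolding E_def using assms(1) by (intro char_mult_in)
  have shift: "(\<Prod>i<Suc n. h i) = h 0 * (\<Prod>i<n. h (Suc i))" for h :: "nat \<Rightarrow> qbar"
    by (rule prod.lessThan_Suc_shift)
  have "jacobi K (Suc n) (case_nat A \<chi>) = (\<Prod>i<Suc n. ?g (case_nat A \<chi> i)) /
      gauss0 K \<psi> (\<lambda>x. \<Prod>i<Suc n. case_nat A \<chi> i x)"
  proof (rule jacobi_eq_gauss)
    show "case_nat A \<chi> i \<in> mult_chars K" if "i < Suc n" for i
      using that assms(1) \<chi> by (cases i) auto
    show "\<exists>i<Suc n. case_nat A \<chi> i \<noteq> triv_char K" using assms(2) by (intro exI[of _ 0]) auto
  qed
  then have jac: "jacobi K (Suc n) (case_nat A \<chi>) = ?g A * (\<Prod>i<n. ?g (\<chi> i)) / gauss0 K \<psi> E"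
    unfolding shift by (simp add: E_def char_mult_def)
  have nz: "?g A \<noteq> 0" "?g (char_inv A) \<noteq> 0" "?g (char_inv B) \<noteq> 0" "(\<Prod>i<n. ?g (\<chi> i)) \<noteq> 0"
      "?g (char_inv E) \<noteq> 0"
    "A (- 1) \<noteq> 0" "e \<noteq> 0" "?Q \<noteq> 0" "1 - ?Q \<noteq> 0"
    using assms(1,3) \<chi> E gauss_nonzero(1) card_ge_2 mult_charsD(1)[OF _ minus_one_in]
    by (auto simp: e_def char_inv_in)
  have g0E: "gauss0 K \<psi> E = A (- 1) * e * ?Q / ?g (char_inv E)"
    using gauss0_eq[OF E] by (simp add: E_def e_def char_mult_def)
  have gA: "?g A = A (- 1) * ?Q / ?g (char_inv A)"
    using gauss0_eq[OF assms(1)] assms(2) by (simp add: gauss0_def)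
  have ee: "e * e = 1"
    unfolding e_def prod.distrib[symmetric] using \<chi> by (simp add: mult_char_minus_one_sq)
  have S: "?S = (- 1) ^ n * e * gauss_series n A B \<chi> lam /
      ((1 - ?Q) ^ n * ?g (char_inv A) * ?g (char_inv B))"
    using char_sum_eq_gauss_series[OF assms(1-4), of n \<chi> lam] \<chi> lam nz
    by (simp add: e_def field_simps power_minus[of "1 / _"] power_divide flip: minus_divide_left)
  have lau: "lauricella_C K \<psi> n (char_inv E) (char_inv B) (\<lambda>i. char_inv (\<chi> i)) lam =
    gauss_series n A B \<chi> lam / ((1 - ?Q) ^ n * ?g (char_inv E) * ?g (char_inv B) * (\<Prod>i<n. ?g (\<chi> i)))"
    unfolding E_def by (rule lauricella_C_eq_gauss_series[OF \<chi>])
  have e_inv: "1 / e = e" using ee nz(7) by (simp add: field_simps)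
  have "(- 1) ^ n * jacobi K (Suc n) (case_nat A \<chi>) *
      lauricella_C K \<psi> n (char_inv E) (char_inv B) (\<lambda>i. char_inv (\<chi> i)) lam
     = (- 1) ^ n * (1 / e) * gauss_series n A B \<chi> lam /
         ((1 - ?Q) ^ n * ?g (char_inv A) * ?g (char_inv B))"
    unfolding lau jac g0E gA using nz by simp
  then show ?thesis
    unfolding S e_inv E_def by simp
qed

end

section \<open>Polynomials fixed by Frobenius\<close>

lemma prod_linear_power_dvd:
  fixes f :: "'a::field poly"
  assumes "finite S" "f \<noteq> 0" "\<And>x. x \<in> S \<Longrightarrow> u \<le> order x f"
  shows "(\<Prod>x\<in>S. [:-x, 1:] ^ u) dvd f"
  using assms
proof (induction S rule: finite_induct)
  case (insert x S)
  then have "(\<Prod>x\<in>S. [:-x, 1:] ^ u) dvd f" by blast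
  then obtain g where g: "f = (\<Prod>x\<in>S. [:-x, 1:] ^ u) * g" by (rule dvdE)
  have "poly (\<Prod>x\<in>S. [:-x, 1:] ^ u) x \<noteq> 0"
    using insert(1,2) by (auto simp: poly_prod)
  then have "order x (\<Prod>x\<in>S. [:-x, 1:] ^ u) = 0" by (simp add: order_root)
  moreover have "order x f = order x (\<Prod>x\<in>S. [:-x, 1:] ^ u) + order x g"
    using insert.prems(1) unfolding g by (rule order_mult)
  ultimately have "u \<le> order x g" using insert.prems(2)[of x] by simp
  then have "[:-x, 1:] ^ u dvd g" by (simp add: order_divides)
  then have "[:-x, 1:] ^ u * (\<Prod>x\<in>S. [:-x, 1:] ^ u) dvd g * (\<Prod>x\<in>S. [:-x, 1:] ^ u)"
    by (rule mult_dvd_mono) (rule dvd_refl)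
  then show ?case
    unfolding prod.insert[OF insert(1,2)] using g by (simp only: mult.commute)
qed auto

definition frob_poly :: "'k::finite_field alg_closure poly \<Rightarrow> 'k alg_closure poly" where
  "frob_poly = map_poly (\<lambda>x. x ^ CARD('k))"

lemma CARD_pos: "CARD('k::finite_field) > 0"
  using CARD_finite_field_ge_2[where 'k='k] by simp

lemma frobenius_sum:
  fixes h :: "'i \<Rightarrow> 'k::finite_field alg_closure"
  shows "(\<Sum>i\<in>I. h i) ^ CARD('k) = (\<Sum>i\<in>I. h i ^ CARD('k))"
  by (induction I rule: infinite_finite_induct) (auto simp: frobenius_add power_0_left)

lemma frobenius_uminus:
  fixes x :: "'k::finite_field alg_closure"
  shows "(- x) ^ CARD('k) = - (x ^ CARD('k))"
  using frobenius_add[of x "- x"] by (simp add: eq_neg_iff_add_eq_0 add.commute power_0_left)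

lemma frobenius_power_diff:
  fixes x y :: "'k::finite_field alg_closure"
  shows "(x - y) ^ (CARD('k) ^ r) = x ^ (CARD('k) ^ r) - y ^ (CARD('k) ^ r)"
  using frobenius_power_add[of "x - y" y r] by (simp add: eq_diff_eq)

lemma frobenius_power_inj:
  fixes x y :: "'k::finite_field alg_closure"
  assumes "x ^ (CARD('k) ^ r) = y ^ (CARD('k) ^ r)"
  shows "x = y"
proof -
  have "(x - y) ^ (CARD('k) ^ r) = 0"
    by (subst frobenius_power_diff, subst assms, rule diff_self)
  then have "x - y = 0" using power_not_zero[of "x - y"] by blast
  then show ?thesis by (rule right_minus_eq[THEN iffD1])
qed

lemma coeff_frob_poly: "coeff (frob_poly p) i = coeff p i ^ CARD('k)"
  for p :: "'k::finite_field alg_closure poly"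
  unfolding frob_poly_def by (rule coeff_map_poly) (simp add: power_0_left)

lemma frob_poly_mult: "frob_poly (p * r) = frob_poly p * frob_poly r"
  by (rule poly_eqI) (simp add: coeff_frob_poly coeff_mult frobenius_sum power_mult_distrib)

lemma frob_poly_1 [simp]: "frob_poly 1 = 1"
  by (rule poly_eqI) (simp add: coeff_frob_poly coeff_1 power_0_left)

lemma frob_poly_prod: "frob_poly (\<Prod>i\<in>I. h i) = (\<Prod>i\<in>I. frob_poly (h i))"
  by (induction I rule: infinite_finite_induct) (auto simp: frob_poly_mult)

lemma frob_poly_power: "frob_poly (p ^ n) = frob_poly p ^ n"
  by (induction n) (auto simp: frob_poly_mult)

lemma frob_poly_linear: "frob_poly [:- x, 1:] = [:- (x ^ CARD('k)), 1:]"
  for x :: "'k::finite_field alg_closure"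
  by (rule poly_eqI) (auto simp: coeff_frob_poly coeff_pCons frobenius_uminus power_0_left split:
      nat.splits)

text \<open>
  The monic polynomials of degree \<open>n\<close> over \<open>'k\<close>, seen in the algebraic closure: their coefficients are
  fixed by Frobenius. In this form the quotient of two of them is again of this kind by
  uniqueness of division, and their roots are directly available.
\<close>

definition monics :: "nat \<Rightarrow> 'k::finite_field alg_closure poly set" where
  "monics n = {p. degree p = n \<and> lead_coeff p = 1 \<and> frob_poly p = p}"

lemma monics_coeff: "p \<in> monics n \<Longrightarrow> coeff p i \<in> range to_ac"
  unfolding ext_1[symmetric] ext_def monics_def by (auto simp: poly_eq_iff coeff_frob_poly)

lemma monics_coeff_top: "p \<in> monics n \<Longrightarrow> coeff p n = 1"
  by (auto simp: monics_def)

lemma monicsI: "degree p = n \<Longrightarrow> coeff p n = 1 \<Longrightarrow> frob_poly p = p \<Longrightarrow> p \<in> monics n"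
  by (auto simp: monics_def)

lemma monics_nz: "p \<in> monics n \<Longrightarrow> p \<noteq> 0"
  by (auto simp: monics_def)

lemma monics_mult: "p \<in> monics m \<Longrightarrow> r \<in> monics n \<Longrightarrow> p * r \<in> monics (m + n)"
  using monics_nz[of p] monics_nz[of r]
  by (auto simp: monics_def frob_poly_mult degree_mult_eq lead_coeff_mult)

lemma monics_quotient:
  assumes "p \<in> monics m" "p * r \<in> monics n"
  shows "m \<le> n" "r \<in> monics (n - m)"
proof -
  have nz: "p \<noteq> 0" "r \<noteq> 0" using monics_nz[OF assms(2)] by auto
  then have "degree (p * r) = degree p + degree r" by (simp add: degree_mult_eq)
  moreover have "p * frob_poly r = p * r"
    using assms by (simp add: monics_def frob_poly_mult)
  then have "frob_poly r = r" using nz by simp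
  moreover have "lead_coeff p = 1" using assms(1) by (auto simp: monics_def)
  then have "lead_coeff (p * r) = lead_coeff r" by (simp only: lead_coeff_mult mult_1_left)
  ultimately show "m \<le> n" "r \<in> monics (n - m)" using assms by (auto simp: monics_def)
qed

lemma finite_monics: "finite (monics n :: 'k::finite_field alg_closure poly set)"
proof (rule finite_imageD)
  let ?h = "\<lambda>p :: 'k alg_closure poly. \<lambda>i\<in>{..n}. coeff p i"
  have "?h ` monics n \<subseteq> {..n} \<rightarrow>\<^sub>E (range to_ac :: 'k alg_closure set)"
    by (intro image_subsetI restrict_PiE_iff[THEN iffD2] ballI monics_coeff)
  then show "finite (?h ` (monics n :: 'k alg_closure poly set))"
    by (rule finite_subset) (auto intro: finite_PiE)
  show "inj_on ?h (monics n :: 'k alg_closure poly set)"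
  proof (rule inj_onI)
    fix p r :: "'k alg_closure poly" assume A: "p \<in> monics n" "r \<in> monics n" "?h p = ?h r"
    show "p = r"
    proof (rule poly_eqI)
      show "coeff p i = coeff r i" for i
        using A(1,2) fun_cong[OF A(3), of i]
        by (cases "i \<le> n") (auto simp: monics_def coeff_eq_0)
    qed
  qed
qed

lemma monics_0: "monics 0 = {1 :: 'k::finite_field alg_closure poly}"
  by (auto simp: monics_def elim!: degree_eq_zeroE)

text \<open>
  For \<open>x \<in> ext k\<close> the characteristic polynomial of \<open>x\<close>, that is, the power of degree \<open>k\<close> of the minimal
  polynomial of \<open>x\<close>.
\<close>

definition conj_poly :: "nat \<Rightarrow> 'k::finite_field alg_closure \<Rightarrow> 'k alg_closure poly" where
  "conj_poly k x = (\<Prod>i<k. [:- (x ^ (CARD('k) ^ i)), 1:])"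

lemma degree_conj_poly: "degree (conj_poly k x) = k"
  unfolding conj_poly_def by (subst degree_prod_eq_sum_degree) auto

lemma lead_coeff_conj_poly: "lead_coeff (conj_poly k x) = 1"
  unfolding conj_poly_def lead_coeff_prod by (simp add: prod.neutral)

lemma conj_poly_in_monics:
  fixes x :: "'k::finite_field alg_closure"
  assumes "x \<in> ext k"
  shows "conj_poly k x \<in> monics k"
proof -
  \<comment> \<open>Frobenius permutes the conjugates cyclically; the factor for \<open>x\<close> closes the cycle.\<close>
  have "[:- x, 1:] * frob_poly (conj_poly k x) = [:- x, 1:] * (\<Prod>i<k. [:- (x ^ (CARD('k) ^ Suc i)), 1:])"
    unfolding conj_poly_def frob_poly_prod frob_poly_linear
    by (simp add: mult.commute del: mult_pCons_left flip: power_mult)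
  also have "\<dots> = (\<Prod>i<Suc k. [:- (x ^ (CARD('k) ^ i)), 1:])"
    by (subst prod.lessThan_Suc_shift) simp
  also have "\<dots> = [:- x, 1:] * conj_poly k x"
    using assms by (simp add: ext_def conj_poly_def mult.commute del: mult_pCons_left)
  finally have "frob_poly (conj_poly k x) = conj_poly k x"
    by (simp only: mult_cancel_left) simp
  then show ?thesis
    using degree_conj_poly[of k x] lead_coeff_conj_poly[of k x] by (simp add: monics_def)
qed

lemma prod_lessThan_add:
  fixes h :: "nat \<Rightarrow> 'a::comm_monoid_mult"
  shows "(\<Prod>i<m + n. h i) = (\<Prod>i<m. h i) * (\<Prod>i<n. h (m + i))"
  by (induction n) (simp_all add: mult.assoc)

text \<open>
  Frobenius maps \<open>f\<close> to itself, hence a power of \<open>X - x\<close> dividing \<open>f\<close> to the same power of \<open>X - x\<^sup>q\<close>.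
\<close>

lemma order_le_order_frob:
  fixes x :: "'k::finite_field alg_closure"
  assumes "f \<in> monics n"
  shows "order x f \<le> order (x ^ CARD('k)) f"
proof -
  have "[:- x, 1:] ^ order x f dvd f" by (rule order_1)
  then obtain g where "f = [:- x, 1:] ^ order x f * g" by (auto elim: dvdE)
  then have "frob_poly f = [:- (x ^ CARD('k)), 1:] ^ order x f * frob_poly g"
    by (metis frob_poly_mult frob_poly_power frob_poly_linear)
  moreover have "frob_poly f = f" using assms by (simp add: monics_def)
  ultimately have "[:- (x ^ CARD('k)), 1:] ^ order x f dvd f" by (metis dvd_triv_left)
  then show ?thesis using monics_nz[OF assms] by (simp add: order_divides)
qed

lemma order_le_order_frob_power:
  fixes x :: "'k::finite_field alg_closure"
  assumes "f \<in> monics n"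
  shows "order x f \<le> order (x ^ (CARD('k) ^ i)) f"
proof (induction i)
  case (Suc i)
  have "(x ^ (CARD('k) ^ i)) ^ CARD('k) = x ^ (CARD('k) ^ Suc i)"
    by (simp add: mult.commute flip: power_mult)
  with Suc order_le_order_frob[OF assms, of "x ^ (CARD('k) ^ i)"] show ?case by simp
qed simp

text \<open>
  If \<open>s\<close> is the degree of \<open>x\<close>, then \<open>x \<in> ext k\<close> means \<open>s dvd k\<close>, and \<open>conj_poly (s * u) x\<close> is the
  \<open>u\<close>-th power of the minimal polynomial. All conjugates of \<open>x\<close> have the same multiplicity in \<open>f\<close>, so this
  power divides \<open>f\<close> exactly for \<open>u\<close> up to that multiplicity.
\<close>

lemma card_conj_poly_dvd:
  fixes x :: "'k::finite_field alg_closure"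
  assumes f: "f \<in> monics n" and root: "poly f x = 0"
  shows "card {k \<in> {1..n}. x \<in> ext k \<and> conj_poly k x dvd f} = order x f"
proof -
  define e where "e = (\<lambda>i. x ^ (CARD('k) ^ i))"
  have e_add: "e (i + j) = e i ^ (CARD('k) ^ j)" for i j
    by (simp add: e_def power_add flip: power_mult)
  have e0: "e 0 = x" by (simp add: e_def)
  have ext_iff: "x \<in> ext k \<longleftrightarrow> e k = x" for k by (simp add: ext_def e_def)
  have fnz: "f \<noteq> 0" using monics_nz[OF f] .
  have "e i \<in> {y. poly f y = 0}" for i
    using order_le_order_frob_power[OF f, of x i] root fnz by (simp add: e_def order_root)
  then have "finite (range e)"
    using poly_roots_finite[OF fnz] by (meson finite_subset image_subsetI)
  then have "\<not> inj e" using finite_imageD by blast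
  then obtain i j where "i < j" "e i = e j" by (metis injI linorder_neqE_nat)
  \<comment> \<open>Frobenius is injective, so the finite orbit of \<open>x\<close> returns to \<open>x\<close> itself.\<close>
  then have "e (0 + i) = e ((j - i) + i)" by simp
  then have "e 0 = e (j - i)" unfolding e_add by (rule frobenius_power_inj)
  then have ex: "\<exists>k>0. e k = x" using \<open>i < j\<close> e0 by (intro exI[of _ "j - i"]) auto
  define s where "s = (LEAST k. k > 0 \<and> e k = x)"
  have s: "s > 0" "e s = x" using LeastI_ex[OF ex] by (auto simp: s_def)
  have s_min: "s \<le> k" if "k > 0" "e k = x" for k unfolding s_def using that by (intro Least_le) auto
  have e_mult: "e (s * u + i) = e i" for u i
  proof (induction u)
    case (Suc u)
    have "e (s * Suc u + i) = e (s + (s * u + i))" by (simp add: algebra_simps)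
    also have "\<dots> = e (s * u + i)" unfolding e_add[of s] s(2) by (simp add: e_def)
    finally show ?case using Suc by simp
  qed simp
  have e_inj: "inj_on e {..<s}"
  proof -
    have False if "i < j" "j < s" "e i = e j" for i j
    proof -
      have "e (i + (s - j)) = e (j + (s - j))" using that(3) unfolding e_add by simp
      then have "e (i + (s - j)) = x" using that s by simp
      then show False using s_min[of "i + (s - j)"] that by simp
    qed
    then show ?thesis by (intro linorder_inj_onI) auto
  qed
  have dvd_iff: "x \<in> ext k \<longleftrightarrow> s dvd k" for k
  proof -
    have "e k = e (s * (k div s) + k mod s)" by simp
    then have "e k = e (k mod s)" by (simp only: e_mult)
    moreover have "k mod s < s" using s(1) by simp
    then have "e (k mod s) = x \<longleftrightarrow> k mod s = 0"
      using s_min[of "k mod s"] e0 by (cases "k mod s = 0") auto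
    ultimately show ?thesis by (simp add: ext_iff dvd_eq_mod_eq_0)
  qed
  have conj: "conj_poly (s * u) x = (\<Prod>y\<in>e ` {..<s}. [:- y, 1:] ^ u)" for u
  proof -
    have "(\<Prod>i<s * u. [:- e i, 1:]) = (\<Prod>i<s. [:- e i, 1:]) ^ u"
    proof (induction u)
      case (Suc u)
      have "(\<Prod>i<s * Suc u. [:- e i, 1:]) = (\<Prod>i<s * u + s. [:- e i, 1:])" by (simp add: add.commute)
      also have "\<dots> = (\<Prod>i<s * u. [:- e i, 1:]) * (\<Prod>i<s. [:- e (s * u + i), 1:])"
        by (rule prod_lessThan_add)
      finally show ?case using Suc by (simp only: e_mult power_Suc2)
    qed simp
    moreover have "conj_poly (s * u) x = (\<Prod>i<s * u. [:- e i, 1:])"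
      by (simp only: conj_poly_def e_def)
    moreover have "(\<Prod>y\<in>e ` {..<s}. [:- y, 1:] ^ u) = (\<Prod>i<s. [:- e i, 1:]) ^ u"
      by (subst prod.reindex[OF e_inj]) (simp only: prod_power_distrib o_def)
    ultimately show ?thesis by simp
  qed
  have order_e: "order x f \<le> order y f" if "y \<in> e ` {..<s}" for y
    using that order_le_order_frob_power[OF f] by (auto simp: e_def)
  have conj_dvd: "conj_poly (s * u) x dvd f \<longleftrightarrow> u \<le> order x f" for u
  proof
    assume "conj_poly (s * u) x dvd f"
    moreover have "[:- x, 1:] ^ u dvd conj_poly (s * u) x"
      unfolding conj using e0 s(1) by (intro dvd_prodI) (auto intro!: image_eqI[of _ _ 0])
    ultimately have "[:- x, 1:] ^ u dvd f" by (rule dvd_trans[rotated])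
    then show "u \<le> order x f" using fnz by (simp add: order_divides)
  next
    assume "u \<le> order x f"
    then show "conj_poly (s * u) x dvd f"
      unfolding conj using fnz order_e by (intro prod_linear_power_dvd) force+
  qed
  have "{k \<in> {1..n}. x \<in> ext k \<and> conj_poly k x dvd f} = (\<lambda>u. s * u) ` {1..order x f}"
  proof (intro equalityI subsetI)
    fix k assume k: "k \<in> {k \<in> {1..n}. x \<in> ext k \<and> conj_poly k x dvd f}"
    then obtain u where u: "k = s * u" using dvd_iff by auto
    then have "u \<le> order x f" using conj_dvd k by simp
    then show "k \<in> (\<lambda>u. s * u) ` {1..order x f}" using u k
        by (intro image_eqI[of _ _ u]) (auto simp: Suc_le_eq)
  next
    fix k assume "k \<in> (\<lambda>u. s * u) ` {1..order x f}"
    then obtain u where "u \<in> {1..order x f}" and u: "k = s * u" by blast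
    then have u: "k = s * u" "1 \<le> u" "u \<le> order x f" by simp_all
    then have "conj_poly k x dvd f" using conj_dvd by simp
    moreover from this have "k \<le> n" using dvd_imp_degree_le[OF _ fnz] degree_conj_poly[of k x] f
      by (metis (mono_tags, lifting) mem_Collect_eq monics_def)
    ultimately show "k \<in> {k \<in> {1..n}. x \<in> ext k \<and> conj_poly k x dvd f}"
      using u s(1) dvd_iff by (auto simp: Suc_le_eq)
  qed
  then show ?thesis using s(1) by (simp add: card_image inj_on_def)
qed

lemma finite_ext: "k \<ge> 1 \<Longrightarrow> finite (ext k :: 'k::finite_field alg_closure set)"
  using card_ext[of k, where 'k='k] CARD_pos[where 'k='k] by (intro card_ge_0_finite) simp

text \<open>
  Adding up the multiplicities of all roots gives the degree. This plays the part of unique factorization: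
  it is the identity \<open>n = \<Sum> deg P\<close> over all prime powers \<open>P\<^sup>e\<close> dividing \<open>f\<close>, expressed by roots.
\<close>

lemma sum_card_conj_poly_dvd:
  fixes f :: "'k::finite_field alg_closure poly"
  assumes f: "f \<in> monics n"
  shows "(\<Sum>k=1..n. card {x \<in> ext k. conj_poly k x dvd f}) = n"
proof -
  let ?Z = "{x. poly f x = 0}"
  have finZ: "finite ?Z" using poly_roots_finite[OF monics_nz[OF f]] .
  have sub: "x \<in> ?Z" if "k \<in> {1..n}" "conj_poly k x dvd f" for k x
  proof -
    have "[:- x, 1:] dvd conj_poly k x"
      unfolding conj_poly_def using that(1) dvd_prodI[of "{..<k}" 0 "\<lambda>i. [:- (x ^ CARD('k) ^ i), 1:]"]
          by simp
    then show ?thesis using that(2) by (simp add: poly_eq_0_iff_dvd) (metis dvd_trans)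
  qed
  have "(\<Sum>k=1..n. card {x \<in> ext k. conj_poly k x dvd f}) =
     (\<Sum>k=1..n. card {x \<in> ?Z. x \<in> ext k \<and> conj_poly k x dvd f})"
    using sub by (intro sum.cong refl arg_cong[where f=card]) blast
  also have "\<dots> = (\<Sum>k=1..n. \<Sum>x\<in>?Z. if x \<in> ext k \<and> conj_poly k x dvd f then 1 else 0)"
    using finZ by (simp add: sum.If_cases Int_def)
  also have "\<dots> = (\<Sum>x\<in>?Z. \<Sum>k=1..n. if x \<in> ext k \<and> conj_poly k x dvd f then 1 else 0)"
    by (rule sum.swap)
  also have "\<dots> = (\<Sum>x\<in>?Z. card {k \<in> {1..n}. x \<in> ext k \<and> conj_poly k x dvd f})"
    by (simp add: sum.If_cases Int_def)
  also have "\<dots> = (\<Sum>x\<in>?Z. order x f)"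
    using card_conj_poly_dvd[OF f] by (intro sum.cong) auto
  also have "\<dots> = n" using sum_order_eq_degree[OF monics_nz[OF f]] f by (simp add: monics_def)
  finally show ?thesis .
qed

section \<open>The Hasse-Davenport relation\<close>

definition ext_trace :: "nat \<Rightarrow> 'k::finite_field alg_closure \<Rightarrow> 'k" where
  "ext_trace r x = of_ac (\<Sum>i<r. x ^ (CARD('k) ^ i))"

text \<open>
  \<open>\<psi>\<close> of the sum of the roots times \<open>\<eta>\<close> of their product. Coefficient \<open>1\<close> of the reflected polynomial is
  the coefficient of \<open>X\<^sup>n\<^sup>-\<^sup>1\<close>; it is \<open>0\<close> for constant polynomials, and the constant \<open>1\<close> thus has weight \<open>1\<close>.
\<close>

definition poly_weight :: "('k::finite_field \<Rightarrow> qbar) \<Rightarrow> ('k \<Rightarrow> qbar) \<Rightarrow> 'k alg_closure poly \<Rightarrow> qbar" where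
  "poly_weight \<psi> \<eta> p = \<psi> (of_ac (- coeff (reflect_poly p) 1)) *
      \<eta> (of_ac ((- 1) ^ degree p * coeff p 0))"

lemma of_ac_mult: "x \<in> range to_ac \<Longrightarrow> y \<in> range to_ac \<Longrightarrow> of_ac (x * y) = of_ac x * of_ac y"
  by (auto intro!: of_ac_eqI simp: to_ac_of_ac)

lemma of_ac_add: "x \<in> range to_ac \<Longrightarrow> y \<in> range to_ac \<Longrightarrow> of_ac (x + y) = of_ac x + of_ac y"
  by (auto intro!: of_ac_eqI simp: to_ac_of_ac)

lemma range_to_ac:
  fixes x y :: "'a::field alg_closure"
  shows "(0 :: 'a alg_closure) \<in> range to_ac" "(1 :: 'a alg_closure) \<in> range to_ac"
    "x \<in> range to_ac \<Longrightarrow> - x \<in> range to_ac"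
    "x \<in> range to_ac \<Longrightarrow> y \<in> range to_ac \<Longrightarrow> x * y \<in> range to_ac"
    "x \<in> range to_ac \<Longrightarrow> x ^ n \<in> range to_ac"
proof -
  show "(0 :: 'a alg_closure) \<in> range to_ac" "(1 :: 'a alg_closure) \<in> range to_ac"
    by (rule range_eqI[of _ _ 0], simp, rule range_eqI[of _ _ 1], simp)
  show "- x \<in> range to_ac" if "x \<in> range to_ac"
    using that by (auto simp flip: to_ac_minus)
  show "x * y \<in> range to_ac" if "x \<in> range to_ac" "y \<in> range to_ac"
    using that by (auto simp flip: to_ac_mult)
  show "x ^ n \<in> range to_ac" if "x \<in> range to_ac"
    using that by (auto simp flip: to_ac_power)
qed

lemma finite_subfield_UNIV: "finite_subfield (UNIV :: 'k::finite_field set)"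
  by unfold_locales auto

lemma finite_subfield_ext: "r \<ge> 1 \<Longrightarrow> finite_subfield (ext r :: 'k::finite_field alg_closure set)"
  by unfold_locales (auto simp: finite_ext ext_subfield)

lemma coeff_1_reflect_poly_mult:
  fixes p r :: "'a::{comm_ring_1,ring_no_zero_divisors} poly"
  assumes "lead_coeff p = 1" "lead_coeff r = 1"
  shows "coeff (reflect_poly (p * r)) 1 = coeff (reflect_poly p) 1 + coeff (reflect_poly r) 1"
  unfolding reflect_poly_mult One_nat_def coeff_mult by (simp add: assms)

lemma poly_weight_mult:
  assumes \<psi>: "nontriv_add_char UNIV \<psi>" and \<eta>: "\<eta> \<in> mult_chars UNIV"
    and p: "p \<in> monics m" and r: "r \<in> monics n"
  shows "poly_weight \<psi> \<eta> (p * r) = poly_weight \<psi> \<eta> p * poly_weight \<psi> \<eta> r"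
proof -
  interpret finite_subfield "UNIV :: 'a set" by (rule finite_subfield_UNIV)
  note c = monics_coeff[OF p] monics_coeff[OF r]
  have refl_in: "coeff (reflect_poly p) 1 \<in> range to_ac" "coeff (reflect_poly r) 1 \<in> range to_ac"
    using c by (auto simp: coeff_reflect_poly range_to_ac)
  have lc: "lead_coeff p = 1" "lead_coeff r = 1" using p r by (auto simp: monics_def)
  have "- coeff (reflect_poly (p * r)) 1 = - coeff (reflect_poly p) 1 + - coeff (reflect_poly r) 1"
    by (simp only: coeff_1_reflect_poly_mult[OF lc] minus_add_distrib)
  then have 1: "of_ac (- coeff (reflect_poly (p * r)) 1) = of_ac (- coeff (reflect_poly p) 1) +
      of_ac (- coeff (reflect_poly r) 1)"
    by (simp only: of_ac_add range_to_ac refl_in)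
  have "(- 1) ^ degree (p * r) * coeff (p * r) 0 = ((- 1) ^ degree p * coeff p 0) *
      ((- 1) ^ degree r * coeff r 0)"
    using monics_nz[OF p] monics_nz[OF r] by (simp add: degree_mult_eq coeff_mult power_add)
  then have 2: "of_ac ((- 1) ^ degree (p * r) * coeff (p * r) 0) =
      of_ac ((- 1) ^ degree p * coeff p 0) * of_ac ((- 1) ^ degree r * coeff r 0)"
    using c by (simp add: of_ac_mult range_to_ac)
  show ?thesis using \<psi> unfolding poly_weight_def 1 2
    by (simp add: mult_charsD[OF \<eta>] nontriv_add_char_def)
qed

text \<open>
  The roots of \<open>conj_poly k x\<close> are the conjugates of \<open>x\<close>; their sum and product are trace and norm.
\<close>

lemma poly_weight_conj:
  fixes x :: "'k::finite_field alg_closure"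
  assumes "x \<in> ext k"
  shows "poly_weight \<psi> \<eta> (conj_poly k x) = \<psi> (ext_trace k x) * lift_char k \<eta> x"
proof -
  have "coeff (conj_poly k x) 0 = (\<Prod>i<k. - (x ^ CARD('k) ^ i))"
    unfolding conj_poly_def by (simp add: poly_prod flip: poly_0_coeff_0)
  then have 1: "(- 1) ^ degree (conj_poly k x) * coeff (conj_poly k x) 0 = (\<Prod>i<k. x ^ CARD('k) ^ i)"
    by (simp add: degree_conj_poly prod_uminus flip: mult.assoc power_mult_distrib)
  have "coeff (reflect_poly (conj_poly j x)) 1 = - (\<Sum>i<j. x ^ CARD('k) ^ i)" for j
  proof (induction j)
    case (Suc j)
    have lin: "coeff (reflect_poly [:- c, 1:]) 1 = - c" for c :: "'k alg_closure"
      by (simp add: coeff_reflect_poly)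
    have "conj_poly (Suc j) x = conj_poly j x * [:- (x ^ CARD('k) ^ j), 1:]"
      unfolding conj_poly_def by (rule prod.lessThan_Suc)
    moreover have "lead_coeff [:- (x ^ CARD('k) ^ j), 1:] = 1" by simp
    ultimately have "coeff (reflect_poly (conj_poly (Suc j) x)) 1 =
        coeff (reflect_poly (conj_poly j x)) 1 + - (x ^ CARD('k) ^ j)"
      by (simp only: coeff_1_reflect_poly_mult lead_coeff_conj_poly lin)
    then show ?case using Suc by simp
  qed (simp add: conj_poly_def)
  then show ?thesis
    using assms unfolding poly_weight_def 1 by (simp add: ext_trace_def lift_char_def ext_norm_def)
qed

text \<open>
  Subtracting \<open>u X\<^sup>n\<^sup>-\<^sup>1\<close> permutes the monic polynomials, multiplies the first factor of the weight by
  \<open>\<psi> u\<close>, and leaves the constant coefficient unchanged because \<open>n \<ge> 2\<close>.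
\<close>

lemma sum_poly_weight_eq_0:
  assumes \<psi>: "nontriv_add_char UNIV (\<psi> :: 'k::finite_field \<Rightarrow> qbar)" and "n \<ge> 2"
  shows "(\<Sum>p\<in>monics n. poly_weight \<psi> \<eta> p) = 0"
proof -
  obtain u where u: "\<psi> u \<noteq> 1" using \<psi> by (auto simp: nontriv_add_char_def)
  define T where "T = (\<lambda>p. p + monom (to_ac u) (n - 1))"
  define T' where "T' = (\<lambda>p. p - monom (to_ac u) (n - 1))"
  have uq: "to_ac u ^ CARD('k) = to_ac u"
    using ext_subfield(7)[of u 1] by (simp add: ext_def)
  have deg: "degree (monom (to_ac u) (n - 1)) < n" "degree (- monom (to_ac u) (n - 1)) < n"
    using \<open>n \<ge> 2\<close> degree_monom_le[of "to_ac u" "n - 1"] by auto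
  have T_in: "p + m \<in> monics n" if "p \<in> monics n" "degree m < n" "frob_poly m = m"
      for p m :: "'k alg_closure poly"
  proof -
    have "degree (p + m) = n" using that by (simp add: monics_def degree_add_eq_left)
    moreover have "frob_poly (p + m) = p + m"
      using that by (simp add: monics_def poly_eq_iff coeff_frob_poly frobenius_add)
    ultimately show ?thesis using that monics_coeff_top[OF that(1)]
        by (intro monicsI) (simp_all add: coeff_eq_0)
  qed
  have m_fixed: "frob_poly (monom (to_ac u) (n - 1)) = monom (to_ac u) (n - 1)"
    "frob_poly (- monom (to_ac u) (n - 1)) = - monom (to_ac u) (n - 1)"
    by (auto simp: poly_eq_iff coeff_frob_poly uq frobenius_uminus power_0_left)
  have wt: "poly_weight \<psi> \<eta> (T' p) = \<psi> u * poly_weight \<psi> \<eta> p" if p: "p \<in> monics n" for p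
  proof -
    have T'p: "T' p \<in> monics n" using T_in[OF p deg(2) m_fixed(2)] by (simp add: T'_def)
    have "coeff (reflect_poly (T' p)) 1 = coeff (reflect_poly p) 1 - to_ac u"
      using p T'p \<open>n \<ge> 2\<close> by (simp add: coeff_reflect_poly monics_def) (simp add: T'_def)
    then have "- coeff (reflect_poly (T' p)) 1 = to_ac u + - coeff (reflect_poly p) 1" by simp
    moreover have "- coeff (reflect_poly p) 1 \<in> range to_ac"
      using monics_coeff[OF p] by (auto simp: coeff_reflect_poly range_to_ac)
    ultimately have 1: "of_ac (- coeff (reflect_poly (T' p)) 1) = u +
        of_ac (- coeff (reflect_poly p) 1)"
      by (simp only: of_ac_add rangeI of_ac_to_ac)
    have 2: "degree (T' p) = degree p" "coeff (T' p) 0 = coeff p 0"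
      using p T'p \<open>n \<ge> 2\<close> by (auto simp: monics_def T'_def)
    show ?thesis using \<psi> unfolding poly_weight_def 1 2 by (simp add: nontriv_add_char_def)
  qed
  have "(\<Sum>p\<in>monics n. poly_weight \<psi> \<eta> p) = (\<Sum>p\<in>monics n. poly_weight \<psi> \<eta> (T' p))"
  proof (rule sum.reindex_bij_witness[of _ T' T])
    show "T p \<in> monics n" if "p \<in> monics n" for p using T_in[OF that deg(1) m_fixed(1)]
        by (simp add: T_def)
    show "T' p \<in> monics n" if "p \<in> monics n" for p using T_in[OF that deg(2) m_fixed(2)]
        by (simp add: T'_def)
  qed (auto simp: T_def T'_def)
  also have "\<dots> = \<psi> u * (\<Sum>p\<in>monics n. poly_weight \<psi> \<eta> p)"
    by (simp add: sum_distrib_left wt)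
  finally show ?thesis using u by (metis mult_cancel_right1)
qed

text \<open>
  Newton's identity between the sums of weights and the power sums given by the Gauss sums over the
  extensions. Triples of \<open>k\<close>, \<open>x \<in> ext k\<close> and \<open>f\<close> with \<open>conj_poly k x dvd f\<close> are weighted by \<open>f\<close>: for fixed
  \<open>f\<close> there are \<open>n\<close> of them, and for fixed \<open>k\<close> and \<open>x\<close> the cofactor runs through all monic polynomials of
  degree \<open>n - k\<close>.
\<close>

lemma newton_identity:
  assumes \<psi>: "nontriv_add_char UNIV (\<psi> :: 'k::finite_field \<Rightarrow> qbar)" and \<eta>: "\<eta> \<in> mult_chars UNIV"
  shows "of_nat n * (\<Sum>p\<in>monics n. poly_weight \<psi> \<eta> p) =
    (\<Sum>k=1..n. (\<Sum>x\<in>ext k. \<psi> (ext_trace k x) * lift_char k \<eta> x) * (\<Sum>p\<in>monics (n - k). poly_weight \<psi> \<eta> p))"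
proof -
  have inner: "(\<Sum>f\<in>{f\<in>monics n. conj_poly k x dvd f}. poly_weight \<psi> \<eta> f) =
     \<psi> (ext_trace k x) * lift_char k \<eta> x * (\<Sum>p\<in>monics (n - k). poly_weight \<psi> \<eta> p)"
    if k: "k \<in> {1..n}" and x: "x \<in> ext k" for k and x :: "'k alg_closure"
  proof -
    note P = conj_poly_in_monics[OF x]
    have "(\<Sum>f\<in>{f\<in>monics n. conj_poly k x dvd f}. poly_weight \<psi> \<eta> f) =
       (\<Sum>g\<in>monics (n - k). poly_weight \<psi> \<eta> (conj_poly k x * g))"
    proof (rule sum.reindex_bij_witness[of _ "\<lambda>g. conj_poly k x * g" "\<lambda>f. f div conj_poly k x"])
      fix f :: "'k alg_closure poly" assume f: "f \<in> {f\<in>monics n. conj_poly k x dvd f}"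
      then show *: "conj_poly k x * (f div conj_poly k x) = f" by simp
      show "f div conj_poly k x \<in> monics (n - k)"
        using monics_quotient(2)[OF P, of "f div conj_poly k x" n] * f by simp
      show "poly_weight \<psi> \<eta> (conj_poly k x * (f div conj_poly k x)) = poly_weight \<psi> \<eta> f"
        using * by simp
    next
      fix g :: "'k alg_closure poly" assume g: "g \<in> monics (n - k)"
      show "conj_poly k x * g div conj_poly k x = g" using monics_nz[OF P] by simp
      show "conj_poly k x * g \<in> {f\<in>monics n. conj_poly k x dvd f}"
        using monics_mult[OF P g] k by simp
    qed
    then show ?thesis
      using poly_weight_mult[OF \<psi> \<eta> P] poly_weight_conj[OF x, of \<psi> \<eta>] by (simp add: sum_distrib_left)
  qed
  have "of_nat n * (\<Sum>f\<in>monics n. poly_weight \<psi> \<eta> f) =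
     (\<Sum>f\<in>monics n. of_nat (\<Sum>k=1..n. card {x \<in> ext k. conj_poly k x dvd f}) * poly_weight \<psi> \<eta> f)"
    unfolding sum_distrib_left by (intro sum.cong refl) (simp only: sum_card_conj_poly_dvd)
  also have "\<dots> = (\<Sum>f\<in>monics n. \<Sum>k=1..n. \<Sum>x\<in>ext k. if conj_poly k x dvd f then poly_weight \<psi> \<eta> f else 0)"
  proof -
    have "of_nat (card {x \<in> ext k. conj_poly k x dvd f}) * poly_weight \<psi> \<eta> f
      = (\<Sum>x\<in>ext k. if conj_poly k x dvd f then poly_weight \<psi> \<eta> f else 0)" if "k \<in> {1..n}" for k f
      using that by (simp add: sum.If_cases finite_ext Int_def)
    then show ?thesis by (simp only: of_nat_sum sum_distrib_right cong: sum.cong)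
  qed
  also have "\<dots> = (\<Sum>k=1..n. \<Sum>x\<in>ext k. \<Sum>f\<in>monics n. if conj_poly k x dvd f then poly_weight \<psi> \<eta> f else 0)"
    by (subst sum.swap) (intro sum.cong refl sum.swap)
  also have "\<dots> = (\<Sum>k=1..n. \<Sum>x\<in>ext k. \<Sum>f\<in>{f\<in>monics n. conj_poly k x dvd f}. poly_weight \<psi> \<eta> f)"
    by (rule sum.cong[OF refl], rule sum.cong[OF refl]) (simp add: sum.If_cases finite_monics Int_def)
  also have "\<dots> = (\<Sum>k=1..n. (\<Sum>x\<in>ext k. \<psi> (ext_trace k x) * lift_char k \<eta> x) *
      (\<Sum>p\<in>monics (n - k). poly_weight \<psi> \<eta> p))"
    unfolding sum_distrib_right by (intro sum.cong refl inner)
  finally show ?thesis .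
qed

lemma gauss_ext_eq:
  assumes \<eta>: "\<eta> \<in> mult_chars (UNIV :: 'k::finite_field set)" and "r \<ge> 1"
  shows "gauss (ext r) (\<lambda>x. \<psi> (ext_trace r x)) (lift_char r \<eta>) =
      - (\<Sum>x\<in>ext r. \<psi> (ext_trace r x) * lift_char r \<eta> x)"
proof -
  interpret finite_subfield "UNIV :: 'k set" by (rule finite_subfield_UNIV)
  have "ext_norm r 0 = (0::'k)"
    using assms(2) by (auto simp: ext_norm_def power_0_left intro!: of_ac_eqI prod_zero)
  then have "lift_char r \<eta> 0 = 0" by (simp add: lift_char_def mult_charsD[OF \<eta>])
  then show ?thesis unfolding gauss_def
    by (subst sum.remove[OF finite_ext[OF assms(2)] ext_subfield(1)]) simp
qed

text \<open>
  In Newton's identity of degree \<open>\<ge> 2\<close> all sums of weights vanish except those of degree \<open>0\<close> and \<open>1\<close>, so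
  the power sums satisfy a two-term recursion and form, up to signs, a geometric progression.
\<close>

theorem hasse_davenport:
  assumes \<psi>: "nontriv_add_char UNIV (\<psi> :: 'k::finite_field \<Rightarrow> qbar)" and \<eta>: "\<eta> \<in> mult_chars UNIV"
    and r: "r \<ge> 1"
  shows "gauss (ext r) (\<lambda>x. \<psi> (ext_trace r x)) (lift_char r \<eta>) = gauss UNIV \<psi> \<eta> ^ r"
proof -
  interpret finite_subfield "UNIV :: 'k set" by (rule finite_subfield_UNIV)
  define p where "p = (\<lambda>k. \<Sum>x\<in>ext k. \<psi> (ext_trace k x) * lift_char k \<eta> x)"
  define c where "c = (\<lambda>n. \<Sum>f\<in>monics n. poly_weight \<psi> \<eta> f)"
  have newton: "of_nat n * c n = (\<Sum>k=1..n. p k * c (n - k))" for n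
    unfolding p_def c_def by (rule newton_identity[OF \<psi> \<eta>])
  have "\<psi> 0 = 1"
    using \<psi> unfolding nontriv_add_char_def by (metis UNIV_I add_0 mult_cancel_right1)
  moreover have "of_ac (1 :: 'k alg_closure) = 1" by (intro of_ac_eqI) simp
  ultimately have c0: "c 0 = 1"
    by (simp add: c_def monics_0 poly_weight_def mult_charsD[OF \<eta>])
  have c_ge2: "c n = 0" if "n \<ge> 2" for n
    unfolding c_def by (rule sum_poly_weight_eq_0[OF \<psi> that])
  have c1: "c 1 = p 1" using newton[of 1] c0 by simp
  have rec: "p (Suc (Suc m)) = - p (Suc m) * p 1" for m
  proof -
    have "0 = (\<Sum>k=1..Suc (Suc m). p k * c (Suc (Suc m) - k))"
      using newton[of "Suc (Suc m)"] c_ge2[of "Suc (Suc m)"] by simp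
    also have "\<dots> = (\<Sum>k\<in>{Suc m, Suc (Suc m)}. p k * c (Suc (Suc m) - k))"
      by (rule sum.mono_neutral_right) (auto intro!: c_ge2)
    also have "\<dots> = p (Suc m) * p 1 + p (Suc (Suc m))" using c0 c1 by simp
    finally show ?thesis by (simp add: eq_neg_iff_add_eq_0 add.commute)
  qed
  have "- p (Suc m) = (- p 1) ^ Suc m" for m
    by (induction m) (auto simp: rec)
  from this[of "r - 1"] have pr: "- p r = (- p 1) ^ r" using r by simp
  have "p 1 = (\<Sum>x\<in>UNIV. \<psi> x * \<eta> x)"
  proof -
    have *: "ext_trace 1 (to_ac x) = x" "lift_char 1 \<eta> (to_ac x) = \<eta> x" for x :: 'k
      using ext_subfield(7)[of x 1] by (auto simp: ext_trace_def lift_char_def ext_norm_def)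
    have "p 1 = (\<Sum>x\<in>range to_ac. \<psi> (ext_trace 1 x) * lift_char 1 \<eta> x)"
      unfolding p_def ext_1 ..
    also have "\<dots> = (\<Sum>x\<in>UNIV. \<psi> x * \<eta> x)"
      by (subst sum.reindex[OF inj_to_ac]) (simp add: * del: One_nat_def)
    finally show ?thesis .
  qed
  also have "\<dots> = - gauss UNIV \<psi> \<eta>"
    unfolding gauss_def by (simp add: sum.remove[of UNIV 0] mult_charsD[OF \<eta>])
  finally have "- p 1 = gauss UNIV \<psi> \<eta>" by simp
  with pr show ?thesis unfolding gauss_ext_eq[OF \<eta> r] p_def by simp
qed

section \<open>Lifting characters along the norm\<close>

lemma ext_norm_eq_iff: "x \<in> ext r \<Longrightarrow> ext_norm r x = v \<longleftrightarrow> (\<Prod>i<r. x ^ (CARD('k) ^ i)) = to_ac v"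
  for x :: "'k::finite_field alg_closure"
  using to_ac_ext_norm[of x r] by (metis to_ac_eq_iff)

lemma ext_norm_mult:
  fixes x y :: "'k::finite_field alg_closure"
  assumes "x \<in> ext r" "y \<in> ext r"
  shows "ext_norm r (x * y) = ext_norm r x * ext_norm r y"
  using assms by (simp add: ext_norm_eq_iff ext_subfield to_ac_ext_norm power_mult_distrib prod.distrib)

lemma ext_norm_eq_0_iff:
  fixes x :: "'k::finite_field alg_closure"
  assumes "x \<in> ext r" "r \<ge> 1"
  shows "ext_norm r x = 0 \<longleftrightarrow> x = 0"
proof -
  have "0 < r" using assms(2) by simp
  then show ?thesis
    unfolding ext_norm_eq_iff[OF assms(1)] using CARD_pos[where 'k='k] by (auto simp: prod_zero_iff)
qed

text \<open>
  The norm from \<open>ext r\<close> is the power map with this exponent, which is \<open>(q\<^sup>r - 1) / (q - 1)\<close>.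
\<close>

definition norm_exponent :: "nat \<Rightarrow> nat \<Rightarrow> nat" where
  "norm_exponent q r = (\<Sum>i<r. q ^ i)"

lemma norm_exponent_mult: "norm_exponent (CARD('k::finite_field)) r * (CARD('k) - 1) = CARD('k) ^ r - 1"
proof -
  have "int (norm_exponent (CARD('k)) r * (CARD('k) - 1)) = int (CARD('k) ^ r) - 1"
    using CARD_pos[where 'k='k] power_diff_1_eq[of "int (CARD('k))" r]
    by (simp add: norm_exponent_def of_nat_diff mult.commute lessThan_atLeast0)
  then show ?thesis by linarith
qed

lemma to_ac_ext_norm_power:
  fixes x :: "'k::finite_field alg_closure"
  assumes "x \<in> ext r"
  shows "to_ac (ext_norm r x) = x ^ norm_exponent (CARD('k)) r"
  using assms by (simp add: to_ac_ext_norm norm_exponent_def power_sum)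

lemma power_card_minus_1_imp_ext:
  fixes x :: "'k::finite_field alg_closure"
  assumes "x ^ (CARD('k) ^ r - 1) = 1"
  shows "x \<in> ext r"
proof -
  have "CARD('k) ^ r > 0" using CARD_pos[where 'k='k] by simp
  then have "x ^ (CARD('k) ^ r) = x * x ^ (CARD('k) ^ r - 1)" by (cases "CARD('k) ^ r") auto
  then show ?thesis using assms by (simp add: ext_def)
qed

lemma ext_imp_power_card_minus_1:
  fixes x :: "'k::finite_field alg_closure"
  assumes "x \<in> ext r" "x \<noteq> 0"
  shows "x ^ (CARD('k) ^ r - 1) = 1"
proof -
  have "CARD('k) ^ r > 0" using CARD_pos[where 'k='k] by simp
  then have "x ^ (CARD('k) ^ r) = x * x ^ (CARD('k) ^ r - 1)" by (cases "CARD('k) ^ r") auto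
  then show ?thesis using assms by (simp add: ext_def)
qed

text \<open>
  A root \<open>x\<close> of \<open>X\<^sup>M = v\<close>, with \<open>M\<close> the norm exponent, lies in \<open>ext r\<close> because \<open>x\<close> to the power
  \<open>q\<^sup>r - 1 = M (q - 1)\<close> is \<open>v\<^sup>q\<^sup>-\<^sup>1 = 1\<close>.
\<close>

lemma ext_norm_surj:
  fixes v :: "'k::finite_field"
  assumes "v \<noteq> 0" "r \<ge> 1"
  obtains x where "x \<in> ext r - {0}" "ext_norm r x = v"
proof -
  let ?M = "norm_exponent (CARD('k)) r"
  have "?M * (CARD('k) - 1) \<noteq> 0"
    using norm_exponent_mult[of r, where 'k='k] CARD_finite_field_ge_2[where 'k='k] one_less_power[of
        "CARD('k)" r] assms(2) by auto
  then have "?M > 0" by simp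
  then obtain x :: "'k alg_closure" where x: "x ^ ?M = to_ac v" using nth_root_exists by blast
  have "to_ac v \<in> ext 1" "to_ac v \<noteq> 0" using assms(1) ext_subfield(7)[of v 1] by simp_all
  then have "to_ac v ^ (CARD('k) - 1) = 1" using ext_imp_power_card_minus_1[of "to_ac v" 1] by simp
  then have "x ^ (CARD('k) ^ r - 1) = 1"
    unfolding norm_exponent_mult[symmetric] power_mult x .
  then have "x \<in> ext r" by (rule power_card_minus_1_imp_ext)
  moreover have "x \<noteq> 0" using x assms(1) \<open>?M > 0\<close> by (auto simp: power_0_left)
  moreover have "to_ac (ext_norm r x) = to_ac v" using to_ac_ext_norm_power[OF \<open>x \<in> ext r\<close>] x by simp
  ultimately show ?thesis using that by simp
qed

lemma ext_norm_0: "r \<ge> 1 \<Longrightarrow> ext_norm r (0 :: 'k::finite_field alg_closure) = 0"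
  by (simp add: ext_norm_eq_0_iff ext_subfield)

lemma lift_char_in:
  fixes \<eta> :: "'k::finite_field \<Rightarrow> qbar"
  assumes "\<eta> \<in> mult_chars UNIV" "r \<ge> 1"
  shows "lift_char r \<eta> \<in> mult_chars (ext r)"
  using assms unfolding mult_chars_def lift_char_def
  by (auto simp: ext_subfield ext_norm_mult ext_norm_eq_0_iff ext_norm_0)

lemma lift_char_triv: "r \<ge> 1 \<Longrightarrow> lift_char r (triv_char UNIV) = triv_char (ext r)"
  by (auto simp: lift_char_def triv_char_def ext_norm_eq_0_iff fun_eq_iff)

lemma lift_char_triv_iff:
  fixes \<eta> :: "'k::finite_field \<Rightarrow> qbar"
  assumes "\<eta> \<in> mult_chars UNIV" "r \<ge> 1"
  shows "lift_char r \<eta> = triv_char (ext r) \<longleftrightarrow> \<eta> = triv_char UNIV"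
proof
  interpret finite_subfield "UNIV :: 'k set" by (rule finite_subfield_UNIV)
  assume *: "lift_char r \<eta> = triv_char (ext r)"
  show "\<eta> = triv_char UNIV"
  proof (rule mult_chars_eqI[OF assms(1) triv_in])
    fix v :: 'k assume "v \<in> UNIV - {0}"
    then obtain x where "x \<in> ext r - {0}" "ext_norm r x = v" using ext_norm_surj[of v r] assms(2)
        by auto
    then show "\<eta> v = triv_char UNIV v"
      using fun_cong[OF *, of x] \<open>v \<in> UNIV - {0}\<close> by (auto simp: lift_char_def triv_char_def)
  qed
qed (use lift_char_triv assms in auto)

lemma lift_char_pow:
  fixes \<eta> :: "'k::finite_field \<Rightarrow> qbar"
  shows "lift_char r (char_pow \<eta> k) = char_pow (lift_char r \<eta>) k"
  by (auto simp: lift_char_def char_pow_def fun_eq_iff)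

lemma ext_trace_add:
  fixes x y :: "'k::finite_field alg_closure"
  assumes "x \<in> ext r" "y \<in> ext r"
  shows "ext_trace r (x + y) = ext_trace r x + ext_trace r y"
proof -
  have tr: "(\<Sum>i<r. x ^ (CARD('k) ^ i)) \<in> range to_ac" if "x \<in> ext r" for x :: "'k alg_closure"
  proof -
    have "(\<Sum>i<r. x ^ (CARD('k) ^ i)) ^ CARD('k) + x = x + (\<Sum>i<r. x ^ (CARD('k) ^ Suc i))"
      unfolding frobenius_sum by (simp add: mult.commute flip: power_mult)
    also have "\<dots> = (\<Sum>i<Suc r. x ^ (CARD('k) ^ i))" by (subst sum.lessThan_Suc_shift) simp
    also have "\<dots> = (\<Sum>i<r. x ^ (CARD('k) ^ i)) + x" using that by (simp add: ext_def)
    finally show ?thesis unfolding ext_1[symmetric] by (simp add: ext_def)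
  qed
  show ?thesis unfolding ext_trace_def frobenius_power_add sum.distrib
    by (rule of_ac_add) (use tr assms in auto)
qed

text \<open>
  Were \<open>\<psi>\<close> trivial on all traces, the Gauss sum of the lift of \<open>\<eta>\<close> would be a full sum of a nontrivial
  multiplicative character, hence zero; but by Hasse-Davenport it is a power of a nonzero Gauss sum.
\<close>

lemma nontriv_add_char_trace:
  fixes \<psi> :: "'k::finite_field \<Rightarrow> qbar"
  assumes \<psi>: "nontriv_add_char UNIV \<psi>" and \<eta>: "\<eta> \<in> mult_chars (UNIV :: 'k set)" "\<eta> \<noteq> triv_char UNIV"
      and r: "r \<ge> 1"
  shows "nontriv_add_char (ext r) (\<lambda>x. \<psi> (ext_trace r x))"
proof -
  interpret U: finite_subfield_add_char "UNIV :: 'k set" \<psi>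
    using finite_subfield_UNIV \<psi>
        by (simp add: finite_subfield_add_char_def finite_subfield_add_char_axioms_def)
  interpret E: finite_subfield "ext r :: 'k alg_closure set" by (rule finite_subfield_ext[OF r])
  have "\<exists>x\<in>ext r. \<psi> (ext_trace r x) \<noteq> 1"
  proof (rule ccontr)
    assume "\<not> ?thesis"
    then have "gauss (ext r) (\<lambda>x. \<psi> (ext_trace r x)) (lift_char r \<eta>) =
        - (\<Sum>x\<in>ext r - {0}. lift_char r \<eta> x)"
      unfolding gauss_def by (intro arg_cong[where f=uminus] sum.cong) auto
    also have "\<dots> = 0"
      using E.sum_mult_char[OF lift_char_in[OF \<eta>(1) r]] lift_char_triv_iff[OF \<eta>(1) r] \<eta>(2) by simp
    finally show False
      using hasse_davenport[OF \<psi> \<eta>(1) r] U.gauss_nonzero(1)[OF \<eta>(1)] by simp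
  qed
  then show ?thesis using \<psi> by (auto simp: nontriv_add_char_def ext_trace_add)
qed

text \<open>
  The Jacobi sum is a quotient of Gauss sums formed with any nontrivial additive character. Over
  \<open>ext r\<close> the character \<open>\<psi>\<close> composed with the trace is chosen, so that Hasse-Davenport applies to numerator
  and denominator; the extra factor \<open>card (ext r) = q\<^sup>r\<close> in \<open>gauss0\<close> is compatible because a lifted character
  is trivial only if the character is.
\<close>

lemma jacobi_lift:
  fixes \<eta> :: "nat \<Rightarrow> 'k::finite_field \<Rightarrow> qbar"
  assumes \<psi>: "nontriv_add_char UNIV (\<psi> :: 'k \<Rightarrow> qbar)" and r: "r \<ge> 1"
    and \<eta>: "\<And>i. i < k \<Longrightarrow> \<eta> i \<in> mult_chars UNIV" and nt: "\<exists>i<k. \<eta> i \<noteq> triv_char UNIV"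
  shows "jacobi (ext r) k (\<lambda>i. lift_char r (\<eta> i)) = jacobi UNIV k \<eta> ^ r"
proof -
  obtain j where j: "j < k" "\<eta> j \<noteq> triv_char UNIV" using nt by auto
  let ?\<psi>r = "\<lambda>x. \<psi> (ext_trace r x)"
  interpret U: finite_subfield_add_char "UNIV :: 'k set" \<psi>
    using finite_subfield_UNIV \<psi>
        by (simp add: finite_subfield_add_char_def finite_subfield_add_char_axioms_def)
  interpret E: finite_subfield_add_char "ext r :: 'k alg_closure set" ?\<psi>r
    using finite_subfield_ext[OF r] nontriv_add_char_trace[OF \<psi> \<eta>[OF j(1)] j(2) r]
    by (simp add: finite_subfield_add_char_def finite_subfield_add_char_axioms_def)
  define P where "P = (\<lambda>x. \<Prod>i<k. \<eta> i x)"
  have P: "P \<in> mult_chars UNIV" unfolding P_def using j \<eta> by (intro U.char_prod_in) auto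
  have lift_P: "(\<lambda>x. \<Prod>i<k. lift_char r (\<eta> i) x) = lift_char r P"
    using j(1) by (auto simp: lift_char_def P_def fun_eq_iff intro!: prod_zero)
  have "jacobi (ext r) k (\<lambda>i. lift_char r (\<eta> i)) =
     (\<Prod>i<k. gauss (ext r) ?\<psi>r (lift_char r (\<eta> i))) / gauss0 (ext r) ?\<psi>r (lift_char r P)"
    unfolding lift_P[symmetric]
  proof (rule E.jacobi_eq_gauss)
    show "\<exists>i<k. lift_char r (\<eta> i) \<noteq> triv_char (ext r)"
      using j lift_char_triv_iff[OF \<eta>[OF j(1)] r] by auto
  qed (use lift_char_in \<eta> r in auto)
  also have "(\<Prod>i<k. gauss (ext r) ?\<psi>r (lift_char r (\<eta> i))) = (\<Prod>i<k. gauss UNIV \<psi> (\<eta> i)) ^ r"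
    unfolding prod_power_distrib by (intro prod.cong refl hasse_davenport \<psi> r \<eta>) auto
  also have "gauss0 (ext r) ?\<psi>r (lift_char r P) = gauss0 UNIV \<psi> P ^ r"
    by (simp add: gauss0_def lift_char_triv_iff[OF P r] hasse_davenport[OF \<psi> P r] card_ext[OF r]
        power_mult_distrib)
  also have "(\<Prod>i<k. gauss UNIV \<psi> (\<eta> i)) ^ r / gauss0 UNIV \<psi> P ^ r = jacobi UNIV k \<eta> ^ r"
    using U.jacobi_eq_gauss[of k \<eta>, OF \<eta> nt] by (simp add: power_divide P_def)
  finally show ?thesis .
qed

lemma char_pow_char_pow: "char_pow (char_pow \<eta> j) k = char_pow \<eta> (j * k)"
  by (auto simp: char_pow_def fun_eq_iff power_int_mult)

lemma power_int_mod_exponent: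
  fixes z :: "'a::field"
  assumes "z powi e = 1" "z \<noteq> 0"
  shows "z powi (j mod e) = z powi j"
proof -
  have "z powi j = z powi (e * (j div e) + j mod e)" by simp
  also have "\<dots> = (z powi e) powi (j div e) * z powi (j mod e)"
    using assms(2) by (subst power_int_add) (auto simp: power_int_mult)
  finally show ?thesis using assms(1) by simp
qed

text \<open>
  If a smaller positive power of \<open>\<phi>\<close> were trivial, the powers of \<open>\<phi>\<close> would be fewer than the
  \<open>q - 1\<close> multiplicative characters.
\<close>

lemma generator_power_triv_iff:
  fixes \<phi> :: "'k::finite_field \<Rightarrow> qbar"
  assumes "generates_mult_chars UNIV \<phi>"
  shows "char_pow \<phi> k = triv_char UNIV \<longleftrightarrow> int (CARD('k) - 1) dvd k"
proof -
  interpret finite_subfield "UNIV :: 'k set" by (rule finite_subfield_UNIV)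
  define N where "N = CARD('k) - 1"
  have N: "N > 0" using CARD_finite_field_ge_2[where 'k='k] by (simp add: N_def)
  have \<phi>: "\<phi> \<in> mult_chars UNIV" using assms by (simp add: generates_mult_chars_def)
  have eval: "char_pow \<phi> j = triv_char UNIV \<longleftrightarrow> (\<forall>x. x \<noteq> 0 \<longrightarrow> \<phi> x powi j = 1)" for j
    using mult_charsD(1,4)[OF \<phi>] by (auto simp: char_pow_def triv_char_def fun_eq_iff)
  have nz: "\<phi> x \<noteq> 0" if "x \<noteq> 0" for x using mult_charsD(1)[OF \<phi>] that by auto
  have N1: "\<phi> x powi int N = 1" if "x \<noteq> 0" for x
  proof -
    have "\<phi> x ^ N = 1"
      using mult_charsD(8)[OF \<phi>, of x N] unit_power_card[of x] that mult_charsD(5)[OF \<phi>]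
          by (simp add: N_def)
    then show ?thesis by (simp only: power_int_of_nat)
  qed
  have min: "N \<le> e" if "char_pow \<phi> (int e) = triv_char UNIV" "e > 0" for e
  proof -
    have "mult_chars UNIV \<subseteq> (\<lambda>i. char_pow \<phi> (int i)) ` {..<e}"
    proof
      fix \<eta> :: "'k \<Rightarrow> qbar" assume "\<eta> \<in> mult_chars UNIV"
      then obtain j where j: "\<eta> = char_pow \<phi> j" using assms by (auto simp: generates_mult_chars_def)
      have "\<phi> x powi j = \<phi> x powi (j mod int e)" if "\<phi> x \<noteq> 0" for x
      proof -
        have "x \<noteq> 0" using that mult_charsD(4)[OF \<phi>] by auto
        then have "\<phi> x powi int e = 1" using \<open>char_pow \<phi> (int e) = triv_char UNIV\<close> eval by blast
        then show ?thesis using power_int_mod_exponent[of "\<phi> x" "int e" j] that by simp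
      qed
      then have "\<eta> = char_pow \<phi> (int (nat (j mod int e)))"
        using \<open>e > 0\<close> mult_charsD(4)[OF \<phi>] by (auto simp: j char_pow_def fun_eq_iff)
      moreover have "nat (j mod int e) \<in> {..<e}" using \<open>e > 0\<close> by (simp add: nat_less_iff)
      ultimately show "\<eta> \<in> (\<lambda>i. char_pow \<phi> (int i)) ` {..<e}" by blast
    qed
    then have "card (mult_chars (UNIV :: 'k set)) \<le> e"
      by (metis card_lessThan finite_lessThan surj_card_le)
    then show ?thesis by (simp add: card_mult_chars N_def)
  qed
  have mod: "\<phi> x powi k = \<phi> x powi (k mod int N)" if "x \<noteq> 0" for x
    using power_int_mod_exponent[OF N1[OF that] nz[OF that], of k] by simp
  show ?thesis
  proof
    assume "char_pow \<phi> k = triv_char UNIV"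
    then have "char_pow \<phi> (int (nat (k mod int N))) = triv_char UNIV"
      using N mod by (auto simp: eval)
    moreover have "nat (k mod int N) < N" using N by (simp add: nat_less_iff)
    ultimately have "nat (k mod int N) = 0" using min[of "nat (k mod int N)"] by linarith
    then have "k mod int N = 0" using N pos_mod_sign[of "int N" k] by linarith
    then show "int (CARD('k) - 1) dvd k" unfolding N_def by (rule mod_0_imp_dvd)
  next
    assume "int (CARD('k) - 1) dvd k"
    then obtain j where "k = int N * j" by (auto simp: N_def)
    then show "char_pow \<phi> k = triv_char UNIV" unfolding eval using N1 by (simp add: power_int_mult)
  qed
qed

section \<open>Exponential generating series\<close>

lemma exp_gen_cong: "(\<And>r. r \<ge> 1 \<Longrightarrow> s r = s' r) \<Longrightarrow> exp_gen s = exp_gen s'"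
  unfolding exp_gen_def by (intro arg_cong[where f="\<lambda>x. fps_exp 1 oo x"] arg_cong[where f=Abs_fps])
      (auto simp: fun_eq_iff)

text \<open>
  With \<open>u = 1 - Q X\<close> and \<open>E\<close> the exponential, \<open>E * u\<close> has derivative zero and constant term \<open>1\<close>.
\<close>

lemma exp_gen_geometric: "exp_gen (\<lambda>r. Q ^ r) = 1 / (1 - fps_const Q * fps_X)"
proof -
  define u where "u = 1 - fps_const Q * fps_X"
  define g where "g = Abs_fps (\<lambda>r. if r = 0 then 0 else Q ^ r / of_nat r)"
  have g0: "fps_nth g 0 = 0" by (simp add: g_def)
  define E where "E = fps_exp 1 oo g"
  have dg: "fps_deriv g = Abs_fps (\<lambda>r. Q ^ Suc r)"
    by (rule fps_ext) (simp add: g_def del: of_nat_Suc)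
  have dgu: "fps_deriv g * u = fps_const Q"
  proof (rule fps_ext)
    fix r
    have "fps_deriv g * u = fps_deriv g - fps_const Q * (fps_X * fps_deriv g)"
      by (simp add: u_def algebra_simps)
    then show "fps_nth (fps_deriv g * u) r = fps_nth (fps_const Q) r"
      by (cases r) (simp_all add: dg)
  qed
  have dE: "fps_deriv E = E * fps_deriv g"
    unfolding E_def by (subst fps_compose_deriv[OF g0]) simp
  have du: "fps_deriv u = - fps_const Q" by (simp add: u_def)
  have "fps_deriv (E * u) = E * (fps_deriv g * u) - E * fps_const Q"
    unfolding fps_deriv_mult dE du by (simp add: algebra_simps del: fps_const_neg)
  then have "fps_deriv (E * u) = 0" by (simp add: dgu)
  then have "E * u = fps_const (fps_nth (E * u) 0)" by (simp only: fps_deriv_eq_0_iff)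
  also have "fps_nth (E * u) 0 = 1" by (simp add: E_def u_def)
  finally have Eu: "E * u = 1" by simp
  then have "u \<noteq> 0" by auto
  have "1 / u = E * u / u" by (simp only: Eu)
  also have "\<dots> = E" using \<open>u \<noteq> 0\<close> by simp
  finally show ?thesis by (simp add: exp_gen_def E_def g_def u_def)
qed

section \<open>Counting twisted points\<close>

lemma frob_power:
  fixes x :: "nat \<Rightarrow> 'k::finite_field alg_closure"
  assumes "x \<in> extensional {..<n}"
  shows "(frob n ^^ r) (x, y) = ((\<lambda>i\<in>{..<n}. x i ^ (CARD('k) ^ r)), y ^ (CARD('k) ^ r))"
proof (induction r)
  case 0
  then show ?case using assms by (simp add: extensional_restrict)
next
  case (Suc r)
  have "(z ^ CARD('k) ^ r) ^ CARD('k) = z ^ (CARD('k) * CARD('k) ^ r)" for z :: "'k alg_closure"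
    by (simp add: mult.commute flip: power_mult)
  then show ?case using Suc by (auto simp: frob_def fun_eq_iff restrict_def)
qed

definition hypersurface_poly ::
    "nat \<Rightarrow> nat \<Rightarrow> nat \<Rightarrow> (nat \<Rightarrow> nat) \<Rightarrow> (nat \<Rightarrow> 'k::field) \<Rightarrow> (nat \<Rightarrow> 'k alg_closure) \<Rightarrow> 'k alg_closure" where
  "hypersurface_poly n a b c lam x = (\<Prod>i<n. x i ^ c i) * (1 - (\<Sum>i<n. x i)) ^ a *
     ((\<Prod>i<n. x i) - (\<Sum>i<n. to_ac (lam i) * (\<Prod>j\<in>{..<n} - {i}. x j))) ^ b"

lemma hypersurface_poly_in_ext:
  fixes lam :: "nat \<Rightarrow> 'k::finite_field"
  assumes "x \<in> {..<n} \<rightarrow>\<^sub>E ext r" "r \<ge> 1"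
  shows "hypersurface_poly n a b c lam x \<in> ext r"
proof -
  interpret finite_subfield "ext r :: 'k alg_closure set" by (rule finite_subfield_ext[OF assms(2)])
  have "x i \<in> ext r" if "i < n" for i using assms(1) that by auto
  then show ?thesis unfolding hypersurface_poly_def
    by (intro mult_in power_in diff_in prod_in sum_in one_in ext_subfield(7)) auto
qed

text \<open>
  The points over a point \<open>x\<close> where the right-hand side of the equation takes the value \<open>u\<close> and on which the
  \<open>r\<close>-th power of Frobenius acts like \<open>\<xi>\<close>.
\<close>

definition twisted_fibre :: "nat \<Rightarrow> nat \<Rightarrow> 'k::finite_field alg_closure \<Rightarrow> 'k \<Rightarrow> 'k alg_closure set" where
  "twisted_fibre d r u \<xi> = {y. y ^ d = u \<and> y ^ (CARD('k) ^ r) = to_ac \<xi> * y}"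

lemma finite_nth_roots:
  fixes u :: "'a::field"
  assumes "d > 0"
  shows "finite {y. y ^ d = u}"
proof (cases "u = 0")
  case True
  then have "{y. y ^ d = u} \<subseteq> {0}" by auto
  then show ?thesis using finite_subset by blast
next
  case False
  show ?thesis
  proof (cases "{y. y ^ d = u} = {}")
    case False
    then obtain z where z: "z ^ d = u" by auto
    then have "z \<noteq> 0" using \<open>u \<noteq> 0\<close> assms by (auto simp: power_0_left)
    have "{y. y ^ d = u} \<subseteq> (\<lambda>w. w * z) ` {w. w ^ d = 1}"
    proof
      fix y assume "y \<in> {y. y ^ d = u}"
      then have "(y / z) ^ d = 1" using z \<open>u \<noteq> 0\<close> by (simp add: power_divide)
      then show "y \<in> (\<lambda>w. w * z) ` {w. w ^ d = 1}"
        using \<open>z \<noteq> 0\<close> by (intro image_eqI[of _ _ "y / z"]) auto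
    qed
    then show ?thesis using card_roots_of_unity_le(1)[OF assms, where 'a='a]
        by (meson finite_imageI finite_subset)
  qed simp
qed

lemma finite_twisted_fibre: "d > 0 \<Longrightarrow> finite (twisted_fibre d r u \<xi>)"
  unfolding twisted_fibre_def by (rule finite_subset[OF _ finite_nth_roots[of d u]]) auto

lemma N_points_S_C:
  fixes lam :: "nat \<Rightarrow> 'k::finite_field"
  assumes "r \<ge> 1" "d > 0"
  shows "N_points (S_C n d a b c lam) (frob n) G scale_y \<theta> r =
    (\<Sum>x\<in>{..<n} \<rightarrow>\<^sub>E ext r. 1 / of_nat (card G) *
        (\<Sum>\<xi>\<in>G. \<theta> \<xi> * of_nat (card (twisted_fibre d r (hypersurface_poly n a b c lam x) \<xi>))))"
proof -
  let ?P = "{..<n} \<rightarrow>\<^sub>E (ext r :: 'k alg_closure set)"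
  have finP: "finite ?P" by (intro finite_PiE finite_ext assms) auto
  have fixed_eq: "{p \<in> S_C n d a b c lam. (frob n ^^ r) p = scale_y \<xi> p} =
      (SIGMA x:?P. twisted_fibre d r (hypersurface_poly n a b c lam x) \<xi>)" for \<xi>
  proof (intro equalityI subsetI)
    fix p assume "p \<in> {p \<in> S_C n d a b c lam. (frob n ^^ r) p = scale_y \<xi> p}"
    then obtain x y where p: "p = (x, y)" "(x, y) \<in> S_C n d a b c lam"
        "(frob n ^^ r) (x, y) = scale_y \<xi> (x, y)"
      by (cases p) auto
    then have x: "x \<in> extensional {..<n}" by (auto simp: S_C_def PiE_def)
    have eq: "(\<lambda>i\<in>{..<n}. x i ^ (CARD('k) ^ r)) = x" "y ^ (CARD('k) ^ r) = to_ac \<xi> * y"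
      using p(3) unfolding frob_power[OF x] by (auto simp: scale_y_def)
    have "x i \<in> ext r" if "i < n" for i
      using fun_cong[OF eq(1), of i] that by (simp add: ext_def)
    then have "x \<in> ?P" using x by (auto simp: PiE_def)
    then show "p \<in> (SIGMA x:?P. twisted_fibre d r (hypersurface_poly n a b c lam x) \<xi>)"
      using p(2) eq(2) by (auto simp: p(1) S_C_def hypersurface_poly_def twisted_fibre_def)
  next
    fix p assume "p \<in> (SIGMA x:?P. twisted_fibre d r (hypersurface_poly n a b c lam x) \<xi>)"
    then obtain x y where p: "p = (x, y)" "x \<in> ?P"
        "y \<in> twisted_fibre d r (hypersurface_poly n a b c lam x) \<xi>" by auto
    then have x: "x \<in> extensional {..<n}" by (auto simp: PiE_def)
    have "(\<lambda>i\<in>{..<n}. x i ^ (CARD('k) ^ r)) = x"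
    proof
      show "(\<lambda>i\<in>{..<n}. x i ^ (CARD('k) ^ r)) i = x i" for i
        using p(2) x by (cases "i < n") (auto simp: ext_def extensional_def)
    qed
    then have "(frob n ^^ r) p = scale_y \<xi> p"
      unfolding p(1) frob_power[OF x] using p(3) by (simp add: scale_y_def twisted_fibre_def)
    moreover have "p \<in> S_C n d a b c lam"
      using p by (auto simp: S_C_def hypersurface_poly_def twisted_fibre_def PiE_def)
    ultimately show "p \<in> {p \<in> S_C n d a b c lam. (frob n ^^ r) p = scale_y \<xi> p}" by simp
  qed
  have "card {p \<in> S_C n d a b c lam. (frob n ^^ r) p = scale_y \<xi> p} =
      (\<Sum>x\<in>?P. card (twisted_fibre d r (hypersurface_poly n a b c lam x) \<xi>))" for \<xi>
    unfolding fixed_eq by (rule card_SigmaI[OF finP]) (use finite_twisted_fibre[OF assms(2)] in auto)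
  then have "N_points (S_C n d a b c lam) (frob n) G scale_y \<theta> r =
     1 / of_nat (card G) * (\<Sum>\<xi>\<in>G. \<Sum>x\<in>?P. \<theta> \<xi> *
         of_nat (card (twisted_fibre d r (hypersurface_poly n a b c lam x) \<xi>)))"
    unfolding N_points_def by (simp add: sum_distrib_left)
  then show ?thesis by (subst (asm) sum.swap) (simp only: sum_distrib_left)
qed

lemma roots_of_unity_power_card:
  fixes \<zeta> :: "'k::finite_field alg_closure"
  assumes "d dvd CARD('k) - 1" "\<zeta> ^ d = 1"
  shows "\<zeta> ^ (CARD('k) ^ r - 1) = 1"
proof -
  obtain e where "CARD('k) - 1 = d * e" using assms(1) by auto
  then have "CARD('k) ^ r - 1 = d * (e * norm_exponent (CARD('k)) r)"
    using norm_exponent_mult[of r, where 'k='k] by (simp add: mult_ac)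
  then show ?thesis using assms(2) by (simp add: power_mult)
qed

text \<open>
  Frobenius multiplies \<open>y\<close> by its power with exponent \<open>q\<^sup>r - 1 = d M ((q - 1)/d)\<close>, where \<open>M\<close> is the norm
  exponent. For a \<open>d\<close>-th root \<open>y\<close> of \<open>u\<close> it equals the norm of \<open>u\<close> to the power \<open>(q - 1)/d\<close>, whatever the
  choice of \<open>y\<close>. The \<open>d\<close>-th roots of \<open>u\<close> form a coset of \<open>\<mu>\<^sub>d\<close>, which is contained in \<open>'k\<close> as \<open>d\<close> divides \<open>q - 1\<close>.
\<close>

lemma card_twisted_fibre:
  fixes u :: "'k::finite_field alg_closure"
  assumes d: "d dvd CARD('k) - 1" "d > 0" and u: "u \<in> ext r" "u \<noteq> 0" and r: "r \<ge> 1"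
      and \<xi>: "\<xi> \<in> roots_of_unity d"
  shows "card (twisted_fibre d r u \<xi>) =
      (if \<xi> = ext_norm r u ^ ((CARD('k) - 1) div d) then card (roots_of_unity d :: 'k set) else 0)"
proof -
  let ?q = "CARD('k)"
  obtain z where z: "z ^ d = u" using nth_root_exists[OF d(2)] by blast
  have znz: "z \<noteq> 0" using z u d by (auto simp: power_0_left)
  have roots: "{y. y ^ d = u} = (\<lambda>\<zeta>. to_ac \<zeta> * z) ` roots_of_unity d"
  proof (intro equalityI subsetI)
    fix y assume "y \<in> {y. y ^ d = u}"
    then have 1: "(y / z) ^ d = 1" using z u by (simp add: power_divide)
    then have "y / z \<in> ext 1"
      using roots_of_unity_power_card[OF d(1), of "y / z" 1] by (intro power_card_minus_1_imp_ext) simp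
    then obtain \<zeta> :: 'k where \<zeta>: "y / z = to_ac \<zeta>" unfolding ext_1 by auto
    then have "\<zeta> \<in> roots_of_unity d" using 1 by (simp add: roots_of_unity_def flip: to_ac_power)
    then show "y \<in> (\<lambda>\<zeta>. to_ac \<zeta> * z) ` roots_of_unity d" using \<zeta> znz
        by (intro image_eqI[of _ _ \<zeta>]) (auto simp: field_simps)
  next
    fix y assume "y \<in> (\<lambda>\<zeta>. to_ac \<zeta> * z) ` roots_of_unity d"
    then show "y \<in> {y. y ^ d = u}" using z
        by (auto simp: roots_of_unity_def power_mult_distrib simp flip: to_ac_power)
  qed
  define \<xi>0 where "\<xi>0 = ext_norm r u ^ ((?q - 1) div d)"
  have "to_ac \<xi>0 = (u ^ norm_exponent ?q r) ^ ((?q - 1) div d)"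
    unfolding \<xi>0_def to_ac_power to_ac_ext_norm_power[OF u(1)] ..
  also have "\<dots> = z ^ (d * norm_exponent ?q r * ((?q - 1) div d))"
    unfolding z[symmetric] by (simp only: power_mult)
  also have "d * norm_exponent ?q r * ((?q - 1) div d) = ?q ^ r - 1"
    using d norm_exponent_mult[of r, where 'k='k] by (metis dvd_mult_div_cancel mult.assoc mult.commute)
  finally have \<xi>0: "to_ac \<xi>0 = z ^ (?q ^ r - 1)" .
  have yq: "y ^ ?q ^ r = to_ac \<xi>0 * y" if "y \<in> {y. y ^ d = u}" for y
  proof -
    obtain \<zeta> where \<zeta>: "y = to_ac \<zeta> * z" "\<zeta> ^ d = 1" using \<open>y \<in> {y. y ^ d = u}\<close> unfolding roots
        by (auto simp: roots_of_unity_def)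
    have "to_ac \<zeta> ^ d = 1" using \<zeta>(2) by (simp flip: to_ac_power)
    then have "y ^ (?q ^ r - 1) = to_ac \<xi>0"
      using roots_of_unity_power_card[OF d(1), of "to_ac \<zeta>" r] by (simp add: \<zeta>(1) power_mult_distrib \<xi>0)
    moreover have "?q ^ r = Suc (?q ^ r - 1)" using CARD_pos[where 'k='k] by simp
    then have "y ^ ?q ^ r = y ^ (?q ^ r - 1) * y" by (metis power_Suc2)
    ultimately show ?thesis by simp
  qed
  show ?thesis
  proof (cases "\<xi> = \<xi>0")
    case True
    then have "twisted_fibre d r u \<xi> = (\<lambda>\<zeta>. to_ac \<zeta> * z) ` roots_of_unity d"
      unfolding roots[symmetric] twisted_fibre_def using yq by auto
    moreover have "inj_on (\<lambda>\<zeta>. to_ac \<zeta> * z) (roots_of_unity d)" using znz by (auto simp: inj_on_def)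
    ultimately show ?thesis using True by (simp add: card_image \<xi>0_def)
  next
    case False
    have "twisted_fibre d r u \<xi> = {}"
    proof (rule equals0I)
      fix y assume y: "y \<in> twisted_fibre d r u \<xi>"
      then have "y \<noteq> 0" using u d by (auto simp: twisted_fibre_def power_0_left)
      moreover have "to_ac \<xi> * y = to_ac \<xi>0 * y" using y yq[of y] by (simp add: twisted_fibre_def)
      ultimately show False using False by simp
    qed
    then show ?thesis using False by (simp add: \<xi>0_def)
  qed
qed

lemma char_of_order_pow_triv_iff:
  fixes \<phi> :: "'k::finite_field \<Rightarrow> qbar"
  assumes "generates_mult_chars UNIV \<phi>" "d dvd CARD('k) - 1"
  shows "char_pow (char_of_order \<phi> d) k = triv_char UNIV \<longleftrightarrow> int d dvd k"
proof -
  obtain e where e: "CARD('k) - 1 = d * e" using assms(2) by auto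
  have nz: "d * e \<noteq> 0" using CARD_finite_field_ge_2[where 'k='k] unfolding e[symmetric] by linarith
  have "char_pow (char_of_order \<phi> d) k = char_pow \<phi> (int e * k)"
    using nz unfolding char_of_order_def char_pow_char_pow e by simp
  moreover have "int (CARD('k) - 1) = int e * int d" by (simp only: e of_nat_mult mult.commute)
  ultimately show ?thesis
    using nz by (simp only: generator_power_triv_iff[OF assms(1)]) simp
qed

text \<open>
  For \<open>u \<noteq> 0\<close> only one \<open>\<xi>\<close> contributes, with \<open>card G\<close> points. For \<open>u = 0\<close> every \<open>\<xi>\<close> has the single point
  \<open>y = 0\<close>, and the average of \<open>\<phi>\<^sup>m\<close> over \<open>\<mu>\<^sub>d\<close> is \<open>1\<close> or \<open>0\<close> according to whether \<open>\<phi>\<^sup>m\<close> is trivial there.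
\<close>

lemma twisted_count_over_value:
  fixes \<phi> :: "'k::finite_field \<Rightarrow> qbar" and u :: "'k alg_closure"
  assumes \<phi>: "generates_mult_chars UNIV \<phi>" and d: "d dvd CARD('k) - 1" "d > 0" and u: "u \<in> ext r"
      and r: "r \<ge> 1"
  defines "G \<equiv> roots_of_unity d :: 'k set"
  shows "1 / of_nat (card G) *
      (\<Sum>\<xi>\<in>G. char_pow (restrict \<phi> G) m \<xi> * of_nat (card (twisted_fibre d r u \<xi>))) =
    (if int d dvd m then 1 else char_pow (lift_char r (char_of_order \<phi> d)) m u)"
proof -
  interpret finite_subfield "UNIV :: 'k set" by (rule finite_subfield_UNIV)
  have \<phi>_in: "\<phi> \<in> mult_chars UNIV" using \<phi> by (simp add: generates_mult_chars_def)
  let ?e = "(CARD('k) - 1) div d"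
  have de: "d * ?e = CARD('k) - 1" using d(1) by simp
  have G1: "1 \<in> G" by (simp add: G_def roots_of_unity_def)
  then have cardG: "of_nat (card G) \<noteq> (0 :: qbar)" by (auto simp: G_def)
  have Gnz: "\<xi> \<noteq> 0" if "\<xi> \<in> G" for \<xi> using that d(2)
      by (auto simp: G_def roots_of_unity_def power_0_left)
  have val: "char_pow (restrict \<phi> G) m \<xi> = \<phi> \<xi> powi m" if "\<xi> \<in> G" for \<xi>
    using that Gnz[OF that] mult_charsD(1)[OF \<phi>_in] by (simp add: char_pow_def)
  have d_val: "\<phi> \<xi> powi m = 1" if "int d dvd m" "\<xi> \<in> G" for \<xi>
  proof -
    obtain k where k: "m = int d * k" using \<open>int d dvd m\<close> by (rule dvdE)
    have "\<phi> \<xi> ^ d = \<phi> (\<xi> ^ d)" using Gnz[OF that(2)] by (simp add: mult_charsD[OF \<phi>_in])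
    then have "\<phi> \<xi> ^ d = 1" using that(2)
        by (simp add: G_def roots_of_unity_def mult_charsD(5)[OF \<phi>_in])
    then show ?thesis by (simp add: k power_int_mult)
  qed
  show ?thesis
  proof (cases "u = 0")
    case True
    have "twisted_fibre d r u \<xi> = {0}" for \<xi>
      using d(2) CARD_pos[where 'k='k] by (auto simp: twisted_fibre_def True power_0_left)
    then have lhs: "(\<Sum>\<xi>\<in>G. char_pow (restrict \<phi> G) m \<xi> * of_nat (card (twisted_fibre d r u \<xi>))) =
        (\<Sum>\<xi>\<in>G. \<phi> \<xi> powi m)"
      by (simp add: val)
    show ?thesis
    proof (cases "int d dvd m")
      case True
      then show ?thesis unfolding lhs using d_val cardG by simp
    next
      case False
      then have "char_pow (char_of_order \<phi> d) m \<noteq> triv_char UNIV"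
        using char_of_order_pow_triv_iff[OF \<phi> d(1)] by simp
      then obtain x where x: "x \<noteq> 0" "char_pow (char_of_order \<phi> d) m x \<noteq> 1"
        using mult_chars_eqI[OF char_pow_in[of "char_of_order \<phi> d" m] triv_in] char_pow_in[OF \<phi>_in]
        by (auto simp: char_of_order_def triv_char_def)
      \<comment> \<open>\<open>\<phi>\<^sup>m\<close> is nontrivial on \<open>\<mu>\<^sub>d\<close>: raising to the power \<open>(q - 1)/d\<close> maps the units into \<open>\<mu>\<^sub>d\<close>.\<close>
      define \<zeta> where "\<zeta> = x ^ ?e"
      have \<zeta>: "\<zeta> \<in> G" using x(1) unit_power_card[of x] de
        by (simp add: G_def roots_of_unity_def \<zeta>_def mult.commute flip: power_mult)
      have \<zeta>m: "\<phi> \<zeta> powi m \<noteq> 1"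
        using x mult_charsD(1)[OF \<phi>_in, of x]
        by (simp add: \<zeta>_def mult_charsD(8)[OF \<phi>_in] char_of_order_def char_pow_def split: if_splits)
      have "(\<Sum>\<xi>\<in>G. \<phi> \<xi> powi m) = (\<Sum>\<xi>\<in>G. \<phi> (\<zeta> * \<xi>) powi m)"
        by (rule sum.reindex_bij_witness[of _ "\<lambda>\<xi>. \<zeta> * \<xi>" "\<lambda>\<xi>. \<xi> / \<zeta>"])
           (use \<zeta> Gnz[OF \<zeta>] in \<open>auto simp: G_def roots_of_unity_def power_mult_distrib power_divide\<close>)
      also have "\<dots> = \<phi> \<zeta> powi m * (\<Sum>\<xi>\<in>G. \<phi> \<xi> powi m)"
        by (simp add: sum_distrib_left mult_charsD[OF \<phi>_in] power_int_mult_distrib)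
      finally have "(\<Sum>\<xi>\<in>G. \<phi> \<xi> powi m) = 0" using \<zeta>m by (metis mult_cancel_right1)
      moreover have "lift_char r (char_of_order \<phi> d) 0 = 0"
        using r by (simp add: lift_char_def ext_norm_0 char_of_order_def char_pow_def
            mult_charsD[OF \<phi>_in])
      ultimately show ?thesis unfolding lhs using False \<open>u = 0\<close> by (simp add: char_pow_def)
    qed
  next
    case False
    let ?x = "ext_norm r u ^ ?e"
    have nu: "ext_norm r u \<noteq> 0" using ext_norm_eq_0_iff[OF u r] False by simp
    then have xG: "?x \<in> G" using unit_power_card[of "ext_norm r u"] de
      by (simp add: G_def roots_of_unity_def mult.commute flip: power_mult)
    have "(\<Sum>\<xi>\<in>G. char_pow (restrict \<phi> G) m \<xi> * of_nat (card (twisted_fibre d r u \<xi>))) =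
       (\<Sum>\<xi>\<in>G. if \<xi> = ?x then \<phi> \<xi> powi m * of_nat (card G) else 0)"
      by (intro sum.cong refl)
         (simp only: val card_twisted_fibre[OF d u False r, folded G_def] of_nat_0 mult_zero_right
             split: if_split, simp)
    also have "\<dots> = \<phi> ?x powi m * of_nat (card G)" using xG by (simp add: G_def)
    finally have lhs: "1 / of_nat (card G) *
        (\<Sum>\<xi>\<in>G. char_pow (restrict \<phi> G) m \<xi> * of_nat (card (twisted_fibre d r u \<xi>))) = \<phi> ?x powi m"
      using cardG by simp
    have "char_pow (lift_char r (char_of_order \<phi> d)) m u = \<phi> ?x powi m"
      using nu u mult_charsD(1)[OF \<phi>_in, of "ext_norm r u"]
      by (simp add: char_pow_def lift_char_def char_of_order_def mult_charsD(8)[OF \<phi>_in])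
    then show ?thesis unfolding lhs using d_val[OF _ xG] by simp
  qed
qed

lemma char_pow_mult_nat:
  assumes "k > 0"
  shows "char_pow \<eta> (m * int k) x = char_pow \<eta> m x ^ k"
  using assms by (simp add: char_pow_def power_int_mult power_0_left)

text \<open>
  Points with some \<open>x\<^sub>i = 0\<close> contribute nothing because \<open>c\<^sub>i > 0\<close>. For the others
  \<open>\<Prod>x\<^sub>i - \<Sum>\<lambda>\<^sub>i \<Prod>\<^sub>j\<^sub>\<noteq>\<^sub>i x\<^sub>j = (\<Prod>x\<^sub>i) (1 - \<Sum>\<lambda>\<^sub>i/x\<^sub>i)\<close>, which turns the exponents \<open>c\<^sub>i\<close> into \<open>b + c\<^sub>i\<close>.
\<close>

lemma sum_char_hypersurface:
  fixes \<Phi> :: "'k::finite_field alg_closure \<Rightarrow> qbar" and lam :: "nat \<Rightarrow> 'k"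
  assumes r: "r \<ge> 1" and \<Phi>: "\<Phi> \<in> mult_chars (ext r)"
    and "n > 0" "a > 0" "b > 0" and c: "\<And>i. i < n \<Longrightarrow> c i > 0" and lam: "\<And>i. i < n \<Longrightarrow> lam i \<noteq> 0"
  shows "(\<Sum>x\<in>{..<n} \<rightarrow>\<^sub>E ext r. char_pow \<Phi> m (hypersurface_poly n a b c lam x)) =
    (\<Sum>x\<in>{..<n} \<rightarrow>\<^sub>E (ext r - {0}). (\<Prod>i<n. char_pow \<Phi> (m * int (b + c i)) (x i)) *
       char_pow \<Phi> (m * int a) (1 - (\<Sum>i<n. x i)) *
           char_pow \<Phi> (m * int b) (1 - (\<Sum>i<n. to_ac (lam i) / x i)))"
proof -
  interpret finite_subfield "ext r :: 'k alg_closure set" by (rule finite_subfield_ext[OF r])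
  define \<eta> where "\<eta> = char_pow \<Phi> m"
  have \<eta>: "\<eta> \<in> mult_chars (ext r)" unfolding \<eta>_def by (rule char_pow_in[OF \<Phi>])
  have pow: "char_pow \<Phi> (m * int k) x = \<eta> x ^ k" if "k > 0" for k x
    unfolding \<eta>_def by (rule char_pow_mult_nat[OF that])
  have pow': "\<eta> (z ^ k) = \<eta> z ^ k" if "k > 0" "z \<in> ext r" for k z
    using mult_charsD(8)[OF \<eta> that(2), of k] that(1) by simp
  have "(\<Sum>x\<in>{..<n} \<rightarrow>\<^sub>E ext r. \<eta> (hypersurface_poly n a b c lam x)) =
      (\<Sum>x\<in>{..<n} \<rightarrow>\<^sub>E (ext r - {0}). \<eta> (hypersurface_poly n a b c lam x))"
  proof (rule sum.mono_neutral_right)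
    show "finite ({..<n} \<rightarrow>\<^sub>E (ext r :: 'k alg_closure set))" by (intro finite_PiE finite_ext r) auto
    show "{..<n} \<rightarrow>\<^sub>E (ext r - {0}) \<subseteq> {..<n} \<rightarrow>\<^sub>E (ext r :: 'k alg_closure set)" by (intro PiE_mono) auto
    show "\<forall>x\<in>({..<n} \<rightarrow>\<^sub>E ext r) - ({..<n} \<rightarrow>\<^sub>E (ext r - {0})). \<eta> (hypersurface_poly n a b c lam x) = 0"
    proof
      fix x :: "nat \<Rightarrow> 'k alg_closure" assume "x \<in> ({..<n} \<rightarrow>\<^sub>E ext r) - ({..<n} \<rightarrow>\<^sub>E (ext r - {0}))"
      then obtain i where "i < n" "x i = 0" by (auto simp: PiE_def)
      then have "(\<Prod>i<n. x i ^ c i) = 0" using c[of i] by (intro prod_zero) (auto intro!: bexI[of _ i])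
      then show "\<eta> (hypersurface_poly n a b c lam x) = 0"
          by (simp add: hypersurface_poly_def mult_charsD[OF \<eta>])
    qed
  qed
  also have "\<dots> = (\<Sum>x\<in>{..<n} \<rightarrow>\<^sub>E (ext r - {0}). (\<Prod>i<n. char_pow \<Phi> (m * int (b + c i)) (x i)) *
       char_pow \<Phi> (m * int a) (1 - (\<Sum>i<n. x i)) *
           char_pow \<Phi> (m * int b) (1 - (\<Sum>i<n. to_ac (lam i) / x i)))"
  proof (intro sum.cong refl)
    fix x :: "nat \<Rightarrow> 'k alg_closure" assume x: "x \<in> {..<n} \<rightarrow>\<^sub>E (ext r - {0})"
    have xi: "x i \<in> ext r" "x i \<noteq> 0" if "i < n" for i using x that by auto
    have "to_ac (lam i) * (\<Prod>j\<in>{..<n} - {i}. x j) = (\<Prod>i<n. x i) * (to_ac (lam i) / x i)" if "i < n" for i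
      using that xi(2)[OF that] by (subst prod.remove[of "{..<n}" i]) auto
    then have fac: "(\<Prod>i<n. x i) - (\<Sum>i<n. to_ac (lam i) * (\<Prod>j\<in>{..<n} - {i}. x j)) =
        (\<Prod>i<n. x i) * (1 - (\<Sum>i<n. to_ac (lam i) / x i))"
      by (simp add: sum_distrib_left right_diff_distrib)
    have in1: "1 - (\<Sum>i<n. x i) \<in> ext r" "(\<Prod>i<n. x i) \<in> ext r" "1 - (\<Sum>i<n. to_ac (lam i) / x i) \<in> ext r"
      using xi by (auto intro!: diff_in one_in sum_in prod_in divide_in ext_subfield(7))
    have in2: "(\<Prod>i<n. x i ^ c i) \<in> ext r" using xi by (intro prod_in power_in) auto
    have "\<eta> (hypersurface_poly n a b c lam x) = \<eta> (\<Prod>i<n. x i ^ c i) * \<eta> (1 - (\<Sum>i<n. x i)) ^ a *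
       (\<eta> (\<Prod>i<n. x i) ^ b * \<eta> (1 - (\<Sum>i<n. to_ac (lam i) / x i)) ^ b)"
      unfolding hypersurface_poly_def fac power_mult_distrib
      using in1 in2 \<open>a > 0\<close> \<open>b > 0\<close> by (simp add: mult_charsD(2)[OF \<eta>] mult_in power_in pow')
    also have "\<eta> (\<Prod>i<n. x i ^ c i) = (\<Prod>i<n. \<eta> (x i) ^ c i)"
      using xi c by (subst mult_char_prod[OF \<eta>]) (auto simp: power_in pow' intro!: prod.cong)
    also have "\<eta> (\<Prod>i<n. x i) = (\<Prod>i<n. \<eta> (x i))"
      using xi by (intro mult_char_prod[OF \<eta>]) auto
    also have "(\<Prod>i<n. \<eta> (x i) ^ c i) * \<eta> (1 - (\<Sum>i<n. x i)) ^ a *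
       ((\<Prod>i<n. \<eta> (x i)) ^ b * \<eta> (1 - (\<Sum>i<n. to_ac (lam i) / x i)) ^ b) =
       (\<Prod>i<n. \<eta> (x i) ^ (b + c i)) * \<eta> (1 - (\<Sum>i<n. x i)) ^ a * \<eta> (1 - (\<Sum>i<n. to_ac (lam i) / x i)) ^ b"
      by (simp add: power_add prod.distrib prod_power_distrib)
    finally show "\<eta> (hypersurface_poly n a b c lam x) = (\<Prod>i<n. char_pow \<Phi> (m * int (b + c i)) (x i)) *
       char_pow \<Phi> (m * int a) (1 - (\<Sum>i<n. x i)) *
           char_pow \<Phi> (m * int b) (1 - (\<Sum>i<n. to_ac (lam i) / x i))"
      using \<open>a > 0\<close> \<open>b > 0\<close> by (simp add: pow del: of_nat_add)
  qed
  finally show ?thesis unfolding \<eta>_def .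
qed

lemma char_pow_char_inv: "char_pow (char_inv \<eta>) k = char_inv (char_pow \<eta> k)"
  by (auto simp: char_pow_def char_inv_def fun_eq_iff power_int_inverse)

lemma char_pow_exponent_sum:
  assumes "n > 0"
  shows "char_pow \<Phi> (m * int (a + n * b + (\<Sum>i<n. c i))) =
    char_mult (char_pow \<Phi> (m * int a)) (\<lambda>x. \<Prod>i<n. char_pow \<Phi> (m * int (b + c i)) x)"
proof
  fix x
  show "char_pow \<Phi> (m * int (a + n * b + (\<Sum>i<n. c i))) x =
    char_mult (char_pow \<Phi> (m * int a)) (\<lambda>x. \<Prod>i<n. char_pow \<Phi> (m * int (b + c i)) x) x"
  proof (cases "\<Phi> x = 0")
    case False
    have *: "\<Phi> x powi (m * int (\<Sum>i\<in>I. e i)) = (\<Prod>i\<in>I. \<Phi> x powi (m * int (e i)))" for I :: "nat set" and e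
      using False by (induction I rule: infinite_finite_induct) (auto simp: power_int_add distrib_left)
    have "a + n * b + (\<Sum>i<n. c i) = a + (\<Sum>i<n. b + c i)" by (simp add: sum.distrib)
    then have "\<Phi> x powi (m * int (a + n * b + (\<Sum>i<n. c i))) =
        \<Phi> x powi (m * int a) * \<Phi> x powi (m * int (\<Sum>i<n. b + c i))"
      using False by (simp only: of_nat_add distrib_left power_int_add simp_thms)
    then show ?thesis
      using False by (simp only: char_pow_def char_mult_def * if_False)
  qed (simp add: char_pow_def char_mult_def)
qed

theorem corollary4p12:
  fixes \<phi> :: "'k::finite_field \<Rightarrow> qbar"
    and \<psi> :: "nat \<Rightarrow> 'k alg_closure \<Rightarrow> qbar"
    and n d a b :: nat and c :: "nat \<Rightarrow> nat" and lam :: "nat \<Rightarrow> 'k" and m :: int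
  defines "q \<equiv> CARD('k)"
  defines "\<phi>d \<equiv> char_of_order \<phi> d"
  defines "\<phi>dr \<equiv> (\<lambda>r. lift_char r \<phi>d)"
  defines "\<chi> \<equiv> restrict \<phi> (roots_of_unity d)"
  defines "L \<equiv> L_function (S_C n d a b c lam) (frob n) (roots_of_unity d) scale_y (char_pow \<chi> m)"
  defines "f \<equiv> (\<lambda>r. lauricella_C (ext r) (\<psi> r) n
                  (char_pow (char_inv (\<phi>dr r)) (m * int (a + n * b + (\<Sum>i<n. c i))))
                  (char_pow (char_inv (\<phi>dr r)) (m * int b))
                  (\<lambda>i. char_pow (char_inv (\<phi>dr r)) (m * int (b + c i)))
                  (\<lambda>i. to_ac (lam i)))"
  defines "J \<equiv> jacobi UNIV (Suc n)
                  (\<lambda>i. case i of 0 \<Rightarrow> char_pow \<phi>d (m * int a)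
                     | Suc i' \<Rightarrow> char_pow \<phi>d (m * int (b + c i')))"
  assumes "generates_mult_chars UNIV \<phi>"
    and "\<And>r. r \<ge> 1 \<Longrightarrow> nontriv_add_char (ext r) (\<psi> r)"
    and "n \<ge> 1" "d > 0" "a > 0" "b > 0" "\<And>i. i < n \<Longrightarrow> c i > 0"
    and "d dvd q - 1"
    and "\<And>i. i < n \<Longrightarrow> lam i \<noteq> 0"
    and "gcd d a = 1" "gcd d b = 1"
  shows "L = (if int d dvd m
              then 1 / (1 - fps_const (of_nat q ^ n) * fps_X)
              else exp_gen (\<lambda>r. (-1) ^ n * J ^ r * f r))"
proof -
  interpret U: finite_subfield "UNIV :: 'k set" by (rule finite_subfield_UNIV)
  let ?N = "N_points (S_C n d a b c lam) (frob n) (roots_of_unity d) scale_y (char_pow \<chi> m)"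
  have dq: "d dvd CARD('k) - 1" using assms by simp
  have \<phi>d: "\<phi>d \<in> mult_chars UNIV"
    using assms(8) unfolding \<phi>d_def char_of_order_def
        by (auto simp: generates_mult_chars_def intro: U.char_pow_in)
  have N: "?N r = (\<Sum>x\<in>{..<n} \<rightarrow>\<^sub>E ext r. if int d dvd m then 1 else char_pow (\<phi>dr r) m (hypersurface_poly n a b c lam x))"
    if r: "r \<ge> 1" for r
    unfolding N_points_S_C[OF r \<open>d > 0\<close>] \<chi>_def \<phi>dr_def \<phi>d_def
    by (intro sum.cong refl twisted_count_over_value[OF assms(8) dq \<open>d > 0\<close> _ r]
        hypersurface_poly_in_ext[OF _ r])
  show ?thesis
  proof (cases "int d dvd m")
    case True
    have "?N r = (of_nat q ^ n) ^ r" if r: "r \<ge> 1" for r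
      unfolding N[OF r] using True
      by (simp add: card_PiE card_ext[OF r] q_def mult.commute flip: power_mult)
    then have "L = exp_gen (\<lambda>r. (of_nat q ^ n) ^ r)" unfolding L_def L_function_def
        by (rule exp_gen_cong)
    then show ?thesis using True by (simp only: exp_gen_geometric if_True)
  next
    case False
    have nontriv: "char_pow \<phi>d (m * int k) \<noteq> triv_char UNIV" if "gcd d k = 1" for k
    proof -
      have "coprime (int d) (int k)" using that by (simp add: coprime_iff_gcd_eq_1)
      then have "\<not> int d dvd m * int k" using False by (simp add: coprime_dvd_mult_left_iff)
      then show ?thesis unfolding \<phi>d_def char_of_order_pow_triv_iff[OF assms(8) dq] .
    qed
    have "?N r = (-1) ^ n * J ^ r * f r" if r: "r \<ge> 1" for r
    proof -
      interpret E: finite_subfield_add_char "ext r :: 'k alg_closure set" "\<psi> r"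
        using finite_subfield_ext[OF r] assms(9)[OF r]
        by (simp add: finite_subfield_add_char_def finite_subfield_add_char_axioms_def)
      let ?\<Phi> = "\<phi>dr r"
      have \<Phi>: "?\<Phi> \<in> mult_chars (ext r)" unfolding \<phi>dr_def by (rule lift_char_in[OF \<phi>d r])
      define A where "A = char_pow ?\<Phi> (m * int a)"
      define B where "B = char_pow ?\<Phi> (m * int b)"
      define \<theta> where "\<theta> = (\<lambda>i. char_pow ?\<Phi> (m * int (b + c i)))"
      have in_chars: "A \<in> mult_chars (ext r)" "B \<in> mult_chars (ext r)" "\<theta> i \<in> mult_chars (ext r)" for i
        unfolding A_def B_def \<theta>_def by (intro E.char_pow_in \<Phi>)+
      have AB: "A \<noteq> triv_char (ext r)" "B \<noteq> triv_char (ext r)"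
        unfolding A_def B_def \<phi>dr_def lift_char_pow[symmetric]
            lift_char_triv_iff[OF U.char_pow_in[OF \<phi>d] r]
        using nontriv assms(17,18) by auto
      have "nontriv_add_char UNIV (\<lambda>x :: 'k. \<psi> 1 (to_ac x))"
        using assms(9)[of 1] unfolding nontriv_add_char_def ext_1 by auto
      then have "J ^ r = jacobi (ext r) (Suc n) (\<lambda>i. lift_char r (case i of 0 \<Rightarrow> char_pow \<phi>d (m * int a)
                     | Suc i' \<Rightarrow> char_pow \<phi>d (m * int (b + c i'))))"
        unfolding J_def
      proof (rule jacobi_lift[symmetric, OF _ r])
        show "\<exists>i<Suc n. (case i of 0 \<Rightarrow> char_pow \<phi>d (m * int a) | Suc i' \<Rightarrow> char_pow \<phi>d (m *
            int (b + c i'))) \<noteq> triv_char UNIV"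
          using nontriv[of a] assms(17) by (intro exI[of _ 0]) auto
      qed (auto split: nat.splits intro: U.char_pow_in[OF \<phi>d])
      also have "(\<lambda>i. lift_char r (case i of 0 \<Rightarrow> char_pow \<phi>d (m * int a) | Suc i' \<Rightarrow> char_pow \<phi>d (m *
          int (b + c i')))) = case_nat A \<theta>"
        unfolding A_def \<theta>_def \<phi>dr_def
            by (auto simp: fun_eq_iff lift_char_pow simp del: of_nat_add split: nat.splits)
      finally have J: "J ^ r = jacobi (ext r) (Suc n) (case_nat A \<theta>)" .
      have f: "f r = lauricella_C (ext r) (\<psi> r) n (char_inv (char_mult A (\<lambda>x. \<Prod>i<n. \<theta> i x))) (char_inv B) (\<lambda>i. char_inv (\<theta> i)) (\<lambda>i. to_ac (lam i))"
        unfolding f_def char_pow_char_inv A_def B_def \<theta>_def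
        by (subst char_pow_exponent_sum) (use \<open>n \<ge> 1\<close> in auto)
      have "?N r = (\<Sum>x\<in>{..<n} \<rightarrow>\<^sub>E (ext r - {0}). (\<Prod>i<n. \<theta> i (x i)) * A (1 - (\<Sum>i<n. x i)) *
          B (1 - (\<Sum>i<n. to_ac (lam i) / x i)))"
        unfolding N[OF r] \<theta>_def A_def B_def using False assms
        by (subst sum_char_hypersurface[symmetric, OF r \<Phi>]) auto
      also have "\<dots> = (-1) ^ n * jacobi (ext r) (Suc n) (case_nat A \<theta>) * f r"
        unfolding f by (rule E.char_sum_eq_lauricella) (use in_chars AB assms ext_subfield(7) in auto)
      finally show ?thesis unfolding J .
    qed
    then have "L = exp_gen (\<lambda>r. (-1) ^ n * J ^ r * f r)" unfolding L_def L_function_def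
        by (rule exp_gen_cong)
    then show ?thesis using False by simp
  qed
qed

end
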